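(* Let $\nu\ge2$, $p\in(1,\infty)$ and let $0<r<\rho<R$ satisfy $R^\nu-r^\nu=\rho^\nu$. Set $B_\rho:=\{x\in\mathbb{R}^\nu:|x|<\rho\}$ and $U_{r,R}:=\{x\in\mathbb{R}^\nu:r<|x|<R\}$, so that $B_\rho$ and $U_{r,R}$ have the same volume. Then for all sufficiently large $\mu>0$, $$S(\mu B_\rho,p,p)<S(\mu U_{r,R},p,p).$$ In particular, balls do not maximize $S(\Omega,p,p)$ among the domains $\Omega$ of a fixed volume (for the volume of $\mu B_\rho$ with such $\mu$).
   Context: For a domain $\Omega\subset\mathbb{R}^\nu$ and $p\in(1,\infty)$, $S(\Omega,p,p)$ denotes the best constant in the trace embedding $W^{1,p}(\Omega)\hookrightarrow L^p(\partial\Omega)$, defined through $$\frac{1}{S(\Omega,p,p)}=\sup_{u\in W^{1,p}(\Omega),\ u\not\equiv0}\frac{\int_{\partial\Omega}|u|^p\,\mathrm{d}\sigma}{\int_\Omega(|\nabla u|^p+|u|^p)\,\mathrm{d}x},$$ where $\mathrm{d}\sigma$ is the surface measure on $\partial\Omega$. For $\mu>0$, $\mu\Omega:=\{\mu x:x\in\Omega\}$. *)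

theory Defs
  imports "HOL-Analysis.Analysis"
begin

section \<open>Differentiability classes and smooth domains\<close>

text \<open>Meant for open \<open>S\<close>: all partial derivatives of order at most \<open>k\<close> exist and are continuous
  on \<open>S\<close>.\<close>

primrec Ck_on :: "nat \<Rightarrow> ('a::euclidean_space \<Rightarrow> real) \<Rightarrow> 'a set \<Rightarrow> bool" where
  "Ck_on 0 f S \<longleftrightarrow> continuous_on S f"
| "Ck_on (Suc k) f S \<longleftrightarrow>
     f differentiable_on S \<and> (\<forall>b\<in>Basis. Ck_on k (\<lambda>x. frechet_derivative f (at x) b) S)"

definition smooth_on :: "('a::euclidean_space \<Rightarrow> real) \<Rightarrow> 'a set \<Rightarrow> bool" where
  "smooth_on f S \<longleftrightarrow> (\<forall>k. Ck_on k f S)"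

definition gradient :: "('a::euclidean_space \<Rightarrow> real) \<Rightarrow> 'a \<Rightarrow> 'a" where
  "gradient f x = (\<Sum>b\<in>Basis. frechet_derivative f (at x) b *\<^sub>R b)"

definition smooth_boundary :: "'a::euclidean_space set \<Rightarrow> bool" where
  "smooth_boundary \<Omega> \<longleftrightarrow>
     (\<forall>x\<in>frontier \<Omega>. \<exists>W \<psi>. open W \<and> x \<in> W \<and> smooth_on \<psi> W \<and>
        (\<forall>y\<in>W. gradient \<psi> y \<noteq> 0) \<and> \<Omega> \<inter> W = {y \<in> W. \<psi> y < 0})"

definition smooth_bounded_domain :: "'a::euclidean_space set \<Rightarrow> bool" where
  "smooth_bounded_domain \<Omega> \<longleftrightarrow>
     open \<Omega> \<and> connected \<Omega> \<and> \<Omega> \<noteq> {} \<and> bounded \<Omega> \<and> smooth_boundary \<Omega>"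

section \<open>Surface measure\<close>

text \<open>The surface measure is the Hausdorff measure of codimension one, with the usual normalisation
  by the volume of the unit ball. The case distinction keeps empty covering sets from
  contributing \<open>0 ^ 0 = 1\<close> when \<open>m = 0\<close>; the condition \<open>bounded\<close> is needed because
  \<open>diameter\<close> is meaningless on unbounded sets.\<close>

definition hausdorff_pre :: "nat \<Rightarrow> real \<Rightarrow> 'a::euclidean_space set \<Rightarrow> ennreal" where
  "hausdorff_pre m \<delta> A =
     (INF C \<in> {C :: nat \<Rightarrow> 'a set. A \<subseteq> (\<Union>i. C i) \<and> (\<forall>i. bounded (C i) \<and> diameter (C i) \<le> \<delta>)}.
        \<Sum>i. if C i = {} then 0 else ennreal (unit_ball_vol (real m) * (diameter (C i) / 2) ^ m))"

definition hausdorff_outer :: "nat \<Rightarrow> 'a::euclidean_space set \<Rightarrow> ennreal" where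
  "hausdorff_outer m A = (SUP \<delta>\<in>{0<..}. hausdorff_pre m \<delta> A)"

definition hausdorff_measure :: "nat \<Rightarrow> 'a::euclidean_space measure" where
  "hausdorff_measure m = measure_of UNIV (sets borel) (hausdorff_outer m)"

definition surface_measure :: "'a::euclidean_space set \<Rightarrow> 'a measure" where
  "surface_measure \<Omega> = restrict_space (hausdorff_measure (DIM('a) - 1)) (frontier \<Omega>)"

section \<open>Sobolev functions and traces\<close>

definition Lp_fun :: "real \<Rightarrow> 'a measure \<Rightarrow> ('a \<Rightarrow> 'b::euclidean_space) \<Rightarrow> bool" where
  "Lp_fun p M f \<longleftrightarrow> f \<in> borel_measurable M \<and> (\<integral>\<^sup>+x. ennreal (norm (f x) powr p) \<partial>M) < \<infinity>"

definition Lp_tendsto ::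
  "real \<Rightarrow> 'a measure \<Rightarrow> (nat \<Rightarrow> 'a \<Rightarrow> 'b::euclidean_space) \<Rightarrow> ('a \<Rightarrow> 'b) \<Rightarrow> bool" where
  "Lp_tendsto p M f g \<longleftrightarrow>
     (\<lambda>k. \<integral>\<^sup>+x. ennreal (norm (f k x - g x) powr p) \<partial>M) \<longlonglongrightarrow> 0"

definition locally_integrable ::
  "'a::euclidean_space set \<Rightarrow> ('a \<Rightarrow> 'b::euclidean_space) \<Rightarrow> bool" where
  "locally_integrable \<Omega> f \<longleftrightarrow>
     (\<forall>K. compact K \<and> K \<subseteq> \<Omega> \<longrightarrow> integrable (lebesgue_on K) f)"

definition test_function :: "'a::euclidean_space set \<Rightarrow> ('a \<Rightarrow> real) \<Rightarrow> bool" where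
  "test_function \<Omega> \<phi> \<longleftrightarrow> smooth_on \<phi> UNIV \<and>
     compact (closure {x. \<phi> x \<noteq> 0}) \<and> closure {x. \<phi> x \<noteq> 0} \<subseteq> \<Omega>"

definition has_weak_gradient ::
  "'a::euclidean_space set \<Rightarrow> ('a \<Rightarrow> real) \<Rightarrow> ('a \<Rightarrow> 'a) \<Rightarrow> bool" where
  "has_weak_gradient \<Omega> u G \<longleftrightarrow> locally_integrable \<Omega> u \<and> locally_integrable \<Omega> G \<and>
     (\<forall>\<phi>. test_function \<Omega> \<phi> \<longrightarrow> (\<forall>b\<in>Basis.
        (LINT x|lebesgue_on \<Omega>. u x * (gradient \<phi> x \<bullet> b)) =
        - (LINT x|lebesgue_on \<Omega>. (G x \<bullet> b) * \<phi> x)))"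

text \<open>\<open>u\<close> belongs to \<open>W\<^sup>1\<^sup>,\<^sup>p(\<Omega>)\<close>, with weak gradient \<open>G\<close> (unique up to null sets).\<close>

definition sobolev_W1p ::
  "real \<Rightarrow> 'a::euclidean_space set \<Rightarrow> ('a \<Rightarrow> real) \<Rightarrow> ('a \<Rightarrow> 'a) \<Rightarrow> bool" where
  "sobolev_W1p p \<Omega> u G \<longleftrightarrow>
     Lp_fun p (lebesgue_on \<Omega>) u \<and> Lp_fun p (lebesgue_on \<Omega>) G \<and> has_weak_gradient \<Omega> u G"

text \<open>The trace operator \<open>W\<^sup>1\<^sup>,\<^sup>p(\<Omega>) \<rightarrow> L\<^sup>p(\<partial>\<Omega>)\<close> is the continuous extension of the restriction
  map \<open>v \<mapsto> v|\<^bsub>\<partial>\<Omega>\<^esub>\<close> from \<open>C\<^sup>1\<close> functions, which are dense in \<open>W\<^sup>1\<^sup>,\<^sup>p(\<Omega>)\<close> when \<open>\<Omega>\<close> is a bounded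
  Lipschitz domain. In that case each \<open>u\<close> in \<open>W\<^sup>1\<^sup>,\<^sup>p(\<Omega>)\<close> (with weak gradient \<open>G\<close>) has exactly one
  trace \<open>g\<close>, up to null sets.\<close>

definition has_trace ::
  "real \<Rightarrow> 'a::euclidean_space set \<Rightarrow> ('a \<Rightarrow> real) \<Rightarrow> ('a \<Rightarrow> 'a) \<Rightarrow> ('a \<Rightarrow> real) \<Rightarrow> bool" where
  "has_trace p \<Omega> u G g \<longleftrightarrow> Lp_fun p (surface_measure \<Omega>) g \<and>
     (\<exists>v. (\<forall>k. Ck_on 1 (v k) UNIV) \<and>
          Lp_tendsto p (lebesgue_on \<Omega>) v u \<and>
          Lp_tendsto p (lebesgue_on \<Omega>) (\<lambda>k. gradient (v k)) G \<and>
          Lp_tendsto p (surface_measure \<Omega>) v g)"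

section \<open>The best constant in the trace embedding\<close>

text \<open>\<open>u \<noteq> 0\<close> is meant in \<open>L\<^sup>p(\<Omega>)\<close>. The values are extended nonnegative reals, so that supremum and
  reciprocal need no side conditions.\<close>

definition best_trace_const :: "real \<Rightarrow> 'a::euclidean_space set \<Rightarrow> ennreal" where
  "best_trace_const p \<Omega> = 1 /
     (SUP (u, G, g) \<in> {(u, G, g). sobolev_W1p p \<Omega> u G \<and> has_trace p \<Omega> u G g \<and>
                                  \<not> (AE x in lebesgue_on \<Omega>. u x = 0)}.
        (\<integral>\<^sup>+x. ennreal (\<bar>g x\<bar> powr p) \<partial>surface_measure \<Omega>) /
        (\<integral>\<^sup>+x. ennreal (norm (G x) powr p + \<bar>u x\<bar> powr p) \<partial>lebesgue_on \<Omega>))"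

definition annulus :: "real \<Rightarrow> real \<Rightarrow> 'a::euclidean_space set" where
  "annulus r R = {x. r < norm x \<and> norm x < R}"

end

theory Submission
  imports Defs
begin

text \<open>
  For large \<open>\<mu>\<close> an extremal function concentrates in a layer of width of order one along the boundary
  of \<open>\<mu>\<Omega>\<close>, which there resembles a half-space. On a half-space the extremal decays like
  \<open>exp (- \<beta> t)\<close> in the distance \<open>t\<close> to the boundary, with \<open>(p - 1) * \<beta> powr p = 1\<close>, and the best
  constant is \<open>\<beta> powr (p - 1)\<close>. The correction of order \<open>1 / \<mu>\<close> lowers the constant in proportion to the
  largest mean curvature of the boundary. The ball has curvature \<open>1 / (\<mu> * \<rho>)\<close>, while the annulus has
  only \<open>1 / (\<mu> * R)\<close> on its outer sphere and negative curvature on the inner one. As \<open>\<rho> < R\<close>, the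
  constant of the ball is the smaller one. Write \<open>m\<close> for the dimension minus one.

  For the ball, the trial function \<open>exp (\<beta> * |x - a|)\<close>, smoothed at the centre, gives an upper
  bound (\<open>best_trace_const_ball_le\<close>).

  For the annulus, a trace inequality is needed for all functions. By polar coordinates it reduces
  to one inequality on each ray. There \<open>h(s) * s^m * |f(s)| powr p\<close> is differentiated, with a profile \<open>h\<close>
  running from \<open>-1\<close> on the inner sphere to \<open>1\<close> on the outer one, so that the boundary terms add up to the
  trace. Young's inequality bounds the derivative by a multiple of the energy density, provided that
  \<open>h' + m * h / s + (p - 1) * \<alpha> * |h| \<le> \<alpha> powr (1 - p)\<close> (\<open>ray_trace_le\<close>); the best constant is then at least
  \<open>\<alpha> powr (p - 1)\<close>. For \<open>\<alpha> = \<beta> - c / \<mu>\<close> such a profile exists for large \<open>\<mu>\<close> as soon as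
  \<open>m / R < p * (p - 1) * c\<close> (\<open>eventually_annulus_profile\<close>), whereas the bound for the ball lies below
  \<open>\<alpha> powr (p - 1)\<close> as soon as \<open>p * (p - 1) * c < m / \<rho>\<close> (\<open>eventually_ball_bound_less\<close>). A suitable \<open>c\<close> exists
  because \<open>\<rho> < R\<close>.

  The surface measure is a Hausdorff measure and has to be related to polar coordinates. It is a
  measure on Borel sets by Caratheodory's argument for metric outer measures. On the unit sphere it is
  finite and positive, and it gives the same mass to congruent caps; so does the measure from polar
  coordinates, and two measures with this property are proportional
  (\<open>uniformly_distributed_unique\<close>). By scaling, the factor is the same on all spheres
  (\<open>hausdorff_sphere_integral\<close>), so that it cancels in the comparison of the two constants.
\<close>

section \<open>Hausdorff measure as a metric outer measure\<close>

definition hausdorff_weight :: "nat \<Rightarrow> 'a::euclidean_space set \<Rightarrow> ennreal" where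
  "hausdorff_weight m C =
     (if C = {} then 0 else ennreal (unit_ball_vol (real m) * (diameter C / 2) ^ m))"

definition fine_cover :: "real \<Rightarrow> 'a::euclidean_space set \<Rightarrow> (nat \<Rightarrow> 'a set) \<Rightarrow> bool" where
  "fine_cover \<delta> A C \<longleftrightarrow> A \<subseteq> (\<Union>i. C i) \<and> (\<forall>i. bounded (C i) \<and> diameter (C i) \<le> \<delta>)"

lemma hausdorff_pre_eq:
  "hausdorff_pre m \<delta> A = (INF C \<in> Collect (fine_cover \<delta> A). \<Sum>i. hausdorff_weight m (C i))"
  unfolding hausdorff_pre_def fine_cover_def hausdorff_weight_def by simp

lemma hausdorff_weight_empty [simp]: "hausdorff_weight m {} = 0"
  by (simp add: hausdorff_weight_def)

lemma hausdorff_pre_le: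
  "fine_cover \<delta> A C \<Longrightarrow> hausdorff_pre m \<delta> A \<le> (\<Sum>i. hausdorff_weight m (C i))"
  unfolding hausdorff_pre_eq by (rule INF_lower) simp

lemma hausdorff_pre_mono: "A \<subseteq> B \<Longrightarrow> hausdorff_pre m \<delta> A \<le> hausdorff_pre m \<delta> B"
  unfolding hausdorff_pre_eq
  by (rule INF_superset_mono) (auto simp: fine_cover_def, blast)

lemma hausdorff_pre_antimono: "\<delta> \<le> \<epsilon> \<Longrightarrow> hausdorff_pre m \<epsilon> A \<le> hausdorff_pre m \<delta> A"
  unfolding hausdorff_pre_eq
  by (rule INF_superset_mono) (auto simp: fine_cover_def, meson order_trans)

lemma hausdorff_pre_le_outer: "0 < \<delta> \<Longrightarrow> hausdorff_pre m \<delta> A \<le> hausdorff_outer m A"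
  unfolding hausdorff_outer_def by (rule SUP_upper) simp

lemma hausdorff_outer_mono: "A \<subseteq> B \<Longrightarrow> hausdorff_outer m A \<le> hausdorff_outer m B"
  unfolding hausdorff_outer_def by (intro SUP_mono) (auto intro: hausdorff_pre_mono)

lemma hausdorff_outer_empty [simp]: "hausdorff_outer m {} = 0"
proof -
  have "hausdorff_pre m \<delta> {} \<le> 0" if "\<delta> > 0" for \<delta>
    using hausdorff_pre_le[of \<delta> "{}" "\<lambda>i. {}" m] that by (simp add: fine_cover_def)
  then show ?thesis unfolding hausdorff_outer_def
    by (intro antisym SUP_least) auto
qed

text \<open>Covers of the sets \<open>A n\<close> that are optimal up to \<open>e / 2^(n + 1)\<close> combine into one cover.\<close>

lemma hausdorff_pre_countably_subadditive:
  "hausdorff_pre m \<delta> (\<Union>i. A i) \<le> (\<Sum>i. hausdorff_pre m \<delta> (A i))"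
proof (rule ennreal_le_epsilon)
  fix e :: real assume e: "0 < e" and fin: "(\<Sum>i. hausdorff_pre m \<delta> (A i)) < top"
  have "\<exists>C. fine_cover \<delta> (A n) C \<and>
      (\<Sum>i. hausdorff_weight m (C i)) \<le> hausdorff_pre m \<delta> (A n) + ennreal (e * (1/2) ^ Suc n)" for n
  proof -
    have lt: "hausdorff_pre m \<delta> (A n) < top"
      using fin by (metis ennreal_suminf_lessD infinity_ennreal_def)
    moreover have "0 < ennreal (e * (1/2) ^ Suc n)" using e by simp
    ultimately have "hausdorff_pre m \<delta> (A n) < hausdorff_pre m \<delta> (A n) + ennreal (e * (1/2) ^ Suc n)"
      using ennreal_add_left_cancel_less[of "hausdorff_pre m \<delta> (A n)" 0] by auto
    then show ?thesis
      unfolding hausdorff_pre_eq INF_less_iff by (auto simp: less_imp_le)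
  qed
  then obtain C where C: "\<And>n. fine_cover \<delta> (A n) (C n)"
    and Cle: "\<And>n. (\<Sum>i. hausdorff_weight m (C n i)) \<le> hausdorff_pre m \<delta> (A n) + ennreal (e * (1/2) ^ Suc n)"
    by metis
  define D where "D i = (case prod_decode i of (n, j) \<Rightarrow> C n j)" for i
  have "fine_cover \<delta> (\<Union>i. A i) D"
    unfolding fine_cover_def
  proof (intro conjI allI subsetI)
    fix x assume "x \<in> (\<Union>i. A i)"
    then obtain n where "x \<in> A n" by auto
    then obtain j where "x \<in> C n j" using C[of n] by (auto simp: fine_cover_def)
    then have "x \<in> D (prod_encode (n, j))" by (simp add: D_def)
    then show "x \<in> (\<Union>i. D i)" by blast
  qed (use C in \<open>auto simp: D_def fine_cover_def split: prod.split\<close>)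
  then have "hausdorff_pre m \<delta> (\<Union>i. A i) \<le> (\<Sum>i. hausdorff_weight m (D i))"
    by (rule hausdorff_pre_le)
  also have "\<dots> = (\<Sum>i. (\<lambda>(n, j). hausdorff_weight m (C n j)) (prod_decode i))"
    by (simp add: D_def split: prod.split) (metis (no_types, lifting) case_prod_beta)
  also have "\<dots> = (\<Sum>n. \<Sum>j. hausdorff_weight m (C n j))"
    by (rule suminf_ennreal_2dimen) simp
  also have "\<dots> \<le> (\<Sum>n. hausdorff_pre m \<delta> (A n) + ennreal (e * (1/2) ^ Suc n))"
    by (intro suminf_le Cle) auto
  also have "\<dots> = (\<Sum>n. hausdorff_pre m \<delta> (A n)) + (\<Sum>n. ennreal (e * (1/2) ^ Suc n))"
    by (subst suminf_add) auto
  also have "(\<Sum>n. ennreal (e * (1/2) ^ Suc n)) = ennreal e"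
    using e sums_mult[OF power_half_series, of e] by (intro suminf_ennreal_eq) auto
  finally show "hausdorff_pre m \<delta> (\<Union>i. A i) \<le> (\<Sum>i. hausdorff_pre m \<delta> (A i)) + ennreal e" .
qed

lemma hausdorff_outer_countably_subadditive:
  "hausdorff_outer m (\<Union>i. A i) \<le> (\<Sum>i. hausdorff_outer m (A i))"
proof -
  have "hausdorff_pre m \<delta> (\<Union>i. A i) \<le> (\<Sum>i. hausdorff_outer m (A i))" if "\<delta> > 0" for \<delta>
    by (rule order_trans[OF hausdorff_pre_countably_subadditive])
       (intro suminf_le hausdorff_pre_le_outer that; simp)
  then show ?thesis
    by (subst hausdorff_outer_def) (auto intro: SUP_least)
qed

lemma hausdorff_outer_subadditive:
  "hausdorff_outer m (A \<union> B) \<le> hausdorff_outer m A + hausdorff_outer m B"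
proof -
  have "A \<union> B = (\<Union>i. binaryset A B i)" by (simp add: UN_binaryset_eq)
  then have "hausdorff_outer m (A \<union> B) \<le> (\<Sum>i. hausdorff_outer m (binaryset A B i))"
    by (metis hausdorff_outer_countably_subadditive)
  also have "\<dots> = hausdorff_outer m A + hausdorff_outer m B"
    by (rule suminf_binaryset_eq) simp
  finally show ?thesis .
qed

text \<open>A covering set of diameter less than \<open>d\<close> cannot meet two sets at distance \<open>d\<close>, so a fine cover
  of the union splits into covers of the two parts.\<close>

lemma hausdorff_outer_separated:
  assumes d: "d > 0" and sep: "\<And>x y. x \<in> A \<Longrightarrow> y \<in> B \<Longrightarrow> d \<le> dist x y"
  shows "hausdorff_outer m A + hausdorff_outer m B \<le> hausdorff_outer m (A \<union> B)"
proof -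
  have split: "hausdorff_pre m \<delta> A + hausdorff_pre m \<delta> B \<le> hausdorff_pre m \<delta> (A \<union> B)"
    if \<delta>: "0 < \<delta>" "\<delta> < d" for \<delta>
  proof (subst (3) hausdorff_pre_eq, rule INF_greatest)
    fix C assume "C \<in> Collect (fine_cover \<delta> (A \<union> B))"
    then have C: "fine_cover \<delta> (A \<union> B) C" by simp
    define D where "D X i = (if C i \<inter> X \<noteq> {} then C i else {})" for X i
    have "fine_cover \<delta> A (D A)" "fine_cover \<delta> B (D B)"
      using C \<delta> unfolding fine_cover_def D_def by (auto, (blast)+)
    then have "hausdorff_pre m \<delta> A + hausdorff_pre m \<delta> B
        \<le> (\<Sum>i. hausdorff_weight m (D A i)) + (\<Sum>i. hausdorff_weight m (D B i))"
      by (intro add_mono hausdorff_pre_le)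
    also have "\<dots> = (\<Sum>i. hausdorff_weight m (D A i) + hausdorff_weight m (D B i))"
      by (rule suminf_add) auto
    also have "\<dots> \<le> (\<Sum>i. hausdorff_weight m (C i))"
    proof (intro suminf_le)
      fix i
      have "C i \<inter> A = {} \<or> C i \<inter> B = {}"
      proof (rule ccontr)
        assume "\<not> ?thesis"
        then obtain x y where "x \<in> C i" "x \<in> A" "y \<in> C i" "y \<in> B" by blast
        then have "d \<le> dist x y" "dist x y \<le> diameter (C i)" "diameter (C i) \<le> \<delta>"
          using C sep by (auto simp: fine_cover_def intro: diameter_bounded_bound)
        then show False using \<delta> by linarith
      qed
      then show "hausdorff_weight m (D A i) + hausdorff_weight m (D B i) \<le> hausdorff_weight m (C i)"
        by (auto simp: D_def)
    qed auto
    finally show "hausdorff_pre m \<delta> A + hausdorff_pre m \<delta> B \<le> (\<Sum>i. hausdorff_weight m (C i))" .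
  qed
  have "hausdorff_pre m \<delta> A + hausdorff_pre m \<epsilon> B \<le> hausdorff_outer m (A \<union> B)"
    if "0 < \<delta>" "0 < \<epsilon>" for \<delta> \<epsilon>
  proof -
    define \<eta> where "\<eta> = min (min \<delta> \<epsilon>) (d / 2)"
    have \<eta>: "0 < \<eta>" "\<eta> < d" "\<eta> \<le> \<delta>" "\<eta> \<le> \<epsilon>" using that d by (auto simp: \<eta>_def)
    have "hausdorff_pre m \<delta> A + hausdorff_pre m \<epsilon> B \<le> hausdorff_pre m \<eta> A + hausdorff_pre m \<eta> B"
      using \<eta> by (intro add_mono hausdorff_pre_antimono)
    also have "\<dots> \<le> hausdorff_pre m \<eta> (A \<union> B)" using \<eta> by (intro split)
    also have "\<dots> \<le> hausdorff_outer m (A \<union> B)" using \<eta> by (intro hausdorff_pre_le_outer)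
    finally show ?thesis .
  qed
  moreover have "hausdorff_outer m A + hausdorff_outer m B =
      (SUP \<delta>\<in>{0<..}. SUP \<epsilon>\<in>{0<..}. hausdorff_pre m \<delta> A + hausdorff_pre m \<epsilon> B)"
    unfolding hausdorff_outer_def
    by (subst ennreal_SUP_add_left[symmetric], simp,
        subst ennreal_SUP_add_right[symmetric], auto)
  ultimately show ?thesis by (auto intro!: SUP_least)
qed

text \<open>Caratheodory's argument for metric outer measures. The part of \<open>A\<close> outside \<open>F\<close> is exhausted by
  the sets \<open>G k\<close> of points at distance at least \<open>1 / k\<close> from \<open>F\<close>. Among the layers \<open>D k\<close> between
  consecutive \<open>G k\<close>, those with indices of equal parity are pairwise separated, so that their measures
  are summable and what lies outside \<open>G k\<close> has small measure.\<close>

lemma hausdorff_outer_closed_split: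
  assumes F: "closed F"
  shows "hausdorff_outer m (A \<inter> F) + hausdorff_outer m (A - F) = hausdorff_outer m A"
proof (rule antisym)
  show "hausdorff_outer m A \<le> hausdorff_outer m (A \<inter> F) + hausdorff_outer m (A - F)"
    using hausdorff_outer_subadditive[of m "A \<inter> F" "A - F"] by (simp add: Int_Diff_Un)
next
  let ?H = "hausdorff_outer m"
  show "?H (A \<inter> F) + ?H (A - F) \<le> ?H A"
  proof (cases "F = {} \<or> ?H A = top")
    case True then show ?thesis by auto
  next
    case False
    then have Fne: "F \<noteq> {}" and fin: "?H A < top" by (auto simp: less_top)
    define G where "G k = {x \<in> A. 1 / real k \<le> infdist x F}" for k
    define D where "D k = G (Suc (Suc k)) - G (Suc k)" for k
    have Gmono: "G k \<subseteq> G l" if "k \<le> l" "0 < k" for k l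
      using that by (auto simp: G_def intro: order_trans[rotated] simp: frac_le)
    have GF: "?H (A \<inter> F) + ?H (G (Suc k)) \<le> ?H A" for k
    proof -
      have "?H (A \<inter> F) + ?H (G (Suc k)) \<le> ?H ((A \<inter> F) \<union> G (Suc k))"
      proof (rule hausdorff_outer_separated[where d="1 / real (Suc k)"])
        fix x y assume "x \<in> A \<inter> F" "y \<in> G (Suc k)"
        then show "1 / real (Suc k) \<le> dist x y"
          using infdist_le[of x F y] by (auto simp: G_def dist_commute)
      qed simp
      also have "\<dots> \<le> ?H A" by (rule hausdorff_outer_mono) (auto simp: G_def)
      finally show ?thesis .
    qed
    have par: "(\<Sum>i<n. ?H (D (2 * i + j))) \<le> ?H (G (2 * n + j))" for n j
    proof (induction n)
      case 0 show ?case by simp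
    next
      case (Suc n)
      let ?k = "2 * n + j"
      show ?case
      proof (cases "n = 0")
        case True
        then show ?thesis by (auto simp: D_def intro!: hausdorff_outer_mono)
      next
        case False
        then have k: "0 < ?k" by simp
        have "(\<Sum>i<Suc n. ?H (D (2 * i + j))) \<le> ?H (G ?k) + ?H (D ?k)"
          using Suc by (simp add: add_right_mono)
        also have "\<dots> \<le> ?H (G ?k \<union> D ?k)"
        proof (rule hausdorff_outer_separated)
          show "0 < 1 / real ?k - 1 / real (Suc ?k)"
            using k by (auto intro!: divide_strict_left_mono)
          fix x y assume "x \<in> G ?k" "y \<in> D ?k"
          then have "1 / real ?k \<le> infdist x F" "infdist y F < 1 / real (Suc ?k)"
            by (auto simp: G_def D_def)
          then show "1 / real ?k - 1 / real (Suc ?k) \<le> dist x y"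
            using infdist_triangle[of x F y] by linarith
        qed
        also have "\<dots> \<le> ?H (G (2 * Suc n + j))"
          using Gmono[of ?k "Suc (Suc ?k)"] k
          by (intro hausdorff_outer_mono) (auto simp: D_def)
        finally show ?thesis .
      qed
    qed
    have GA: "?H (G k) \<le> ?H A" for k by (rule hausdorff_outer_mono) (auto simp: G_def)
    have fin_par: "(\<Sum>i. ?H (D (2 * i + j))) < top" for j
      by (rule le_less_trans[OF suminf_le_const fin]) (auto intro: order_trans[OF par GA])
    have even: "(\<Sum>i. ?H (D (2 * i))) < top" using fin_par[of 0] by simp
    have odd: "(\<Sum>i. ?H (D (Suc (2 * i)))) < top" using fin_par[of 1] by simp
    have Dfin: "(\<Sum>i. ?H (D i)) < top"
    proof (rule le_less_trans)
      show "(\<Sum>i. ?H (D i)) \<le> (\<Sum>i. ?H (D (2 * i))) + (\<Sum>i. ?H (D (Suc (2 * i))))"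
      proof (rule suminf_le_const)
        fix n
        have "(\<Sum>i<n. ?H (D i)) \<le> (\<Sum>i<2 * n. ?H (D i))" by (rule sum_mono2) auto
        also have "\<dots> = (\<Sum>i<n. ?H (D (2 * i))) + (\<Sum>i<n. ?H (D (Suc (2 * i))))"
          by (induction n) (auto simp: algebra_simps)
        also have "\<dots> \<le> (\<Sum>i. ?H (D (2 * i))) + (\<Sum>i. ?H (D (Suc (2 * i))))"
          by (intro add_mono sum_le_suminf) auto
        finally show "(\<Sum>i<n. ?H (D i)) \<le> (\<Sum>i. ?H (D (2 * i))) + (\<Sum>i. ?H (D (Suc (2 * i))))" .
      qed auto
      show "(\<Sum>i. ?H (D (2 * i))) + (\<Sum>i. ?H (D (Suc (2 * i)))) < top"
        using even odd by simp
    qed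
    have tail: "(\<lambda>k. \<Sum>i. ?H (D (i + k))) \<longlonglongrightarrow> 0"
    proof -
      define f where "f i = enn2real (?H (D i))" for i
      have Di: "?H (D i) = ennreal (f i)" for i
        using Dfin ennreal_suminf_lessD[of "\<lambda>i. ?H (D i)" top i] by (simp add: f_def)
      have sf: "summable f"
      proof (rule summable_suminf_not_top)
        show "(\<Sum>i. ennreal (f i)) \<noteq> top" using Dfin by (simp add: Di)
      qed (simp add: f_def)
      have "(\<Sum>i. ?H (D (i + k))) = ennreal (\<Sum>i. f (i + k))" for k
        unfolding Di
      proof (rule suminf_ennreal2)
        show "summable (\<lambda>i. f (i + k))" using sf by (simp add: summable_iff_shift)
      qed (simp add: f_def)
      moreover have "(\<lambda>k. \<Sum>i. f (i + k)) \<longlonglongrightarrow> 0" by (rule suminf_exist_split2[OF sf])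
      ultimately show ?thesis by (simp add: ennreal_0[symmetric] del: ennreal_0)
    qed
    have cover: "A - F \<subseteq> G (Suc k) \<union> (\<Union>i. D (i + k))" for k
    proof
      fix x assume x: "x \<in> A - F"
      then have "0 < infdist x F" using F Fne by (simp add: in_closed_iff_infdist_zero infdist_nonneg less_le)
      then obtain l where "1 / real (Suc l) < infdist x F" using nat_approx_posE by metis
      then have l: "x \<in> G (Suc l)" using x by (auto simp: G_def)
      show "x \<in> G (Suc k) \<union> (\<Union>i. D (i + k))"
      proof (rule ccontr)
        assume n: "\<not> ?thesis"
        have "x \<notin> G (Suc (i + k))" for i
        proof (induction i)
          case (Suc i) then show ?case using n by (auto simp: D_def)
        qed (use n in auto)
        moreover have "x \<in> G (Suc (l + k))" using l Gmono[of "Suc l" "Suc (l + k)"] by auto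
        ultimately show False by blast
      qed
    qed
    have bound: "?H (A \<inter> F) + ?H (A - F) \<le> ?H A + (\<Sum>i. ?H (D (i + k)))" for k
    proof -
      have "?H (A - F) \<le> ?H (G (Suc k)) + ?H (\<Union>i. D (i + k))"
        using hausdorff_outer_mono[OF cover] hausdorff_outer_subadditive by (rule order_trans)
      also have "\<dots> \<le> ?H (G (Suc k)) + (\<Sum>i. ?H (D (i + k)))"
        by (intro add_left_mono hausdorff_outer_countably_subadditive)
      finally have "?H (A \<inter> F) + ?H (A - F) \<le> (?H (A \<inter> F) + ?H (G (Suc k))) + (\<Sum>i. ?H (D (i + k)))"
        by (simp add: add_left_mono add.assoc)
      also have "\<dots> \<le> ?H A + (\<Sum>i. ?H (D (i + k)))" by (intro add_right_mono GF)
      finally show ?thesis .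
    qed
    have "(\<lambda>k. ?H A + (\<Sum>i. ?H (D (i + k)))) \<longlonglongrightarrow> ?H A + 0"
      by (intro tendsto_add tendsto_const tail)
    then show ?thesis using bound by (intro LIMSEQ_le_const[of _ "?H A"]) auto
  qed
qed

text \<open>Here \<open>measure_of\<close> gives the intended values only because the outer measure is countably additive on
  Borel sets; otherwise it would be the zero measure.\<close>

lemma emeasure_hausdorff_measure:
  assumes "A \<in> sets borel"
  shows "emeasure (hausdorff_measure m) A = hausdorff_outer m A"
  unfolding hausdorff_measure_def
proof (rule emeasure_measure_of_sigma)
  let ?L = "lambda_system UNIV UNIV (hausdorff_outer m :: 'a set \<Rightarrow> ennreal)"
  interpret U: sigma_algebra "UNIV :: 'a set" "UNIV :: 'a set set"
    using sigma_algebra_Pow[of "UNIV :: 'a set"] by simp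
  have "outer_measure_space UNIV (hausdorff_outer m :: 'a set \<Rightarrow> ennreal)"
    unfolding outer_measure_space_def positive_def increasing_def countably_subadditive_def
    by (auto intro: hausdorff_outer_mono hausdorff_outer_countably_subadditive)
  then have L: "measure_space UNIV ?L (hausdorff_outer m)"
    by (rule U.caratheodory_lemma)
  interpret L: sigma_algebra UNIV ?L using L by (simp add: measure_space_def)
  have "F \<in> ?L" if "closed F" for F
    using hausdorff_outer_closed_split[OF that] by (simp add: U.lambda_system_eq)
  then have "sigma_sets UNIV (Collect closed) \<subseteq> ?L"
    by (intro L.sigma_sets_subset) auto
  then have sub: "sets borel \<subseteq> ?L" by (simp add: borel_eq_closed)
  show "countably_additive (sets borel) (hausdorff_outer m :: 'a set \<Rightarrow> ennreal)"
    unfolding countably_additive_def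
  proof (intro allI impI)
    fix A :: "nat \<Rightarrow> 'a set"
    assume "range A \<subseteq> sets borel" "disjoint_family A"
    moreover from this(1) have "range A \<subseteq> ?L" using sub by (rule subset_trans)
    ultimately show "(\<Sum>i. hausdorff_outer m (A i)) = hausdorff_outer m (\<Union> (range A))"
      using L L.countable_nat_UN[of A] by (simp add: measure_space_def countably_additive_def)
  qed
  show "positive (sets borel) (hausdorff_outer m :: 'a set \<Rightarrow> ennreal)" by (simp add: positive_def)
  show "sigma_algebra (UNIV :: 'a set) (sets borel)"
    using sets.sigma_algebra_axioms[of borel] unfolding space_borel .
  show "A \<in> sets borel" by (rule assms)
qed

lemma sets_hausdorff_measure [measurable_cong, simp]: "sets (hausdorff_measure m) = sets borel"
  unfolding hausdorff_measure_def using sets.sigma_sets_eq[of borel] by simp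

lemma space_hausdorff_measure [simp]: "space (hausdorff_measure m) = UNIV"
  by (simp add: hausdorff_measure_def)

section \<open>Similarities and uniformly distributed measures\<close>

text \<open>Images of the covering sets cover the image, with all diameters scaled by \<open>c\<close>.\<close>

lemma hausdorff_outer_similarity_le:
  fixes T :: "'a::euclidean_space \<Rightarrow> 'a"
  assumes c: "c > 0" and T: "\<And>x y. dist (T x) (T y) = c * dist x y"
  shows "hausdorff_outer m (T ` A) \<le> ennreal (c ^ m) * hausdorff_outer m A"
proof -
  have weight: "hausdorff_weight m (T ` C) \<le> ennreal (c ^ m) * hausdorff_weight m C"
    and bdd: "bounded (T ` C)" and diam: "diameter (T ` C) \<le> c * diameter C" if C: "bounded C" for C
  proof -
    show d: "diameter (T ` C) \<le> c * diameter C"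
    proof (cases "C = {}")
      case False
      then show ?thesis
        using c C by (intro diameter_le)
          (auto simp: dist_norm[symmetric] T intro!: mult_left_mono diameter_bounded_bound)
    qed simp
    show b: "bounded (T ` C)"
    proof -
      obtain e x where "\<And>y. y \<in> C \<Longrightarrow> dist x y \<le> e" using C by (auto simp: bounded_def)
      then show ?thesis
        using c unfolding bounded_def by (intro exI[of _ "T x"] exI[of _ "c * e"]) (auto simp: T)
    qed
    have "(diameter (T ` C) / 2) ^ m \<le> c ^ m * (diameter C / 2) ^ m"
      using power_mono[OF divide_right_mono[OF d, of 2], of m] diameter_ge_0[OF b]
      by (simp add: power_mult_distrib power_divide)
    then have "unit_ball_vol (real m) * (diameter (T ` C) / 2) ^ m
        \<le> c ^ m * (unit_ball_vol (real m) * (diameter C / 2) ^ m)"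
      by (metis mult.left_commute mult_left_mono of_nat_0_le_iff unit_ball_vol_nonneg)
    then show "hausdorff_weight m (T ` C) \<le> ennreal (c ^ m) * hausdorff_weight m C"
      using c diameter_ge_0[OF C]
      by (auto simp: hausdorff_weight_def ennreal_mult[symmetric] intro!: ennreal_leI)
  qed
  have pre: "hausdorff_pre m (c * \<delta>) (T ` A) \<le> ennreal (c ^ m) * hausdorff_pre m \<delta> A" for \<delta>
  proof -
    have "ennreal (1 / c ^ m) * hausdorff_pre m (c * \<delta>) (T ` A) \<le> hausdorff_pre m \<delta> A"
    proof (subst (2) hausdorff_pre_eq, rule INF_greatest)
      fix C assume "C \<in> Collect (fine_cover \<delta> A)"
      then have C: "fine_cover \<delta> A C" by simp
      have "fine_cover (c * \<delta>) (T ` A) (\<lambda>i. T ` C i)"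
        unfolding fine_cover_def
      proof (intro conjI allI)
        show "T ` A \<subseteq> (\<Union>i. T ` C i)" using C unfolding fine_cover_def by blast
        fix i
        have "bounded (C i)" "diameter (C i) \<le> \<delta>" using C by (auto simp: fine_cover_def)
        then show "bounded (T ` C i)" "diameter (T ` C i) \<le> c * \<delta>"
          using bdd diam[of "C i"] c by (auto intro: order_trans mult_left_mono)
      qed
      then have "hausdorff_pre m (c * \<delta>) (T ` A) \<le> (\<Sum>i. hausdorff_weight m (T ` C i))"
        by (rule hausdorff_pre_le)
      also have "\<dots> \<le> (\<Sum>i. ennreal (c ^ m) * hausdorff_weight m (C i))"
        using C by (intro suminf_le weight) (auto simp: fine_cover_def)
      finally have "ennreal (1 / c ^ m) * hausdorff_pre m (c * \<delta>) (T ` A)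
          \<le> ennreal (1 / c ^ m) * (ennreal (c ^ m) * (\<Sum>i. hausdorff_weight m (C i)))"
        by (intro mult_left_mono) auto
      also have "\<dots> = (\<Sum>i. hausdorff_weight m (C i))"
        using c by (simp add: mult.assoc[symmetric] ennreal_mult[symmetric])
      finally show "ennreal (1 / c ^ m) * hausdorff_pre m (c * \<delta>) (T ` A) \<le> (\<Sum>i. hausdorff_weight m (C i))" .
    qed
    then have "ennreal (c ^ m) * (ennreal (1 / c ^ m) * hausdorff_pre m (c * \<delta>) (T ` A))
        \<le> ennreal (c ^ m) * hausdorff_pre m \<delta> A"
      by (intro mult_left_mono) auto
    then show ?thesis
      using c by (simp add: mult.assoc[symmetric] ennreal_mult[symmetric])
  qed
  have "hausdorff_pre m \<delta> (T ` A) \<le> ennreal (c ^ m) * hausdorff_outer m A" if "\<delta> > 0" for \<delta>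
  proof -
    have "hausdorff_pre m (c * (\<delta> / c)) (T ` A) \<le> ennreal (c ^ m) * hausdorff_pre m (\<delta> / c) A"
      by (rule pre)
    also have "\<dots> \<le> ennreal (c ^ m) * hausdorff_outer m A"
      using that c by (intro mult_left_mono hausdorff_pre_le_outer) auto
    finally show ?thesis using c by simp
  qed
  then show ?thesis
    by (subst hausdorff_outer_def) (auto intro: SUP_least)
qed

lemma hausdorff_outer_similarity:
  fixes T :: "'a::euclidean_space \<Rightarrow> 'a"
  assumes c: "c > 0" and T: "\<And>x y. dist (T x) (T y) = c * dist x y" and bij: "bij T"
  shows "hausdorff_outer m (T ` A) = ennreal (c ^ m) * hausdorff_outer m A"
proof (rule antisym)
  show "hausdorff_outer m (T ` A) \<le> ennreal (c ^ m) * hausdorff_outer m A"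
    by (rule hausdorff_outer_similarity_le[OF c T])
  have "dist (inv T x) (inv T y) = (1 / c) * dist x y" for x y
    using T[of "inv T x" "inv T y"] bij c by (simp add: bij_is_surj surj_f_inv_f)
  then have "hausdorff_outer m (inv T ` T ` A) \<le> ennreal ((1 / c) ^ m) * hausdorff_outer m (T ` A)"
    using c by (intro hausdorff_outer_similarity_le) auto
  moreover have "inv T ` T ` A = A" using bij by (simp add: bij_is_inj image_inv_f_f)
  ultimately have "ennreal (c ^ m) * hausdorff_outer m A
      \<le> ennreal (c ^ m) * (ennreal ((1 / c) ^ m) * hausdorff_outer m (T ` A))"
    by (intro mult_left_mono) auto
  also have "\<dots> = hausdorff_outer m (T ` A)"
    using c by (simp add: mult.assoc[symmetric] ennreal_mult[symmetric] power_mult_distrib[symmetric])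
  finally show "ennreal (c ^ m) * hausdorff_outer m A \<le> hausdorff_outer m (T ` A)" .
qed

text \<open>Christensen's argument. \<open>N (U \<inter> ball x (r k)) / h k\<close> tends to 1 at each \<open>x\<close> in \<open>U\<close> and \<open>S\<close>;
  integrate it over \<open>U\<close> against \<open>M\<close>, use Fatou's lemma, and exchange the integrals, which turns
  the measures of balls with respect to \<open>N\<close> into measures of balls with respect to \<open>M\<close>.\<close>

lemma uniformly_distributed_le:
  fixes M N :: "'a::euclidean_space measure"
  assumes "sigma_finite_measure M" "sigma_finite_measure N"
    and [measurable_cong]: "sets M = sets borel" "sets N = sets borel"
    and S: "AE x in M. x \<in> S" "AE x in N. x \<in> S"
    and r: "\<And>k. 0 < r k" "r \<longlonglongrightarrow> 0"
    and h: "\<And>k x. x \<in> S \<Longrightarrow> emeasure N (ball x (r k)) = ennreal (h k)" "\<And>k. 0 < h k"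
    and g: "\<And>k x. x \<in> S \<Longrightarrow> emeasure M (ball x (r k)) \<le> ennreal (t * h k)"
    and t: "0 \<le> t" and U [measurable]: "open U"
  shows "emeasure M U \<le> ennreal t * emeasure N U"
proof -
  interpret M: sigma_finite_measure M by fact
  interpret N: sigma_finite_measure N by fact
  interpret pair_sigma_finite N M ..
  have sM: "space M = UNIV" and sN: "space N = UNIV"
    using assms(3,4) by (auto dest: sets_eq_imp_space_eq)
  have [measurable]: "U \<in> sets borel" using U by simp
  define F where "F k x y = (indicator U x * indicator U y * indicator (ball x (r k)) y :: ennreal)" for k x y
  have F_meas [measurable]: "case_prod (F k) \<in> borel_measurable (borel \<Otimes>\<^sub>M borel)" for k
  proof -
    have "open {z. dist (fst z) (snd z :: 'a) < r k}"
      by (intro open_Collect_less continuous_intros)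
    then have [measurable]: "{z. dist (fst z) (snd z :: 'a) < r k} \<in> sets (borel \<Otimes>\<^sub>M borel)"
      unfolding borel_prod by (rule borel_open)
    have "case_prod (F k) = (\<lambda>z. indicator U (fst z) * indicator U (snd z) *
        indicator {z. dist (fst z) (snd z) < r k} z)"
      by (auto simp: F_def indicator_def fun_eq_iff)
    then show ?thesis by simp
  qed
  have F_meas' [measurable]: "case_prod (F k) \<in> borel_measurable (M \<Otimes>\<^sub>M N)"
     "case_prod (\<lambda>y x. F k x y) \<in> borel_measurable (N \<Otimes>\<^sub>M M)" for k
  proof -
    show "case_prod (F k) \<in> borel_measurable (M \<Otimes>\<^sub>M N)"
      using F_meas[of k] by (simp cong: measurable_cong_sets sets_pair_measure_cong add: assms(3,4))
    have "(\<lambda>z. case_prod (F k) (snd z, fst z)) \<in> borel_measurable (N \<Otimes>\<^sub>M M)" by measurable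
    then show "case_prod (\<lambda>y x. F k x y) \<in> borel_measurable (N \<Otimes>\<^sub>M M)"
      by (simp add: case_prod_beta')
  qed
  have NF: "(\<integral>\<^sup>+y. F k x y \<partial>N) = indicator U x * emeasure N (U \<inter> ball x (r k))" for k x
  proof -
    have "(\<integral>\<^sup>+y. F k x y \<partial>N) = (\<integral>\<^sup>+y. indicator U x * indicator (U \<inter> ball x (r k)) y \<partial>N)"
      by (auto intro!: nn_integral_cong simp: F_def indicator_def)
    also have "\<dots> = indicator U x * emeasure N (U \<inter> ball x (r k))"
      using U by (intro nn_integral_cmult_indicator) (auto simp: assms(4))
    finally show ?thesis .
  qed
  let ?q = "\<lambda>k x. (\<integral>\<^sup>+y. F k x y \<partial>N) * ennreal (1 / h k)"
  have "emeasure M U = (\<integral>\<^sup>+x. indicator U x \<partial>M)" by simp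
  also have "\<dots> \<le> (\<integral>\<^sup>+x. liminf (\<lambda>k. ?q k x) \<partial>M)"
  proof (rule nn_integral_mono_AE)
    show "AE x in M. indicator U x \<le> liminf (\<lambda>k. ?q k x)"
      using S(1)
    proof eventually_elim
      case (elim x)
      show ?case
      proof (cases "x \<in> U")
        case True
        obtain e where e: "e > 0" "ball x e \<subseteq> U" using U True by (meson open_contains_ball)
        have "\<forall>\<^sub>F k in sequentially. r k < e" using r(2) e(1) by (rule order_tendstoD)
        then have "\<forall>\<^sub>F k in sequentially. 1 \<le> ?q k x"
        proof eventually_elim
          case (elim k)
          then have "U \<inter> ball x (r k) = ball x (r k)" using e(2) subset_ball[of "r k" e x] by auto
          then have "?q k x = ennreal (h k * (1 / h k))"
            using True h \<open>x \<in> S\<close> by (simp add: NF ennreal_mult[symmetric] less_imp_le)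
          then show ?case using h(2)[of k] by simp
        qed
        then show ?thesis using True by (intro Liminf_bounded) auto
      qed simp
    qed
  qed
  also have "\<dots> \<le> liminf (\<lambda>k. \<integral>\<^sup>+x. ?q k x \<partial>M)"
    by (rule nn_integral_liminf) measurable
  also have "\<dots> \<le> liminf (\<lambda>k::nat. ennreal t * emeasure N U)"
  proof (intro Liminf_mono always_eventually allI)
    fix k
    have "(\<integral>\<^sup>+x. ?q k x \<partial>M)
        = (\<integral>\<^sup>+x. (\<integral>\<^sup>+y. F k x y \<partial>N) \<partial>M) * ennreal (1 / h k)"
      by (rule nn_integral_multc) measurable
    also have "(\<integral>\<^sup>+x. (\<integral>\<^sup>+y. F k x y \<partial>N) \<partial>M) = (\<integral>\<^sup>+y. (\<integral>\<^sup>+x. F k x y \<partial>M) \<partial>N)"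
      using Fubini'[OF F_meas'(2)[of k]] by simp
    also have "\<dots> \<le> (\<integral>\<^sup>+y. ennreal (t * h k) * indicator U y \<partial>N)"
    proof (rule nn_integral_mono_AE)
      show "AE y in N. (\<integral>\<^sup>+x. F k x y \<partial>M) \<le> ennreal (t * h k) * indicator U y"
        using S(2)
      proof eventually_elim
        case (elim y)
        have "(\<integral>\<^sup>+x. F k x y \<partial>M) \<le> (\<integral>\<^sup>+x. indicator U y * indicator (ball y (r k)) x \<partial>M)"
          by (intro nn_integral_mono) (auto simp: F_def indicator_def dist_commute)
        also have "\<dots> = indicator U y * emeasure M (ball y (r k))"
          by (intro nn_integral_cmult_indicator) (auto simp: assms(3))
        also have "\<dots> \<le> ennreal (t * h k) * indicator U y"
          using g[OF elim, of k] by (auto simp: indicator_def)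
        finally show ?case .
      qed
    qed
    also have "\<dots> = ennreal (t * h k) * emeasure N U"
      using U by (intro nn_integral_cmult_indicator) (auto simp: assms(4))
    finally have "(\<integral>\<^sup>+x. ?q k x \<partial>M)
        \<le> ennreal (t * h k) * emeasure N U * ennreal (1 / h k)"
      by (simp add: mult_right_mono)
    also have "\<dots> = ennreal t * emeasure N U"
    proof -
      have "ennreal (t * h k) * ennreal (1 / h k) = ennreal t"
        using h(2)[of k] t by (simp add: ennreal_mult[symmetric])
      then show ?thesis by (metis mult.commute mult.left_commute)
    qed
    finally show "(\<integral>\<^sup>+x. ?q k x \<partial>M) \<le> ennreal t * emeasure N U" .
  qed
  also have "\<dots> = ennreal t * emeasure N U" by (simp add: Liminf_const)
  finally show ?thesis .
qed

lemma borel_measure_eqI_open: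
  fixes M N :: "'a::euclidean_space measure"
  assumes "sets M = sets borel" "sets N = sets borel"
    and "\<And>U. open U \<Longrightarrow> emeasure M U = emeasure N U"
    and "\<And>k::nat. emeasure M (ball 0 (real k)) < \<infinity>"
  shows "M = N"
proof (rule measure_eqI_generator_eq[where E="Collect open" and \<Omega>=UNIV and A="\<lambda>k. ball 0 (real k)"])
  show "(\<Union>k. ball (0::'a) (real k)) = UNIV" by (auto simp: reals_Archimedean2)
qed (use assms in \<open>auto simp: Int_stable_def borel_def less_top\<close>)

lemma sigma_finite_borelI:
  fixes M :: "'a::euclidean_space measure"
  assumes "sets M = sets borel" "\<And>k::nat. emeasure M (ball 0 (real k)) < \<infinity>"
  shows "sigma_finite_measure M"
proof (unfold_locales, intro exI conjI)
  show "countable (range (\<lambda>k. ball (0::'a) (real k)))" by simp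
  show "\<Union> (range (\<lambda>k. ball (0::'a) (real k))) = space M"
    using sets_eq_imp_space_eq[OF assms(1)] by (auto simp: reals_Archimedean2)
qed (use assms in \<open>auto simp: less_top\<close>)

text \<open>Given \<open>t > 0\<close>, either \<open>g \<le> t * h\<close> at arbitrarily small radii, or \<open>t * h \<le> g\<close> at all small
  radii; by the preceding lemma, \<open>M \<le> t * N\<close> or \<open>t * N \<le> M\<close> on open sets. Balls of radius one exclude the
  second alternative if \<open>t > g 1 / h 1\<close> and the first one if \<open>t < g 1 / h 1\<close>.\<close>

lemma uniformly_distributed_unique:
  fixes M N :: "'a::euclidean_space measure"
  assumes sets: "sets M = sets borel" "sets N = sets borel"
    and fin: "\<And>k::nat. emeasure M (ball 0 (real k)) < \<infinity>" "\<And>k::nat. emeasure N (ball 0 (real k)) < \<infinity>"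
    and S: "AE x in M. x \<in> S" "AE x in N. x \<in> S" "z \<in> S"
    and g: "\<And>r x. x \<in> S \<Longrightarrow> 0 < r \<Longrightarrow> emeasure M (ball x r) = ennreal (g r)" "\<And>r. 0 < r \<Longrightarrow> 0 < g r"
    and h: "\<And>r x. x \<in> S \<Longrightarrow> 0 < r \<Longrightarrow> emeasure N (ball x r) = ennreal (h r)" "\<And>r. 0 < r \<Longrightarrow> 0 < h r"
  shows "M = scale_measure (ennreal (g 1 / h 1)) N"
proof -
  have sf: "sigma_finite_measure M" "sigma_finite_measure N"
    using sets fin by (auto intro: sigma_finite_borelI)
  define r where "r k = 1 / real (Suc k)" for k
  have r: "\<And>k. 0 < r k" "r \<longlonglongrightarrow> 0"
    unfolding r_def using LIMSEQ_inverse_real_of_nat by (auto simp: inverse_eq_divide)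
  have dich: "(\<forall>U. open U \<longrightarrow> emeasure M U \<le> ennreal t * emeasure N U) \<or>
      (\<forall>U. open U \<longrightarrow> emeasure N U \<le> ennreal (1 / t) * emeasure M U)" if t: "t > 0" for t
  proof (cases "\<exists>\<^sub>F k in sequentially. g (r k) \<le> t * h (r k)")
    case True
    then have "infinite {k. g (r k) \<le> t * h (r k)}"
      unfolding cofinite_eq_sequentially[symmetric] frequently_cofinite .
    from infinite_enumerate[OF this]
    obtain s :: "nat \<Rightarrow> nat" where s: "strict_mono s" "\<And>k. s k \<in> {k. g (r k) \<le> t * h (r k)}"
      by auto
    have rs: "(\<lambda>k. r (s k)) \<longlonglongrightarrow> 0"
      using LIMSEQ_subseq_LIMSEQ[OF r(2) s(1)] by (simp add: comp_def)
    have le: "g (r (s k)) \<le> t * h (r (s k))" for k using s(2)[of k] by simp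
    have "emeasure M U \<le> ennreal t * emeasure N U" if "open U" for U
      by (rule uniformly_distributed_le[OF sf sets S(1,2) r(1) rs, where h="\<lambda>k. h (r (s k))"])
         (simp_all add: that r(1) g h t less_imp_le ennreal_leI le)
    then show ?thesis by blast
  next
    case False
    then have "\<forall>\<^sub>F k in sequentially. t * h (r k) < g (r k)"
      by (simp add: not_frequently not_le)
    then obtain K where K: "\<And>k. k \<ge> K \<Longrightarrow> t * h (r k) < g (r k)"
      by (auto simp: eventually_sequentially)
    have rK: "(\<lambda>k. r (k + K)) \<longlonglongrightarrow> 0" using r(2) by (rule LIMSEQ_ignore_initial_segment)
    have le: "h (r (k + K)) \<le> 1 / t * g (r (k + K))" for k
      using K[of "k + K"] t by (simp add: field_simps)
    have "emeasure N U \<le> ennreal (1 / t) * emeasure M U" if "open U" for U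
      by (rule uniformly_distributed_le[OF sf(2,1) sets(2,1) S(2,1) r(1) rK, where h="\<lambda>k. g (r (k + K))"])
         (use le in \<open>simp_all add: that r(1) g h t less_imp_le ennreal_leI\<close>)
    then show ?thesis by blast
  qed
  define c where "c = g 1 / h 1"
  have c: "c > 0" using g(2)[of 1] h(2)[of 1] by (simp add: c_def)
  have M1: "emeasure M (ball z 1) = ennreal (g 1)" and N1: "emeasure N (ball z 1) = ennreal (h 1)"
    using S(3) g h by auto
  have up: "emeasure M U \<le> ennreal t * emeasure N U" if "t > c" "open U" for t U
  proof (rule ccontr)
    assume "\<not> ?thesis"
    then have "emeasure N (ball z 1) \<le> ennreal (1 / t) * emeasure M (ball z 1)"
      using dich[of t] that c by auto
    then have "ennreal (h 1) \<le> ennreal (1 / t * g 1)"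
      using that c g(2)[of 1] by (simp add: M1 N1 ennreal_mult''[symmetric] less_imp_le)
    moreover have "0 \<le> 1 / t * g 1" using that c g(2)[of 1] by simp
    ultimately have "h 1 \<le> 1 / t * g 1" by (simp only: ennreal_le_iff)
    then show False
      using that c g(2)[of 1] h(2)[of 1] by (simp add: c_def field_simps)
  qed
  have lo: "emeasure N U \<le> ennreal (1 / t) * emeasure M U" if "0 < t" "t < c" "open U" for t U
  proof (rule ccontr)
    assume "\<not> ?thesis"
    then have "emeasure M (ball z 1) \<le> ennreal t * emeasure N (ball z 1)"
      using dich[of t] that by auto
    then show False
      using that c g(2)[of 1] h(2)[of 1]
      by (simp add: M1 N1 ennreal_mult[symmetric] c_def field_simps)
  qed
  have eq: "emeasure M U = ennreal c * emeasure N U" if U: "open U" for U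
  proof (rule antisym)
    have "(\<lambda>k. ennreal (c + r k) * emeasure N U) \<longlonglongrightarrow> ennreal (c + 0) * emeasure N U"
      using c by (intro tendsto_mult_ennreal tendsto_ennrealI tendsto_intros r) auto
    then show "emeasure M U \<le> ennreal c * emeasure N U"
      using up[OF _ U] r(1) by (intro LIMSEQ_le_const) (auto intro!: exI[of _ 0])
    have "ennreal t * emeasure N U \<le> emeasure M U" if "0 < t" "t < c" for t
    proof -
      have "ennreal t * emeasure N U \<le> ennreal t * (ennreal (1 / t) * emeasure M U)"
        using lo[OF that U] by (rule mult_left_mono) auto
      also have "\<dots> = emeasure M U"
        using that by (simp add: mult.assoc[symmetric] ennreal_mult[symmetric])
      finally show ?thesis .
    qed
    moreover have "c / (1 + r k) < c" "0 < c / (1 + r k)" for k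
      using c r(1)[of k] by (auto simp: field_simps)
    moreover have "(\<lambda>k. ennreal (c / (1 + r k)) * emeasure N U) \<longlonglongrightarrow> ennreal (c / (1 + 0)) * emeasure N U"
      using c by (intro tendsto_mult_ennreal tendsto_ennrealI tendsto_intros r) auto
    ultimately show "ennreal c * emeasure N U \<le> emeasure M U"
      by (intro LIMSEQ_le_const2) auto
  qed
  show ?thesis
    using sets fin eq by (intro borel_measure_eqI_open) (auto simp: c_def)
qed

text \<open>An isometry maps balls to balls of the same radius, so it transports Lebesgue measure to a
  uniformly distributed measure with the same values on balls.\<close>

lemma lborel_isometry:
  fixes T :: "'a::euclidean_space \<Rightarrow> 'a"
  assumes T: "\<And>x y. dist (T x) (T y) = dist x y" and bij: "bij T"
  shows "distr lborel borel T = lborel"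
proof -
  have "continuous_on UNIV T"
    unfolding continuous_on_iff using T by auto
  then have [measurable]: "T \<in> borel_measurable borel" by (rule borel_measurable_continuous_onI)
  have pre: "T -` ball x r = ball (inv T x) r" for x r
    using T[of "inv T x"] bij by (auto simp: bij_is_surj surj_f_inv_f)
  let ?g = "\<lambda>r. measure lborel (ball (0::'a) r)"
  have ball: "emeasure lborel (ball x r) = ennreal (?g r)" if "0 \<le> r" for x :: 'a and r
    using that by (simp_all add: emeasure_ball content_ball)
  have ball': "emeasure (distr lborel borel T) (ball x r) = ennreal (?g r)" if "0 \<le> r" for x r
    using that by (subst emeasure_distr) (auto simp: pre ball)
  have "distr lborel borel T = scale_measure (ennreal (?g 1 / ?g 1)) lborel"
    by (rule uniformly_distributed_unique[where S=UNIV and z=0]) (simp_all add: ball ball' content_ball_pos)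
  then show ?thesis using content_ball_pos[of 1 "0::'a"] by simp
qed

section \<open>Polar coordinates\<close>

text \<open>The surface measure of the unit sphere in the form of a cone measure. The dimension as a factor
  makes the radial weight in polar coordinates equal to \<open>s^(DIM('a) - 1)\<close>.\<close>

definition sphere_measure :: "'a::euclidean_space measure" where
  "sphere_measure = scale_measure (ennreal (real DIM('a)))
     (distr (density lborel (indicator (ball 0 1 - {0}))) borel sgn)"

lemma borel_measurable_sgn_vector [measurable]:
  "(sgn :: 'a::euclidean_space \<Rightarrow> 'a) \<in> borel_measurable borel"
proof -
  have "(\<lambda>x::'a. x /\<^sub>R norm x) \<in> borel_measurable borel" by measurable
  then show ?thesis by (simp add: sgn_div_norm[abs_def])
qed

lemma sets_sphere_measure [measurable_cong, simp]: "sets sphere_measure = sets borel"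
  by (simp add: sphere_measure_def)

lemma space_sphere_measure [simp]: "space sphere_measure = UNIV"
  using sets_eq_imp_space_eq[OF sets_sphere_measure] by simp

definition open_cone :: "real \<Rightarrow> 'a::euclidean_space set \<Rightarrow> 'a set" where
  "open_cone s A = {x. x \<noteq> 0 \<and> norm x < s \<and> sgn x \<in> A}"

lemma open_cone_borel [measurable]:
  assumes "A \<in> sets borel" shows "open_cone s A \<in> sets borel"
proof -
  have "open_cone s A = (sgn -` A \<inter> space borel) \<inter> (ball 0 s - {0})"
    by (auto simp: open_cone_def)
  then show ?thesis using measurable_sets[OF borel_measurable_sgn_vector assms] by simp
qed

lemma emeasure_sphere_measure:
  fixes A :: "'a::euclidean_space set"
  assumes [measurable]: "A \<in> sets borel"
  shows "emeasure sphere_measure A = ennreal (real DIM('a)) * emeasure lborel (open_cone 1 A)"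
proof -
  have "emeasure (density lborel (indicator (ball (0::'a) 1 - {0}))) (sgn -` A)
      = (\<integral>\<^sup>+x. indicator (ball 0 1 - {0}) x * indicator (sgn -` A) x \<partial>lborel)"
    using measurable_sets[OF borel_measurable_sgn_vector assms]
    by (subst emeasure_density) (auto intro!: borel_measurable_indicator)
  also have "\<dots> = (\<integral>\<^sup>+x. indicator (open_cone 1 A) x \<partial>lborel)"
    by (intro nn_integral_cong) (auto simp: indicator_def open_cone_def)
  finally show ?thesis
    by (simp add: sphere_measure_def emeasure_distr)
qed

lemma emeasure_open_cone_scale:
  fixes A :: "'a::euclidean_space set"
  assumes [measurable]: "A \<in> sets borel" and s: "0 < s"
  shows "emeasure lborel (open_cone s A) = ennreal (s ^ DIM('a)) * emeasure lborel (open_cone 1 A)"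
proof -
  have vim: "(\<lambda>x. 0 + s *\<^sub>R x) -` open_cone s A = open_cone 1 A"
    using s by (auto simp: open_cone_def sgn_scaleR)
  have "emeasure lborel (open_cone s A) = emeasure (density (distr lborel borel (\<lambda>x::'a. 0 + s *\<^sub>R x)) (\<lambda>_. ennreal (\<bar>s\<bar> ^ DIM('a)))) (open_cone s A)"
    using s by (subst lborel_affine[of s 0]) auto
  also have "\<dots> = ennreal (s ^ DIM('a)) * emeasure (distr lborel borel (\<lambda>x::'a. 0 + s *\<^sub>R x)) (open_cone s A)"
    using s by (subst emeasure_density_const) auto
  also have "emeasure (distr lborel borel (\<lambda>x::'a. 0 + s *\<^sub>R x)) (open_cone s A) = emeasure lborel (open_cone 1 A)"
    by (subst emeasure_distr) (auto simp: vim[simplified])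
  finally show ?thesis .
qed

lemma emeasure_sphere_measure_UNIV:
  "emeasure sphere_measure (UNIV :: 'a::euclidean_space set) = ennreal (real DIM('a) * unit_ball_vol (real DIM('a)))"
proof -
  have "emeasure lborel (open_cone 1 (UNIV :: 'a set)) = emeasure lborel (ball (0::'a) 1 - {0})"
    by (rule arg_cong[where f="emeasure lborel"]) (auto simp: open_cone_def)
  also have "\<dots> = emeasure lborel (ball (0::'a) 1) - emeasure lborel {0::'a}"
    by (intro emeasure_Diff) auto
  also have "\<dots> = ennreal (unit_ball_vol (real DIM('a)))" by (simp add: emeasure_ball)
  finally show ?thesis by (simp add: emeasure_sphere_measure ennreal_mult')
qed

lemma AE_sphere_measure: "AE x in sphere_measure. norm (x :: 'a::euclidean_space) = 1"
proof (rule AE_I)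
  have "open_cone 1 {x :: 'a. norm x \<noteq> 1} = {}" by (auto simp: open_cone_def norm_sgn)
  then show "emeasure sphere_measure {x :: 'a. norm x \<noteq> 1} = 0"
    by (subst emeasure_sphere_measure) auto
qed auto

lemma finite_measure_sphere_measure: "finite_measure (sphere_measure :: 'a::euclidean_space measure)"
  by (rule finite_measureI) (simp add: emeasure_sphere_measure_UNIV)

definition radial_measure :: "nat \<Rightarrow> real measure" where
  "radial_measure m = density lborel (\<lambda>s. ennreal (s ^ m) * indicator {0<..} s)"

lemma emeasure_radial_measure_lessThan:
  assumes "0 < s"
  shows "emeasure (radial_measure m) {..<s} = ennreal (s ^ Suc m / real (Suc m))"
proof -
  have "emeasure (radial_measure m) {..<s}
      = (\<integral>\<^sup>+x. ennreal (x ^ m) * indicator {0<..} x * indicator {..<s} x \<partial>lborel)"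
    unfolding radial_measure_def by (subst emeasure_density) auto
  also have "\<dots> = (\<integral>\<^sup>+x. ennreal (x ^ m) * indicator {0..s} x \<partial>lborel)"
  proof (rule nn_integral_cong_AE)
    show "AE x in lborel. ennreal (x ^ m) * indicator {0<..} x * indicator {..<s} x
        = ennreal (x ^ m) * indicator {0..s} x"
      using AE_lborel_singleton[of 0] AE_lborel_singleton[of s]
      by eventually_elim (auto simp: indicator_def)
  qed
  also have "\<dots> = ennreal (s ^ Suc m / real (Suc m) - 0 ^ Suc m / real (Suc m))"
    using assms
    by (intro nn_integral_FTC_Icc)
       (auto intro!: derivative_eq_intros simp: field_simps simp del: power_Suc of_nat_Suc)
  finally show ?thesis by simp
qed

lemma emeasure_radial_measure_nonpos:
  assumes "s \<le> 0"
  shows "emeasure (radial_measure m) {..<s} = 0"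
proof -
  have "emeasure (radial_measure m) {..<s}
      = (\<integral>\<^sup>+x. ennreal (x ^ m) * indicator {0<..} x * indicator {..<s} x \<partial>lborel)"
    unfolding radial_measure_def by (subst emeasure_density) auto
  also have "\<dots> = (\<integral>\<^sup>+x. 0 \<partial>(lborel :: real measure))"
    using assms by (intro nn_integral_cong) (auto simp: indicator_def)
  finally show ?thesis by simp
qed

lemma sets_radial_measure [measurable_cong, simp]: "sets (radial_measure m) = sets borel"
  by (simp add: radial_measure_def)

lemma emeasure_radial_measure_finite: "emeasure (radial_measure m) {..<s} < \<infinity>"
  by (cases "0 < s") (simp_all add: emeasure_radial_measure_lessThan emeasure_radial_measure_nonpos)

lemma sigma_finite_radial_measure: "sigma_finite_measure (radial_measure m)"
proof (unfold_locales, intro exI conjI)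
  show "countable (range (\<lambda>k. {..<real k}))" by simp
  show "\<Union> (range (\<lambda>k. {..<real k})) = space (radial_measure m)"
    by (auto simp: radial_measure_def reals_Archimedean2)
qed (use emeasure_radial_measure_finite[of m] in \<open>auto simp: less_top\<close>)

text \<open>It suffices to compare both measures on sets \<open>{..<s} \<times> B\<close>. Such a set corresponds to the cone of
  height \<open>s\<close> over \<open>B\<close>, whose volume scales like the power of \<open>s\<close> by the dimension.\<close>

lemma polar_pair_measure:
  "radial_measure (DIM('a) - 1) \<Otimes>\<^sub>M sphere_measure =
     distr (density lborel (indicator (- {0}))) (borel \<Otimes>\<^sub>M borel) (\<lambda>x::'a::euclidean_space. (norm x, sgn x))"
  (is "?R \<Otimes>\<^sub>M ?S = ?P")
proof (rule pair_measure_eqI)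
  interpret S: finite_measure "sphere_measure :: 'a measure" by (rule finite_measure_sphere_measure)
  show "sigma_finite_measure ?R" by (rule sigma_finite_radial_measure)
  show "sigma_finite_measure ?S" by unfold_locales
  show "sets (?R \<Otimes>\<^sub>M ?S) = sets ?P"
    by (simp cong: sets_pair_measure_cong)
  fix A :: "real set" and B :: "'a set" assume "A \<in> sets ?R" "B \<in> sets ?S"
  then have [measurable]: "A \<in> sets borel" "B \<in> sets borel" by auto
  have P: "emeasure ?P (A \<times> B) = emeasure lborel {x. x \<noteq> 0 \<and> norm x \<in> A \<and> sgn x \<in> B}"
    if [measurable]: "A \<in> sets borel" for A
  proof -
    have "emeasure ?P (A \<times> B) = emeasure (density lborel (indicator (- {0}))) {x. norm x \<in> A \<and> sgn x \<in> B}"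
      by (subst emeasure_distr) (auto intro!: arg_cong2[where f=emeasure])
    also have "\<dots> = (\<integral>\<^sup>+x. indicator (- {0}) x * indicator {x. norm x \<in> A \<and> sgn x \<in> B} x \<partial>lborel)"
      by (subst emeasure_density) auto
    also have "\<dots> = (\<integral>\<^sup>+x. indicator {x. x \<noteq> 0 \<and> norm x \<in> A \<and> sgn x \<in> B} x \<partial>lborel)"
      by (intro nn_integral_cong) (auto simp: indicator_def)
    also have "\<dots> = emeasure lborel {x. x \<noteq> 0 \<and> norm x \<in> A \<and> sgn x \<in> B}"
      by (rule nn_integral_indicator) measurable
    finally show ?thesis .
  qed
  define Q where "Q = distr (density lborel (indicator {x. x \<noteq> 0 \<and> sgn x \<in> B})) borel norm"
  have Q: "emeasure Q A = emeasure lborel {x. x \<noteq> 0 \<and> norm x \<in> A \<and> sgn x \<in> B}"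
    if [measurable]: "A \<in> sets borel" for A
  proof -
    have "emeasure Q A = emeasure (density lborel (indicator {x. x \<noteq> 0 \<and> sgn x \<in> B})) {x. norm x \<in> A}"
      unfolding Q_def by (subst emeasure_distr) (auto intro!: arg_cong2[where f=emeasure])
    also have "\<dots> = (\<integral>\<^sup>+x. indicator {x. x \<noteq> 0 \<and> sgn x \<in> B} x * indicator {x. norm x \<in> A} x \<partial>lborel)"
      by (subst emeasure_density) auto
    also have "\<dots> = (\<integral>\<^sup>+x. indicator {x. x \<noteq> 0 \<and> norm x \<in> A \<and> sgn x \<in> B} x \<partial>lborel)"
      by (intro nn_integral_cong) (auto simp: indicator_def)
    also have "\<dots> = emeasure lborel {x. x \<noteq> 0 \<and> norm x \<in> A \<and> sgn x \<in> B}"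
      by (rule nn_integral_indicator) measurable
    finally show ?thesis .
  qed
  have Sfin: "emeasure ?S B < \<infinity>" using S.emeasure_finite[of B] by (simp add: less_top[symmetric])
  have eq: "emeasure (scale_measure (emeasure ?S B) ?R) {..<s} = emeasure Q {..<s}" for s
  proof (cases "0 < s")
    case True
    have "emeasure Q {..<s} = emeasure lborel (open_cone s B)"
      by (subst Q) (auto simp: open_cone_def)
    also have "\<dots> = ennreal (s ^ DIM('a)) * emeasure lborel (open_cone 1 B)"
      using True by (intro emeasure_open_cone_scale) auto
    also have "\<dots> = ennreal (s ^ DIM('a) / real DIM('a)) * (ennreal (real DIM('a)) * emeasure lborel (open_cone 1 B))"
      using True by (simp add: mult.assoc[symmetric] ennreal_mult[symmetric])
    also have "\<dots> = ennreal (s ^ DIM('a) / real DIM('a)) * emeasure ?S B"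
      by (simp add: emeasure_sphere_measure)
    also have "ennreal (s ^ DIM('a) / real DIM('a)) = emeasure ?R {..<s}"
      using emeasure_radial_measure_lessThan[OF True, of "DIM('a) - 1"] by simp
    finally show ?thesis by (simp add: mult.commute)
  next
    case False
    then have e: "{} = {x. x \<noteq> 0 \<and> norm x \<in> {..<s} \<and> sgn x \<in> B}"
      by (auto simp: not_less) (meson norm_ge_zero not_less order_trans less_le_trans)
    have "emeasure Q {..<s} = emeasure lborel ({} :: 'a set)"
      unfolding e by (rule Q) simp
    moreover have "emeasure ?R {..<s} = 0"
      using False by (simp add: emeasure_radial_measure_nonpos)
    ultimately show ?thesis by simp
  qed
  have borel: "sets (borel :: real measure) = sigma_sets UNIV (range lessThan)"
  proof -
    have "{x. eucl_less x a} = {..<a}" for a :: real by (auto simp: eucl_less_def)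
    then show ?thesis by (simp add: borel_eq_lessThan)
  qed
  have "scale_measure (emeasure ?S B) ?R = Q"
  proof (rule measure_eqI_generator_eq[where E="range lessThan" and \<Omega>=UNIV and A="\<lambda>k. {..<real k}"])
    have "{..<a} \<inter> {..<b} = {..<min a b}" for a b :: real by auto
    then show "Int_stable (range (lessThan :: real \<Rightarrow> _))"
      by (auto simp: Int_stable_def)
    show "(\<Union>k. {..<real k}) = UNIV" by (auto simp: reals_Archimedean2)
    show "emeasure (scale_measure (emeasure ?S B) ?R) {..<real k} \<noteq> \<infinity>" for k
      using Sfin emeasure_radial_measure_finite[of _ "real k"] by (auto simp: ennreal_mult_eq_top_iff less_top)
    show "sets (scale_measure (emeasure ?S B) ?R) = sigma_sets UNIV (range lessThan)"
      by (simp add: borel)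
    show "sets Q = sigma_sets UNIV (range lessThan)"
      by (simp add: Q_def borel)
  qed (use eq in auto)
  then have "emeasure ?S B * emeasure ?R A = emeasure Q A" by (metis emeasure_scale_measure)
  then show "emeasure ?R A * emeasure ?S B = emeasure ?P (A \<times> B)"
    by (simp add: P Q mult.commute)
qed

theorem nn_integral_polar:
  fixes f :: "'a::euclidean_space \<Rightarrow> ennreal"
  assumes [measurable]: "f \<in> borel_measurable borel"
  shows "(\<integral>\<^sup>+x. f x \<partial>lborel) =
    (\<integral>\<^sup>+\<theta>. (\<integral>\<^sup>+s. ennreal (s ^ (DIM('a) - 1)) * indicator {0<..} s * f (a + s *\<^sub>R \<theta>) \<partial>lborel) \<partial>sphere_measure)"
proof -
  let ?R = "radial_measure (DIM('a) - 1)" and ?S = "sphere_measure :: 'a measure"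
  interpret S: finite_measure ?S by (rule finite_measure_sphere_measure)
  have "(\<integral>\<^sup>+x. f x \<partial>lborel) = (\<integral>\<^sup>+x. f (a + x) \<partial>lborel)"
    by (subst lborel_affine[of 1 a]) (auto simp: nn_integral_density nn_integral_distr)
  also have "\<dots> = (\<integral>\<^sup>+x. indicator (- {0}) x * f (a + norm x *\<^sub>R sgn x) \<partial>lborel)"
  proof (rule nn_integral_cong_AE)
    show "AE x in lborel. f (a + x) = indicator (- {0}) x * f (a + norm x *\<^sub>R sgn x)"
      using AE_lborel_singleton[of 0] by eventually_elim (auto simp: sgn_div_norm)
  qed
  also have "\<dots> = (\<integral>\<^sup>+x. f (a + norm x *\<^sub>R sgn x) \<partial>density lborel (indicator (- {0})))"
    by (subst nn_integral_density) auto
  also have "\<dots> = (\<integral>\<^sup>+z. f (a + fst z *\<^sub>R snd z) \<partial>distr (density lborel (indicator (- {0}))) (borel \<Otimes>\<^sub>M borel) (\<lambda>x::'a. (norm x, sgn x)))"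
    by (subst nn_integral_distr) auto
  also have "\<dots> = (\<integral>\<^sup>+z. f (a + fst z *\<^sub>R snd z) \<partial>(?R \<Otimes>\<^sub>M ?S))"
    by (simp only: polar_pair_measure)
  also have "\<dots> = (\<integral>\<^sup>+\<theta>. (\<integral>\<^sup>+s. f (a + s *\<^sub>R \<theta>) \<partial>?R) \<partial>?S)"
  proof -
    interpret R: sigma_finite_measure ?R by (rule sigma_finite_radial_measure)
    interpret pair_sigma_finite ?R ?S ..
    show ?thesis
      by (subst nn_integral_snd[symmetric]) auto
  qed
  also have "\<dots> = (\<integral>\<^sup>+\<theta>. (\<integral>\<^sup>+s. ennreal (s ^ (DIM('a) - 1)) * indicator {0<..} s * f (a + s *\<^sub>R \<theta>) \<partial>lborel) \<partial>?S)"
    unfolding radial_measure_def by (intro nn_integral_cong, subst nn_integral_density) auto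
  finally show ?thesis .
qed

section \<open>The Hausdorff measure of spheres\<close>

lemma reflection_exists:
  fixes x y :: "'a::euclidean_space"
  assumes xy: "norm x = norm y"
  obtains T where "linear T" "\<And>z. norm (T z) = norm z" "bij T" "T x = y"
proof (cases "x = y")
  case True
  show ?thesis by (rule that[of id]) (auto simp: True linear_id)
next
  case False
  define w where "w = x - y"
  have w: "w \<bullet> w \<noteq> 0" using False by (simp add: w_def)
  define T where "T z = z - (2 * (z \<bullet> w) / (w \<bullet> w)) *\<^sub>R w" for z
  have "linear T"
    unfolding T_def by (rule linearI) (auto simp: inner_simps algebra_simps add_divide_distrib)
  moreover have "norm (T z) = norm z" for z
  proof -
    have "T z \<bullet> T z = z \<bullet> z"
      using w unfolding T_def by (simp add: inner_simps inner_commute field_simps power2_eq_square)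
    then show ?thesis by (simp add: norm_eq_sqrt_inner)
  qed
  moreover have "T (T z) = z" for z
    using w unfolding T_def by (simp add: inner_simps field_simps scaleR_add_left[symmetric] scaleR_diff_left[symmetric])
  then have "bij T" by (intro o_bij[of T]) (auto simp: fun_eq_iff)
  moreover have "T x = y"
  proof -
    have "w \<bullet> w = 2 * (x \<bullet> w)"
      using xy unfolding w_def by (simp add: inner_simps inner_commute norm_eq_sqrt_inner)
    then show ?thesis using w by (simp add: T_def w_def)
  qed
  ultimately show ?thesis by (rule that)
qed

lemma linear_isometry_dist:
  assumes "linear T" "\<And>z. norm (T z) = norm z"
  shows "dist (T x) (T y) = dist x y"
  using assms by (metis dist_norm linear_diff)

text \<open>A reflection that maps \<open>x\<close> to \<open>y\<close> maps the cones over the two caps to each other.\<close>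

lemma sphere_measure_ball_uniform:
  fixes x y :: "'a::euclidean_space"
  assumes "norm x = norm y"
  shows "emeasure sphere_measure (ball x r) = emeasure sphere_measure (ball y r)"
proof -
  obtain T :: "'a \<Rightarrow> 'a" where T: "linear T" "\<And>z. norm (T z) = norm z" "bij T" "T x = y"
    using reflection_exists[OF assms] by metis
  have dist: "dist (T u) (T v) = dist u v" for u v using T by (intro linear_isometry_dist)
  have sgn: "sgn (T z) = T (sgn z)" for z using T by (simp add: sgn_div_norm linear_scale)
  have "T z = 0 \<longleftrightarrow> z = 0" for z using T(2)[of z] by auto
  then have vim: "T -` open_cone 1 (ball y r) = open_cone 1 (ball x r)"
    using T dist[of x] by (auto simp: open_cone_def sgn)
  have [measurable]: "T \<in> borel_measurable borel"
    using T(1) by (intro borel_measurable_continuous_onI linear_continuous_on linear_conv_bounded_linear[THEN iffD1])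
  have "emeasure lborel (open_cone 1 (ball y r)) = emeasure (distr lborel borel T) (open_cone 1 (ball y r))"
    using dist T(3) by (simp add: lborel_isometry)
  also have "\<dots> = emeasure lborel (open_cone 1 (ball x r))"
    by (subst emeasure_distr) (auto simp: vim)
  finally show ?thesis by (simp add: emeasure_sphere_measure)
qed

lemma sphere_measure_ball_pos:
  fixes x :: "'a::euclidean_space"
  assumes x: "norm x = 1" and r: "0 < r"
  shows "0 < emeasure sphere_measure (ball x r)"
proof -
  let ?C = "open_cone 1 (ball x r)"
  have "?C = (sgn -` ball x r \<inter> - {0}) \<inter> ball 0 1" by (auto simp: open_cone_def)
  moreover have "open (sgn -` ball x r \<inter> - {0 :: 'a})"
  proof (rule continuous_open_preimage[where S="- {0::'a}", unfolded Int_commute[of "- {0}"]])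
    show "continuous_on (- {0::'a}) sgn"
      unfolding sgn_div_norm by (intro continuous_intros) auto
  qed auto
  ultimately have "open ?C" by auto
  moreover have "(1/2) *\<^sub>R x \<in> ?C"
    using x r by (auto simp: open_cone_def sgn_scaleR sgn_div_norm)
  ultimately obtain e where e: "e > 0" "ball ((1/2) *\<^sub>R x) e \<subseteq> ?C"
    by (meson open_contains_ball)
  have "0 < emeasure lborel (ball ((1/2) *\<^sub>R x) e)"
    using e(1) by (simp add: emeasure_ball)
  also have "\<dots> \<le> emeasure lborel ?C" using e(2) by (intro emeasure_mono) auto
  finally show ?thesis by (simp add: emeasure_sphere_measure ennreal_zero_less_mult_iff)
qed

text \<open>The cone over a cap of radius \<open>d\<close> lies within distance \<open>d\<close> of a segment of length one, and
  hence in a union of about \<open>1/d\<close> balls of radius \<open>2d\<close>.\<close>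

lemma sphere_measure_cball_le:
  fixes x :: "'a::euclidean_space"
  assumes x: "norm x = 1" and d: "0 < d" "d \<le> 1"
  defines "c \<equiv> real DIM('a) * (2 * 2 ^ DIM('a) * unit_ball_vol (real DIM('a)))"
  shows "emeasure sphere_measure (cball x d) \<le> ennreal (c * d ^ (DIM('a) - 1))"
proof -
  define N where "N = nat \<lfloor>1 / d\<rfloor>"
  have N: "real N \<le> 1 / d" using d by (simp add: N_def)
  have "open_cone 1 (cball x d) \<subseteq> (\<Union>k\<le>N. ball ((real k * d) *\<^sub>R x) (2 * d))"
  proof
    fix z assume "z \<in> open_cone 1 (cball x d)"
    then have z: "z \<noteq> 0" "norm z < 1" "dist x (sgn z) \<le> d" by (auto simp: open_cone_def)
    define k where "k = nat \<lfloor>norm z / d\<rfloor>"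
    have kz: "real k \<le> norm z / d" "norm z / d < real k + 1"
      using d unfolding k_def by (auto simp: of_nat_nat intro: floor_correct[THEN conjunct2] real_of_int_floor_add_one_gt)
    have "k \<le> N" unfolding k_def N_def
      using d z by (intro nat_mono floor_mono divide_right_mono) auto
    moreover have "z \<in> ball ((real k * d) *\<^sub>R x) (2 * d)"
    proof -
      have zs: "z = norm z *\<^sub>R sgn z" using z by (simp add: sgn_div_norm)
      have "dist ((real k * d) *\<^sub>R x) z \<le> dist ((real k * d) *\<^sub>R x) (norm z *\<^sub>R x) + dist (norm z *\<^sub>R x) z"
        by (rule dist_triangle)
      also have "dist ((real k * d) *\<^sub>R x) (norm z *\<^sub>R x) = \<bar>real k * d - norm z\<bar>"
        using x by (simp add: dist_norm scaleR_diff_left[symmetric])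
      also have "\<dots> < d" using kz d by (simp add: field_simps abs_less_iff)
      also have "dist (norm z *\<^sub>R x) z = norm z * dist x (sgn z)"
        by (subst (2) zs) (simp add: dist_norm scaleR_diff_right[symmetric] del: norm_sgn)
      also have "\<dots> \<le> 1 * d" using z by (intro mult_mono) auto
      finally show ?thesis by simp
    qed
    ultimately show "z \<in> (\<Union>k\<le>N. ball ((real k * d) *\<^sub>R x) (2 * d))" by blast
  qed
  then have "emeasure lborel (open_cone 1 (cball x d)) \<le> emeasure lborel (\<Union>k\<le>N. ball ((real k * d) *\<^sub>R x) (2 * d))"
    by (intro emeasure_mono) auto
  also have "\<dots> \<le> (\<Sum>k\<le>N. emeasure lborel (ball ((real k * d) *\<^sub>R x) (2 * d)))"
    by (intro emeasure_subadditive_finite) auto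
  also have "\<dots> = ennreal (real (Suc N) * (unit_ball_vol (real DIM('a)) * (2 * d) ^ DIM('a)))"
    using d by (simp add: emeasure_ball ennreal_mult ennreal_of_nat_eq_real_of_nat[symmetric])
  also have "\<dots> \<le> ennreal ((2 / d) * (unit_ball_vol (real DIM('a)) * (2 * d) ^ DIM('a)))"
  proof (intro ennreal_leI mult_right_mono)
    have "1 \<le> 1 / d" using d by simp
    then show "real (Suc N) \<le> 2 / d" using N by simp
  qed (use d in auto)
  also have "(2 / d) * (unit_ball_vol (real DIM('a)) * (2 * d) ^ DIM('a))
      = 2 * 2 ^ DIM('a) * unit_ball_vol (real DIM('a)) * d ^ (DIM('a) - 1)"
    using d power_Suc[of d "DIM('a) - 1"] by (simp add: power_mult_distrib)
  finally have "emeasure sphere_measure (cball x d) \<le> ennreal (real DIM('a)) *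
      ennreal (2 * 2 ^ DIM('a) * unit_ball_vol (real DIM('a)) * d ^ (DIM('a) - 1))"
    by (simp add: emeasure_sphere_measure mult_left_mono)
  also have "\<dots> = ennreal (c * d ^ (DIM('a) - 1))"
    using d by (simp add: c_def ennreal_mult[symmetric] mult_ac)
  finally show ?thesis .
qed

lemma sphere_measure_cball_bound:
  assumes dim: "2 \<le> DIM('a::euclidean_space)"
  obtains c where "0 < c" "\<And>(x::'a) d. norm x = 1 \<Longrightarrow> 0 \<le> d \<Longrightarrow> d \<le> 1 \<Longrightarrow>
    emeasure sphere_measure (cball x d) \<le> ennreal (c * d ^ (DIM('a) - 1))"
proof
  define c where "c = real DIM('a) * (2 * 2 ^ DIM('a) * unit_ball_vol (real DIM('a)))"
  show "0 < c" by (simp add: c_def)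
  fix x :: 'a and d :: real assume x: "norm x = 1" and d: "0 \<le> d" "d \<le> 1"
  show "emeasure sphere_measure (cball x d) \<le> ennreal (c * d ^ (DIM('a) - 1))"
  proof (cases "d = 0")
    case False
    then show ?thesis using sphere_measure_cball_le[OF x, of d] d by (simp add: c_def)
  next
    case True
    have "emeasure sphere_measure (cball x 0) \<le> ennreal (c * (1 / real (Suc k)) ^ (DIM('a) - 1))" for k
    proof -
      have "emeasure sphere_measure (cball x 0) \<le> emeasure sphere_measure (cball x (1 / real (Suc k)))"
        by (intro emeasure_mono) auto
      then show ?thesis
        using sphere_measure_cball_le[OF x, of "1 / real (Suc k)"] by (simp add: c_def)
    qed
    moreover have "(\<lambda>k. ennreal (c * (1 / real (Suc k)) ^ (DIM('a) - 1))) \<longlonglongrightarrow> ennreal (c * 0 ^ (DIM('a) - 1))"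
      using LIMSEQ_inverse_real_of_nat
      by (intro tendsto_ennrealI tendsto_intros) (simp add: inverse_eq_divide)
    ultimately show ?thesis unfolding True by (intro LIMSEQ_le_const) auto
  qed
qed

text \<open>A mass distribution argument: a covering set that meets the sphere lies in a cap whose radius is the
  diameter of the set, so its weight controls the cone measure of that cap.\<close>

lemma hausdorff_sphere_pos:
  assumes dim: "2 \<le> DIM('a::euclidean_space)"
  shows "0 < hausdorff_outer (DIM('a) - 1) (sphere (0::'a) 1)"
proof -
  let ?m = "DIM('a) - 1"
  obtain c where c: "0 < c" "\<And>(x::'a) d. norm x = 1 \<Longrightarrow> 0 \<le> d \<Longrightarrow> d \<le> 1 \<Longrightarrow>
      emeasure sphere_measure (cball x d) \<le> ennreal (c * d ^ ?m)"
    using sphere_measure_cball_bound[OF dim] by metis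
  define v where "v = unit_ball_vol (real ?m)"
  define b where "b = c * 2 ^ ?m / v"
  have v: "v > 0" by (simp add: v_def)
  have b: "b > 0" using c(1) v by (simp add: b_def)
  have "emeasure sphere_measure (UNIV :: 'a set) \<le> ennreal b * (\<Sum>i. hausdorff_weight ?m (C i))"
    if C: "fine_cover 1 (sphere (0::'a) 1) C" for C
  proof -
    define P where "P i \<longleftrightarrow> C i \<inter> sphere 0 1 \<noteq> {}" for i
    define y where "y i = (SOME z. z \<in> C i \<inter> sphere 0 1)" for i
    have y: "y i \<in> C i" "norm (y i) = 1" if "P i" for i
    proof -
      have "\<exists>z. z \<in> C i \<inter> sphere 0 1" using that by (auto simp: P_def)
      then have "y i \<in> C i \<inter> sphere 0 1" unfolding y_def by (rule someI_ex)
      then show "y i \<in> C i" "norm (y i) = 1" by auto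
    qed
    have Cb: "bounded (C i)" "diameter (C i) \<le> 1" for i using C by (auto simp: fine_cover_def)
    define D where "D i = (if P i then cball (y i) (diameter (C i)) else {})" for i
    have "sphere 0 1 \<subseteq> (\<Union>i. D i)"
    proof
      fix z :: 'a assume z: "z \<in> sphere 0 1"
      then obtain i where i: "z \<in> C i" using C by (auto simp: fine_cover_def)
      then have "P i" using z by (auto simp: P_def)
      then have "z \<in> D i" using i y[of i] Cb(1)[of i] by (auto simp: D_def intro: diameter_bounded_bound)
      then show "z \<in> (\<Union>i. D i)" by blast
    qed
    then have *: "z \<in> (\<Union>i. D i)" if "norm z = 1" for z using that by auto
    have "AE z in sphere_measure. z \<in> UNIV \<longrightarrow> z \<in> (\<Union>i. D i)"
      using AE_sphere_measure by eventually_elim (use * in blast)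
    then have "emeasure sphere_measure (UNIV :: 'a set) \<le> emeasure sphere_measure (\<Union>i. D i)"
      by (rule emeasure_mono_AE) (auto simp: D_def)
    also have "\<dots> \<le> (\<Sum>i. emeasure sphere_measure (D i))"
      by (intro emeasure_subadditive_countably) (auto simp: D_def)
    also have "\<dots> \<le> (\<Sum>i. ennreal b * hausdorff_weight ?m (C i))"
    proof (intro suminf_le)
      fix i
      show "emeasure sphere_measure (D i) \<le> ennreal b * hausdorff_weight ?m (C i)"
      proof (cases "P i")
        case True
        have "emeasure sphere_measure (D i) \<le> ennreal (c * diameter (C i) ^ ?m)"
          using True y(2) Cb[of i] c(2) diameter_ge_0[OF Cb(1)] by (simp add: D_def)
        also have "c * diameter (C i) ^ ?m = b * (v * (diameter (C i) / 2) ^ ?m)"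
          using v by (simp add: b_def power_divide)
        also have "ennreal \<dots> = ennreal b * hausdorff_weight ?m (C i)"
          using True b v diameter_ge_0[OF Cb(1)[of i]]
          by (auto simp: hausdorff_weight_def v_def P_def ennreal_mult)
        finally show ?thesis .
      qed (simp add: D_def)
    qed auto
    finally show ?thesis by simp
  qed
  then have "ennreal (1 / b) * emeasure sphere_measure (UNIV :: 'a set) \<le> hausdorff_pre ?m 1 (sphere (0::'a) 1)"
    unfolding hausdorff_pre_eq
  proof (intro INF_greatest)
    fix C assume le: "\<And>C. fine_cover 1 (sphere (0::'a) 1) C \<Longrightarrow>
        emeasure sphere_measure (UNIV :: 'a set) \<le> ennreal b * (\<Sum>i. hausdorff_weight ?m (C i))"
      and C: "C \<in> Collect (fine_cover 1 (sphere (0::'a) 1))"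
    have "ennreal (1 / b) * emeasure sphere_measure (UNIV :: 'a set)
        \<le> ennreal (1 / b) * (ennreal b * (\<Sum>i. hausdorff_weight ?m (C i)))"
      using C by (intro mult_left_mono le) auto
    also have "\<dots> = (\<Sum>i. hausdorff_weight ?m (C i))"
      using b by (simp add: mult.assoc[symmetric] ennreal_mult[symmetric])
    finally show "ennreal (1 / b) * emeasure sphere_measure (UNIV :: 'a set) \<le> (\<Sum>i. hausdorff_weight ?m (C i))" .
  qed
  moreover have "0 < ennreal (1 / b) * emeasure sphere_measure (UNIV :: 'a set)"
    using b by (simp add: ennreal_zero_less_mult_iff emeasure_sphere_measure_UNIV)
  ultimately show ?thesis
    using hausdorff_pre_le_outer[of 1 ?m "sphere (0::'a) 1"] by auto
qed

lemma power_one_plus_le: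
  fixes h :: real
  assumes "0 \<le> h" "h \<le> 1"
  shows "(1 + h) ^ n \<le> 1 + (2 ^ n - 1) * h"
proof (induction n)
  case (Suc n)
  have "(1 + h) ^ Suc n \<le> (1 + (2 ^ n - 1) * h) * (1 + h)"
    using Suc assms by (simp add: mult.commute mult_left_mono)
  also have "\<dots> = 1 + h + (2 ^ n - 1) * (h * (1 + h))" by (simp add: algebra_simps)
  also have "\<dots> \<le> 1 + h + (2 ^ n - 1) * (h * 2)"
    using assms by (intro add_left_mono mult_left_mono) auto
  finally show ?case by (simp add: algebra_simps)
qed simp

text \<open>Volume packing: the disjoint balls of radius \<open>\<delta>/2\<close> around \<open>P\<close> lie in a shell of thickness \<open>\<delta>\<close>.\<close>

lemma card_separated_sphere_le:
  fixes P :: "'a::euclidean_space set"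
  assumes P: "finite P" "P \<subseteq> sphere 0 1" "\<And>x y. x \<in> P \<Longrightarrow> y \<in> P \<Longrightarrow> x \<noteq> y \<Longrightarrow> \<delta> \<le> dist x y"
    and \<delta>: "0 < \<delta>" "\<delta> \<le> 1"
  shows "real (card P) * \<delta> ^ (DIM('a) - 1) \<le> 2 ^ DIM('a) * (2 ^ DIM('a) + real DIM('a))"
proof -
  let ?n = "DIM('a)" and ?h = "\<delta> / 2"
  define v where "v = unit_ball_vol (real ?n)"
  have v: "v > 0" by (simp add: v_def)
  have disj: "disjoint_family_on (\<lambda>x. ball x ?h) P"
    unfolding disjoint_family_on_def
  proof (intro ballI impI)
    fix x y assume "x \<in> P" "y \<in> P" "x \<noteq> y"
    then have "\<delta> \<le> dist x y" by (rule P)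
    then show "ball x ?h \<inter> ball y ?h = {}" by (intro disjoint_ballI) auto
  qed
  have "ennreal (real (card P) * (v * ?h ^ ?n)) = (\<Sum>x\<in>P. emeasure lborel (ball x ?h))"
    using \<delta> by (simp add: emeasure_ball v_def ennreal_mult ennreal_of_nat_eq_real_of_nat[symmetric])
  also have "\<dots> = emeasure lborel (\<Union>x\<in>P. ball x ?h)"
    using P disj by (intro sum_emeasure) auto
  also have "\<dots> \<le> emeasure lborel (ball (0::'a) (1 + ?h) - ball 0 (1 - ?h))"
  proof (intro emeasure_mono UN_least subsetI)
    fix x z assume "x \<in> P" "z \<in> ball x ?h"
    then have "norm x = 1" "norm (x - z) < ?h" using P(2) by (auto simp: dist_norm)
    then show "z \<in> ball 0 (1 + ?h) - ball 0 (1 - ?h)"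
      using norm_triangle_ineq2[of x z] norm_triangle_ineq3[of x z] by (auto simp: norm_minus_commute)
  qed auto
  also have "\<dots> = emeasure lborel (ball (0::'a) (1 + ?h)) - emeasure lborel (ball (0::'a) (1 - ?h))"
    using \<delta> by (intro emeasure_Diff) (auto simp: emeasure_ball)
  also have "\<dots> = ennreal (v * (1 + ?h) ^ ?n - v * (1 - ?h) ^ ?n)"
    using \<delta> by (simp add: emeasure_ball v_def ennreal_minus)
  finally have "real (card P) * (v * ?h ^ ?n) \<le> v * (1 + ?h) ^ ?n - v * (1 - ?h) ^ ?n"
    using \<delta> v by (subst (asm) ennreal_le_iff) (auto intro!: mult_left_mono power_mono)
  then have "v * (real (card P) * ?h ^ ?n) \<le> v * ((1 + ?h) ^ ?n - (1 - ?h) ^ ?n)"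
    by (simp add: algebra_simps)
  then have "real (card P) * ?h ^ ?n \<le> (1 + ?h) ^ ?n - (1 - ?h) ^ ?n"
    using v by (simp only: mult_le_cancel_left_pos)
  moreover have "(1 + ?h) ^ ?n \<le> 1 + (2 ^ ?n - 1) * ?h" using \<delta> by (intro power_one_plus_le) auto
  moreover have "1 + real ?n * (- ?h) \<le> (1 + (- ?h)) ^ ?n" using \<delta> by (intro Bernoulli_inequality) auto
  ultimately have "real (card P) * ?h ^ ?n \<le> (2 ^ ?n - 1) * ?h + real ?n * ?h" by simp
  also have "\<dots> \<le> (2 ^ ?n + real ?n) * ?h" using \<delta> by (simp add: algebra_simps)
  also have "\<dots> \<le> (2 ^ ?n + real ?n) * \<delta>" using \<delta> by (intro mult_left_mono) auto
  finally have "real (card P) * \<delta> ^ ?n \<le> 2 ^ ?n * ((2 ^ ?n + real ?n) * \<delta>)"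
    by (simp add: power_divide field_simps)
  also have "\<delta> ^ ?n = \<delta> ^ (?n - 1) * \<delta>" using power_Suc2[of \<delta> "?n - 1"] by simp
  finally have "(real (card P) * \<delta> ^ (?n - 1)) * \<delta> \<le> (2 ^ ?n * (2 ^ ?n + real ?n)) * \<delta>"
    by (simp only: mult.assoc)
  then show ?thesis using \<delta> by (simp only: mult_le_cancel_right_pos)
qed

text \<open>A maximal \<open>\<delta>\<close>-separated subset of the sphere is a \<open>\<delta>\<close>-net, and by the packing bound its size is at
  most of order \<open>1 / \<delta>^m\<close>.\<close>

lemma hausdorff_sphere_finite:
  "hausdorff_outer (DIM('a) - 1) (sphere (0::'a::euclidean_space) 1) < \<infinity>"
proof -
  let ?n = "DIM('a)" and ?m = "DIM('a) - 1" and ?S = "sphere (0::'a) 1"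
  define b where "b = 2 ^ ?n * (2 ^ ?n + real ?n)"
  define v where "v = unit_ball_vol (real ?m)"
  have v: "0 < v" by (simp add: v_def)
  have pre: "hausdorff_pre ?m (2 * \<delta>) ?S \<le> ennreal (v * b)" if \<delta>: "0 < \<delta>" "\<delta> \<le> 1" for \<delta>
  proof -
    define sep where "sep P \<longleftrightarrow> finite P \<and> P \<subseteq> ?S \<and> (\<forall>x\<in>P. \<forall>y\<in>P. x \<noteq> y \<longrightarrow> \<delta> \<le> dist x y)" for P
    have card: "real (card P) * \<delta> ^ ?m \<le> b" if "sep P" for P
      using that \<delta> unfolding sep_def b_def by (intro card_separated_sphere_le) auto
    have "card P \<le> nat \<lfloor>b / \<delta> ^ ?m\<rfloor>" if "sep P" for P
      using card[OF that] \<delta> by (simp add: le_nat_floor pos_le_divide_eq)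
    moreover have "sep {}" by (simp add: sep_def)
    ultimately obtain P where P: "sep P" "\<And>Q. sep Q \<Longrightarrow> card Q \<le> card P"
      using ex_has_greatest_nat[of sep "{}" card "Suc (nat \<lfloor>b / \<delta> ^ ?m\<rfloor>)"]
      by (metis less_Suc_eq_le)
    have net: "\<exists>x\<in>P. dist x z \<le> \<delta>" if z: "z \<in> ?S" for z
    proof (rule ccontr)
      assume far: "\<not> ?thesis"
      then have "sep (insert z P)" using P(1) z by (auto simp: sep_def dist_commute not_le less_imp_le)
      moreover have "z \<notin> P" using far \<delta> by force
      ultimately show False using P(2)[of "insert z P"] P(1) by (simp add: sep_def)
    qed
    have fin: "finite P" using P(1) by (simp add: sep_def)
    obtain f where f: "bij_betw f {0..<card P} P" using ex_bij_betw_nat_finite[OF fin] by blast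
    define C where "C i = (if i < card P then cball (f i) \<delta> else {})" for i
    have "fine_cover (2 * \<delta>) ?S C"
      unfolding fine_cover_def
    proof (intro conjI allI subsetI)
      fix z assume "z \<in> ?S"
      then obtain x where "x \<in> P" "dist x z \<le> \<delta>" using net by blast
      moreover from this f obtain i where "i < card P" "f i = x"
        by (metis atLeastLessThan_iff bij_betw_iff_bijections)
      ultimately have "z \<in> C i" by (simp add: C_def)
      then show "z \<in> (\<Union>i. C i)" by blast
    qed (use \<delta> in \<open>auto simp: C_def\<close>)
    then have "hausdorff_pre ?m (2 * \<delta>) ?S \<le> (\<Sum>i. hausdorff_weight ?m (C i))"
      by (rule hausdorff_pre_le)
    also have "\<dots> = (\<Sum>i<card P. hausdorff_weight ?m (C i))"
      by (rule suminf_finite) (auto simp: C_def)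
    also have "\<dots> = (\<Sum>i<card P. ennreal (v * \<delta> ^ ?m))"
      using \<delta> by (intro sum.cong) (auto simp: C_def hausdorff_weight_def v_def)
    also have "\<dots> = ennreal (v * (real (card P) * \<delta> ^ ?m))"
      using \<delta> v by (simp add: ennreal_mult ennreal_of_nat_eq_real_of_nat[symmetric] mult_ac)
    also have "\<dots> \<le> ennreal (v * b)"
      using card[OF P(1)] v by (intro ennreal_leI mult_left_mono) auto
    finally show ?thesis .
  qed
  have "hausdorff_outer ?m ?S \<le> ennreal (v * b)"
    unfolding hausdorff_outer_def
  proof (rule SUP_least)
    fix \<epsilon> :: real assume "\<epsilon> \<in> {0<..}"
    then have e: "0 < min (\<epsilon> / 2) 1" "min (\<epsilon> / 2) 1 \<le> 1" by auto
    have "hausdorff_pre ?m \<epsilon> ?S \<le> hausdorff_pre ?m (2 * min (\<epsilon> / 2) 1) ?S"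
      by (intro hausdorff_pre_antimono) auto
    also have "\<dots> \<le> ennreal (v * b)" using pre[OF e] .
    finally show "hausdorff_pre ?m \<epsilon> ?S \<le> ennreal (v * b)" .
  qed
  then show ?thesis by (rule le_less_trans) simp
qed

lemma emeasure_density_hausdorff:
  assumes "A \<in> sets borel" "S \<in> sets borel"
  shows "emeasure (density (hausdorff_measure m) (indicator S)) A = hausdorff_outer m (S \<inter> A)"
proof -
  have "emeasure (density (hausdorff_measure m) (indicator S)) A
      = (\<integral>\<^sup>+x. indicator S x * indicator A x \<partial>hausdorff_measure m)"
    using assms by (subst emeasure_density) auto
  also have "\<dots> = (\<integral>\<^sup>+x. indicator (S \<inter> A) x \<partial>hausdorff_measure m)"
    by (intro nn_integral_cong) (auto simp: indicator_def)
  also have "\<dots> = hausdorff_outer m (S \<inter> A)"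
    using assms by (subst nn_integral_indicator) (auto simp: emeasure_hausdorff_measure)
  finally show ?thesis .
qed

text \<open>Reflections show that both measures are uniformly distributed. Caps have positive Hausdorff measure,
  since by compactness finitely many congruent caps cover the sphere.\<close>

lemma hausdorff_unit_sphere_proportional:
  assumes dim: "2 \<le> DIM('a::euclidean_space)"
  obtains \<kappa> where "0 < \<kappa>"
    "density (hausdorff_measure (DIM('a) - 1)) (indicator (sphere (0::'a) 1))
       = scale_measure (ennreal \<kappa>) sphere_measure"
proof -
  let ?m = "DIM('a) - 1" and ?S = "sphere (0::'a) 1"
  define M where "M = density (hausdorff_measure ?m) (indicator ?S)"
  have setsM [simp]: "sets M = sets borel" by (simp add: M_def)
  have M: "emeasure M A = hausdorff_outer ?m (?S \<inter> A)" if "A \<in> sets borel" for A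
    unfolding M_def using that by (intro emeasure_density_hausdorff) auto
  have fin: "emeasure M A < \<infinity>" if "A \<in> sets borel" for A
    unfolding M[OF that]
    by (rule le_less_trans[OF hausdorff_outer_mono hausdorff_sphere_finite]) simp
  obtain e :: 'a where e: "norm e = 1" using norm_Basis nonempty_Basis by blast
  have uniform: "emeasure M (ball x r) = emeasure M (ball e r)" if x: "x \<in> ?S" for x r
  proof -
    have "norm x = norm e" using x e by simp
    then obtain T :: "'a \<Rightarrow> 'a" where T: "linear T" "\<And>z. norm (T z) = norm z" "bij T" "T x = e"
      using reflection_exists by metis
    have dist: "dist (T u) (T v) = dist u v" for u v using T by (intro linear_isometry_dist)
    have "T ` (?S \<inter> ball x r) = ?S \<inter> ball e r"
    proof (intro subset_antisym subsetI)
      fix z assume z: "z \<in> ?S \<inter> ball e r"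
      obtain w where w: "z = T w" using T(3) by (metis bij_pointE)
      then show "z \<in> T ` (?S \<inter> ball x r)" using z T(2)[of w] dist[of x w] T(4) by auto
    qed (use T dist[of x] in auto)
    then show ?thesis
      using hausdorff_outer_similarity[of 1 T ?m "?S \<inter> ball x r"] dist T(3) by (simp add: M)
  qed
  have pos: "0 < emeasure M (ball e r)" if r: "0 < r" for r
  proof (rule ccontr)
    assume "\<not> ?thesis"
    then have null: "emeasure M (ball x r) = 0" if "x \<in> ?S" for x using uniform[OF that] by simp
    have "?S \<subseteq> (\<Union>x\<in>?S. ball x r)" using r by force
    then obtain F where F: "F \<subseteq> ?S" "finite F" "?S \<subseteq> (\<Union>x\<in>F. ball x r)"
      using compactE_image[OF compact_sphere, of ?S "\<lambda>x. ball x r" 0 1] by auto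
    have "hausdorff_outer ?m ?S = emeasure M ?S" by (simp add: M)
    also have "\<dots> \<le> emeasure M (\<Union>x\<in>F. ball x r)" using F by (intro emeasure_mono) auto
    also have "\<dots> \<le> (\<Sum>x\<in>F. emeasure M (ball x r))"
      using F by (intro emeasure_subadditive_finite) auto
    also have "\<dots> = 0" using F null by (intro sum.neutral) auto
    finally show False using hausdorff_sphere_pos[OF dim] by simp
  qed
  have AE_M: "AE x in M. x \<in> ?S"
  proof (rule AE_I)
    show "emeasure M (- ?S) = 0" by (subst M) auto
  qed auto
  have AE_S: "AE x in sphere_measure. x \<in> ?S" using AE_sphere_measure by auto
  have fin': "emeasure sphere_measure A < \<infinity>" for A :: "'a set"
    using finite_measure.emeasure_finite[OF finite_measure_sphere_measure, of A] by (simp add: less_top[symmetric])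
  define g where "g r = measure M (ball e r)" for r
  define h where "h r = measure sphere_measure (ball e r)" for r
  have g: "emeasure M (ball x r) = ennreal (g r)" if "x \<in> ?S" for x r
    using uniform[OF that] fin[of "ball e r"] by (simp add: g_def emeasure_eq_ennreal_measure less_top)
  have h: "emeasure sphere_measure (ball x r) = ennreal (h r)" if "x \<in> ?S" for x r
    using sphere_measure_ball_uniform[of x e r] that e fin'[of "ball e r"]
    by (simp add: h_def emeasure_eq_ennreal_measure less_top)
  have gh: "0 < g r" "0 < h r" if "0 < r" for r
    using pos[OF that] sphere_measure_ball_pos[OF e that] g[of e r] h[of e r] e by auto
  have "M = scale_measure (ennreal (g 1 / h 1)) sphere_measure"
    by (rule uniformly_distributed_unique[OF _ _ _ _ AE_M AE_S, where z=e])
       (simp_all add: g h gh e fin fin' del: infinity_ennreal_def)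
  then show ?thesis using gh[of 1] by (intro that[of "g 1 / h 1"]) (auto simp: M_def)
qed

text \<open>A similarity carries the statement over from the unit sphere. The factor is the same for all
  spheres, since both measures scale by \<open>L^m\<close>.\<close>

theorem hausdorff_sphere_integral:
  assumes dim: "2 \<le> DIM('a::euclidean_space)"
  obtains \<kappa> where "0 < \<kappa>"
    "\<And>(a::'a) L f. 0 < L \<Longrightarrow> f \<in> borel_measurable borel \<Longrightarrow>
       (\<integral>\<^sup>+x. f x * indicator (sphere a L) x \<partial>hausdorff_measure (DIM('a) - 1))
         = ennreal (\<kappa> * L ^ (DIM('a) - 1)) * (\<integral>\<^sup>+\<theta>. f (a + L *\<^sub>R \<theta>) \<partial>sphere_measure)"
proof -
  let ?m = "DIM('a) - 1" and ?S = "sphere (0::'a) 1"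
  obtain \<kappa> where \<kappa>: "0 < \<kappa>"
    and M: "density (hausdorff_measure ?m) (indicator ?S) = scale_measure (ennreal \<kappa>) sphere_measure"
    using hausdorff_unit_sphere_proportional[OF dim] by metis
  have "(\<integral>\<^sup>+x. f x * indicator (sphere a L) x \<partial>hausdorff_measure ?m)
         = ennreal (\<kappa> * L ^ ?m) * (\<integral>\<^sup>+\<theta>. f (a + L *\<^sub>R \<theta>) \<partial>sphere_measure)"
    if L: "0 < L" and [measurable]: "f \<in> borel_measurable borel" for a :: 'a and L f
  proof -
    define T where "T x = a + L *\<^sub>R x" for x
    have [measurable]: "T \<in> borel_measurable borel" by (simp add: T_def[abs_def])
    have surj: "z = T ((1 / L) *\<^sub>R (z - a))" for z using L by (simp add: T_def)
    have bij: "bij T"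
    proof (rule bijI)
      show "surj T" using surj by (rule surjI[OF sym])
    qed (use L in \<open>auto simp: T_def inj_on_def\<close>)
    have dist: "dist (T x) (T y) = L * dist x y" for x y
      using L by (simp add: T_def dist_norm scaleR_diff_right[symmetric])
    have eq: "density (hausdorff_measure ?m) (indicator (sphere a L))
        = scale_measure (ennreal (L ^ ?m)) (distr (density (hausdorff_measure ?m) (indicator ?S)) borel T)"
    proof (rule measure_eqI)
      fix A assume "A \<in> sets (density (hausdorff_measure ?m) (indicator (sphere a L)))"
      then have A [measurable]: "A \<in> sets borel" by simp
      have TA: "T -` A \<in> sets borel" using measurable_sets[OF \<open>T \<in> borel_measurable borel\<close> A] by simp
      have "T ` (?S \<inter> T -` A) = sphere a L \<inter> A"
      proof (intro subset_antisym subsetI)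
        fix z assume z: "z \<in> sphere a L \<inter> A"
        then have "norm ((1 / L) *\<^sub>R (z - a)) = 1" using L by (simp add: dist_norm norm_minus_commute)
        then show "z \<in> T ` (?S \<inter> T -` A)" using z surj[of z] by (intro image_eqI[of z T]) auto
      qed (use L in \<open>auto simp: T_def dist_norm\<close>)
      then have "hausdorff_outer ?m (sphere a L \<inter> A) = ennreal (L ^ ?m) * hausdorff_outer ?m (?S \<inter> T -` A)"
        using hausdorff_outer_similarity[OF L dist bij, of ?m "?S \<inter> T -` A"] by simp
      then show "emeasure (density (hausdorff_measure ?m) (indicator (sphere a L))) A
          = emeasure (scale_measure (ennreal (L ^ ?m)) (distr (density (hausdorff_measure ?m) (indicator ?S)) borel T)) A"
        using A TA by (simp add: emeasure_density_hausdorff emeasure_distr)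
    qed simp
    have "(\<integral>\<^sup>+x. f x * indicator (sphere a L) x \<partial>hausdorff_measure ?m)
        = (\<integral>\<^sup>+x. f x \<partial>density (hausdorff_measure ?m) (indicator (sphere a L)))"
      by (subst nn_integral_density) (auto simp: mult.commute intro!: borel_measurable_indicator)
    also have "\<dots> = ennreal (L ^ ?m) * (ennreal \<kappa> * (\<integral>\<^sup>+\<theta>. f (T \<theta>) \<partial>sphere_measure))"
      unfolding eq M by (simp add: nn_integral_scale_measure nn_integral_distr)
    finally show ?thesis
      using \<kappa> L by (simp add: T_def ennreal_mult mult_ac)
  qed
  then show ?thesis using \<kappa> that by metis
qed

section \<open>Weak gradients of continuously differentiable functions\<close>

lemma C1_iff:
  "Ck_on 1 u UNIV \<longleftrightarrow> u differentiable_on UNIV \<and>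
     (\<forall>b\<in>Basis. continuous_on UNIV (\<lambda>x. frechet_derivative u (at x) b))"
  by (simp add: One_nat_def)

lemma C1_has_derivative:
  assumes "Ck_on 1 u UNIV"
  shows "(u has_derivative (\<lambda>h. gradient u x \<bullet> h)) (at x)"
proof -
  have "u differentiable (at x)"
    using assms unfolding C1_iff by (simp add: differentiable_on_def)
  then have D: "(u has_derivative frechet_derivative u (at x)) (at x)"
    by (simp add: frechet_derivative_works)
  interpret D: linear "frechet_derivative u (at x)" by (rule has_derivative_linear[OF D])
  have "frechet_derivative u (at x) h = gradient u x \<bullet> h" for h
  proof -
    have "frechet_derivative u (at x) h = frechet_derivative u (at x) (\<Sum>b\<in>Basis. (h \<bullet> b) *\<^sub>R b)"
      by (simp add: euclidean_representation)
    also have "\<dots> = (\<Sum>b\<in>Basis. (h \<bullet> b) * frechet_derivative u (at x) b)"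
      by (simp add: D.sum D.scale)
    also have "\<dots> = gradient u x \<bullet> h"
      by (simp add: gradient_def inner_sum_left inner_commute[of h] mult.commute)
    finally show ?thesis .
  qed
  then have "frechet_derivative u (at x) = (\<lambda>h. gradient u x \<bullet> h)" by (rule ext)
  then show ?thesis using D by simp
qed

lemma C1_continuous: "Ck_on 1 u UNIV \<Longrightarrow> continuous_on A u"
  using C1_has_derivative has_derivative_continuous
  by (blast intro: continuous_at_imp_continuous_on)

lemma C1_continuous_gradient: "Ck_on 1 u UNIV \<Longrightarrow> continuous_on A (gradient u)"
  unfolding gradient_def[abs_def] C1_iff
  by (intro continuous_intros) (auto intro: continuous_on_subset)

lemma C1_I:
  assumes D: "\<And>x. (u has_derivative (\<lambda>h. G x \<bullet> h)) (at x)" and G: "continuous_on UNIV G"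
  shows "Ck_on 1 u UNIV" "gradient u = G"
proof -
  have fd: "frechet_derivative u (at x) = (\<lambda>h. G x \<bullet> h)" for x
    using frechet_derivative_at[OF D] by simp
  show "Ck_on 1 u UNIV"
    unfolding C1_iff fd
    using D G by (auto simp: differentiable_on_def differentiable_def intro!: continuous_intros)
  show "gradient u = G"
    by (auto simp: gradient_def fd fun_eq_iff euclidean_representation)
qed

lemma C1_mult:
  assumes "Ck_on 1 u UNIV" "Ck_on 1 v UNIV"
  shows "Ck_on 1 (\<lambda>x. u x * v x) UNIV"
    "gradient (\<lambda>x. u x * v x) = (\<lambda>x. u x *\<^sub>R gradient v x + v x *\<^sub>R gradient u x)"
proof -
  have D: "((\<lambda>x. u x * v x) has_derivative (\<lambda>h. (u x *\<^sub>R gradient v x + v x *\<^sub>R gradient u x) \<bullet> h)) (at x)" for x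
    using has_derivative_mult[OF C1_has_derivative[OF assms(1)] C1_has_derivative[OF assms(2)], of x]
    by (simp add: inner_simps algebra_simps)
  have "continuous_on UNIV (\<lambda>x. u x *\<^sub>R gradient v x + v x *\<^sub>R gradient u x)"
    by (intro continuous_intros C1_continuous[OF assms(1)] C1_continuous[OF assms(2)]
        C1_continuous_gradient[OF assms(1)] C1_continuous_gradient[OF assms(2)])
  from C1_I[OF D this] show "Ck_on 1 (\<lambda>x. u x * v x) UNIV"
    "gradient (\<lambda>x. u x * v x) = (\<lambda>x. u x *\<^sub>R gradient v x + v x *\<^sub>R gradient u x)" by auto
qed

lemma C1_mean_value:
  assumes "Ck_on 1 w UNIV" "0 < (t::real)"
  shows "\<exists>s\<in>{0<..<t}. w (x + t *\<^sub>R b) - w x = t * (gradient w (x + s *\<^sub>R b) \<bullet> b)"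
proof -
  have "((\<lambda>s. w (x + s *\<^sub>R b)) has_derivative (\<lambda>h. gradient w (x + s *\<^sub>R b) \<bullet> (h *\<^sub>R b))) (at s)" for s
    by (rule has_derivative_compose[OF _ C1_has_derivative[OF assms(1)]])
       (auto intro!: derivative_eq_intros)
  then have D: "((\<lambda>s. w (x + s *\<^sub>R b)) has_real_derivative (gradient w (x + s *\<^sub>R b) \<bullet> b)) (at s)" for s
    by (rule has_derivative_imp_has_field_derivative) simp
  define f where "f s = w (x + s *\<^sub>R b)" for s
  define f' where "f' s = gradient w (x + s *\<^sub>R b) \<bullet> b" for s
  have "\<exists>s>0. s < t \<and> f t - f 0 = (t - 0) * f' s"
    using D by (intro MVT2[OF assms(2)]) (simp add: f_def[abs_def] f'_def)
  then show ?thesis by (auto simp: f_def f'_def)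
qed

text \<open>The integrals of the difference quotients vanish by translation invariance, and they converge
  to the integral of the derivative.\<close>

lemma integral_gradient_compact_support:
  fixes w :: "'a::euclidean_space \<Rightarrow> real"
  assumes w: "Ck_on 1 w UNIV" and K: "compact K" "\<And>x. x \<notin> K \<Longrightarrow> w x = 0"
  shows "(LINT x|lborel. gradient w x \<bullet> b) = 0"
proof -
  obtain R where R: "\<And>x. x \<in> K \<Longrightarrow> norm x \<le> R" using compact_imp_bounded[OF K(1)] by (auto simp: bounded_iff)
  define Q where "Q = R + norm b"
  have cont: "continuous_on A w" "continuous_on A (\<lambda>x. gradient w x \<bullet> b)" for A
    by (rule C1_continuous[OF w], intro continuous_intros C1_continuous_gradient[OF w])
  have [measurable]: "w \<in> borel_measurable borel" "(\<lambda>x. gradient w x \<bullet> b) \<in> borel_measurable borel"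
    using cont[of UNIV] by (auto intro: borel_measurable_continuous_onI)
  have int_w: "integrable lborel w"
  proof -
    have "(\<lambda>x. indicator K x *\<^sub>R w x) = w" using K(2) by (auto simp: indicator_def fun_eq_iff)
    then show ?thesis using borel_integrable_compact[OF K(1) cont(1)] by simp
  qed
  have "compact ((\<lambda>x. gradient w x \<bullet> b) ` cball 0 (Q + norm b))"
    by (intro compact_continuous_image cont) auto
  then obtain B where B: "\<And>x. norm x \<le> Q + norm b \<Longrightarrow> \<bar>gradient w x \<bullet> b\<bar> \<le> B"
    using compact_imp_bounded by (force simp: bounded_iff)
  define h where "h k = 1 / real (Suc k)" for k
  have h: "0 < h k" "h k \<le> 1" for k by (auto simp: h_def)
  have h0: "h \<longlonglongrightarrow> 0" unfolding h_def using LIMSEQ_inverse_real_of_nat by (simp add: inverse_eq_divide)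
  define q where "q k x = (w (x + h k *\<^sub>R b) - w x) / h k" for k x
  have "(\<lambda>k. LINT x|lborel. q k x) \<longlonglongrightarrow> (LINT x|lborel. gradient w x \<bullet> b)"
  proof (rule integral_dominated_convergence[where w="\<lambda>x. indicator (cball 0 Q) x *\<^sub>R B"])
    show "integrable lborel (\<lambda>x. indicator (cball (0::'a) Q) x *\<^sub>R B)"
      by (intro borel_integrable_compact) auto
    show "AE x in lborel. (\<lambda>k. q k x) \<longlonglongrightarrow> gradient w x \<bullet> b"
    proof (rule AE_I2)
      fix x
      have "\<exists>s. \<forall>k. s k \<in> {0<..<h k} \<and> q k x = gradient w (x + s k *\<^sub>R b) \<bullet> b"
        using C1_mean_value[OF w h(1), of _ x b] h(1) unfolding q_def
        by (intro choice allI) (metis nonzero_mult_div_cancel_left less_irrefl)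
      then obtain s where s: "\<And>k. s k \<in> {0<..<h k}" "\<And>k. q k x = gradient w (x + s k *\<^sub>R b) \<bullet> b"
        by blast
      have "s \<longlonglongrightarrow> 0"
        using s(1) by (intro tendsto_sandwich[OF _ _ tendsto_const h0] always_eventually) (auto intro: less_imp_le)
      then have "(\<lambda>k. x + s k *\<^sub>R b) \<longlonglongrightarrow> x + 0 *\<^sub>R b" by (intro tendsto_intros)
      then have "(\<lambda>k. gradient w (x + s k *\<^sub>R b) \<bullet> b) \<longlonglongrightarrow> gradient w x \<bullet> b"
        using cont(2)[of UNIV] by (auto simp: continuous_on_eq_continuous_at intro: isCont_tendsto_compose)
      then show "(\<lambda>k. q k x) \<longlonglongrightarrow> gradient w x \<bullet> b" by (simp add: s(2))
    qed
    show "AE x in lborel. norm (q k x) \<le> indicator (cball 0 Q) x *\<^sub>R B" for k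
    proof (rule AE_I2)
      fix x
      have hb: "norm (h k *\<^sub>R b) \<le> norm b" using h[of k] by (simp add: mult_left_le_one_le)
      show "norm (q k x) \<le> indicator (cball 0 Q) x *\<^sub>R B"
      proof (cases "norm x \<le> Q")
        case True
        obtain s where s: "s \<in> {0<..<h k}" "w (x + h k *\<^sub>R b) - w x = h k * (gradient w (x + s *\<^sub>R b) \<bullet> b)"
          using C1_mean_value[OF w h(1)] by blast
        have "norm (s *\<^sub>R b) \<le> norm b" using s(1) h[of k] by (simp add: mult_left_le_one_le)
        then have "norm (x + s *\<^sub>R b) \<le> Q + norm b" using True norm_triangle_ineq[of x "s *\<^sub>R b"] by simp
        then show ?thesis using B True s(2) h(1)[of k] by (simp add: q_def)
      next
        case False
        then have "x \<notin> K" "x + h k *\<^sub>R b \<notin> K"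
          using R[of x] R[of "x + h k *\<^sub>R b"] norm_diff_ineq[of x "h k *\<^sub>R b"] hb norm_ge_zero[of b]
          unfolding Q_def by linarith+
        then show ?thesis using False K(2) by (simp add: q_def)
      qed
    qed
  qed (auto simp: q_def)
  moreover have "(LINT x|lborel. q k x) = 0" for k
  proof -
    have eq: "lborel = distr lborel borel ((+) (h k *\<^sub>R b))" by (simp add: lborel_distr_plus)
    have "integrable (distr lborel borel ((+) (h k *\<^sub>R b))) w"
      using int_w unfolding lborel_distr_plus .
    then have int: "integrable lborel (\<lambda>x. w (x + h k *\<^sub>R b))"
      by (subst (asm) integrable_distr_eq) (auto simp: add.commute)
    have "(LINT x|lborel. w x) = (LINT x|distr lborel borel ((+) (h k *\<^sub>R b)). w x)"
      unfolding lborel_distr_plus ..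
    also have "\<dots> = (LINT x|lborel. w (x + h k *\<^sub>R b))"
      by (subst integral_distr) (auto simp: add.commute)
    finally show ?thesis
      using int int_w by (simp add: q_def)
  qed
  ultimately show ?thesis by (simp add: LIMSEQ_const_iff)
qed

lemma nn_integral_lebesgue_on:
  assumes "S \<in> sets borel"
  shows "(\<integral>\<^sup>+x. f x \<partial>lebesgue_on S) = (\<integral>\<^sup>+x. f x * indicator S x \<partial>lborel)"
  using assms by (simp add: nn_integral_restrict_space nn_integral_completion)

lemma borel_measurable_lebesgue_on_continuous:
  "continuous_on UNIV f \<Longrightarrow> f \<in> borel_measurable (lebesgue_on S)"
  by (intro measurable_restrict_space1 measurable_completion) (auto intro: borel_measurable_continuous_onI)

lemma locally_integrable_continuous:
  fixes f :: "'a::euclidean_space \<Rightarrow> 'b::euclidean_space"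
  assumes f: "continuous_on UNIV f"
  shows "locally_integrable \<Omega> f"
  unfolding locally_integrable_def
proof (intro allI impI)
  fix K assume "compact K \<and> K \<subseteq> \<Omega>"
  then have K: "compact K" by simp
  have [measurable]: "f \<in> borel_measurable borel" "K \<in> sets borel"
    using f K by (auto intro: borel_measurable_continuous_onI simp: compact_imp_closed)
  have "integrable lborel (\<lambda>x. indicator K x *\<^sub>R f x)"
    using K continuous_on_subset[OF f] by (intro borel_integrable_compact) auto
  then have "integrable lebesgue (\<lambda>x. indicator K x *\<^sub>R f x)"
    by (subst integrable_completion) auto
  then show "integrable (lebesgue_on K) f" by (subst integrable_restrict_space) auto
qed

lemma C1_has_weak_gradient:
  fixes u :: "'a::euclidean_space \<Rightarrow> real"
  assumes u: "Ck_on 1 u UNIV" and \<Omega>: "open \<Omega>"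
  shows "has_weak_gradient \<Omega> u (gradient u)"
  unfolding has_weak_gradient_def
proof (intro conjI allI impI ballI)
  show "locally_integrable \<Omega> u" "locally_integrable \<Omega> (gradient u)"
    by (intro locally_integrable_continuous C1_continuous[OF u] C1_continuous_gradient[OF u])+
  fix \<phi> and b :: 'a assume \<phi>: "test_function \<Omega> \<phi>" and b: "b \<in> Basis"
  define K where "K = closure {x. \<phi> x \<noteq> 0}"
  have K: "compact K" "K \<subseteq> \<Omega>" using \<phi> by (auto simp: test_function_def K_def)
  have C1: "Ck_on 1 \<phi> UNIV" using \<phi> by (simp add: test_function_def smooth_on_def)
  have off: "\<phi> x = 0" if "x \<notin> K" for x using that closure_subset[of "{x. \<phi> x \<noteq> 0}"] by (auto simp: K_def)
  have goff: "gradient \<phi> x = 0" if x: "x \<notin> K" for x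
  proof -
    have "open (- K)" using compact_imp_closed[OF K(1)] by (rule open_Compl)
    then have "((\<lambda>_. 0) has_derivative (\<lambda>h. gradient \<phi> x \<bullet> h)) (at x)"
      using x off by (intro has_derivative_transform_within_open[OF C1_has_derivative[OF C1]]) auto
    then have "(\<lambda>h. gradient \<phi> x \<bullet> h) = (\<lambda>h. 0)"
      using has_derivative_unique has_derivative_const by blast
    then show ?thesis by (metis inner_eq_zero_iff)
  qed
  have c: "continuous_on A u" "continuous_on A \<phi>" "continuous_on A (gradient u)" "continuous_on A (gradient \<phi>)" for A
    by (intro C1_continuous[OF u] C1_continuous[OF C1] C1_continuous_gradient[OF u] C1_continuous_gradient[OF C1])+
  have red: "(LINT x|lebesgue_on \<Omega>. f x) = (LINT x|lborel. f x)" "integrable lborel f"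
    if f: "continuous_on UNIV f" "\<And>x. x \<notin> K \<Longrightarrow> f x = 0" for f :: "'a \<Rightarrow> real"
  proof -
    have [measurable]: "f \<in> borel_measurable borel" using f(1) by (rule borel_measurable_continuous_onI)
    have "(LINT x|lebesgue_on \<Omega>. f x) = (LINT x|lebesgue. indicator \<Omega> x *\<^sub>R f x)"
      using \<Omega> by (subst integral_restrict_space) auto
    also have "(\<lambda>x. indicator \<Omega> x *\<^sub>R f x) = f"
      using f(2) K(2) by (auto simp: indicator_def fun_eq_iff)
    finally show "(LINT x|lebesgue_on \<Omega>. f x) = (LINT x|lborel. f x)"
      by (simp add: integral_completion)
    have "(\<lambda>x. indicator K x *\<^sub>R f x) = f" using f(2) by (auto simp: indicator_def fun_eq_iff)
    then show "integrable lborel f"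
      using borel_integrable_compact[OF K(1) continuous_on_subset[OF f(1) subset_UNIV]] by simp
  qed
  have f1: "continuous_on UNIV (\<lambda>x. u x * (gradient \<phi> x \<bullet> b))"
    and f2: "continuous_on UNIV (\<lambda>x. (gradient u x \<bullet> b) * \<phi> x)"
    by (intro continuous_intros c)+
  have "0 = (LINT x|lborel. gradient (\<lambda>x. u x * \<phi> x) x \<bullet> b)"
    using integral_gradient_compact_support[OF C1_mult(1)[OF u C1] K(1), of b] off by simp
  also have "\<dots> = (LINT x|lborel. u x * (gradient \<phi> x \<bullet> b) + (gradient u x \<bullet> b) * \<phi> x)"
    unfolding C1_mult(2)[OF u C1] by (simp add: inner_simps mult.commute)
  also have "\<dots> = (LINT x|lborel. u x * (gradient \<phi> x \<bullet> b)) + (LINT x|lborel. (gradient u x \<bullet> b) * \<phi> x)"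
    using red(2)[OF f1] red(2)[OF f2] off goff by (intro Bochner_Integration.integral_add) auto
  finally show "(LINT x|lebesgue_on \<Omega>. u x * (gradient \<phi> x \<bullet> b)) =
      - (LINT x|lebesgue_on \<Omega>. (gradient u x \<bullet> b) * \<phi> x)"
    using red(1)[OF f1] red(1)[OF f2] off goff by simp
qed

lemma Lp_fun_continuous_bounded:
  fixes f :: "'a::euclidean_space \<Rightarrow> 'b::euclidean_space"
  assumes f: "continuous_on UNIV f" and \<Omega>: "bounded \<Omega>" "\<Omega> \<in> sets borel" and p: "0 \<le> p"
  shows "Lp_fun p (lebesgue_on \<Omega>) f"
  unfolding Lp_fun_def
proof
  show "f \<in> borel_measurable (lebesgue_on \<Omega>)" using f by (rule borel_measurable_lebesgue_on_continuous)
  have "compact (f ` closure \<Omega>)"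
    using f \<Omega>(1) by (intro compact_continuous_image) (auto intro: continuous_on_subset)
  then obtain B where "\<And>y. y \<in> f ` closure \<Omega> \<Longrightarrow> norm y \<le> B"
    using compact_imp_bounded[of "f ` closure \<Omega>"] unfolding bounded_iff by blast
  then have B: "\<And>x. x \<in> \<Omega> \<Longrightarrow> norm (f x) \<le> B" using closure_subset by blast
  have "(\<integral>\<^sup>+x. ennreal (norm (f x) powr p) \<partial>lebesgue_on \<Omega>) \<le> (\<integral>\<^sup>+x. ennreal (B powr p) * indicator \<Omega> x \<partial>lborel)"
    unfolding nn_integral_lebesgue_on[OF \<Omega>(2)]
    using B p by (intro nn_integral_mono) (auto simp: indicator_def intro!: ennreal_leI powr_mono2)
  also have "\<dots> = ennreal (B powr p) * emeasure lborel \<Omega>"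
    using \<Omega>(2) by (intro nn_integral_cmult_indicator) simp
  also have "\<dots> < \<infinity>"
    using emeasure_bounded_finite[OF \<Omega>(1)] by (simp add: ennreal_mult_less_top)
  finally show "(\<integral>\<^sup>+x. ennreal (norm (f x) powr p) \<partial>lebesgue_on \<Omega>) < \<infinity>" .
qed

section \<open>Balls: an upper bound for the best constant\<close>

text \<open>The value of \<open>\<kappa>\<close> is left open because \<open>\<kappa>\<close> enters the bounds for balls and annuli alike and cancels
  when they are compared.\<close>

definition hausdorff_factor :: "'a::euclidean_space itself \<Rightarrow> real \<Rightarrow> bool" where
  "hausdorff_factor t \<kappa> \<longleftrightarrow> 0 < \<kappa> \<and> (\<forall>(a::'a) L f. 0 < L \<longrightarrow> f \<in> borel_measurable borel \<longrightarrow>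
       (\<integral>\<^sup>+x. f x * indicator (sphere a L) x \<partial>hausdorff_measure (DIM('a) - 1))
         = ennreal (\<kappa> * L ^ (DIM('a) - 1)) * (\<integral>\<^sup>+\<theta>. f (a + L *\<^sub>R \<theta>) \<partial>sphere_measure))"

lemma nn_integral_surface_measure:
  fixes \<Omega> :: "'a::euclidean_space set"
  shows "(\<integral>\<^sup>+x. f x \<partial>surface_measure \<Omega>)
    = (\<integral>\<^sup>+x. f x * indicator (frontier \<Omega>) x \<partial>hausdorff_measure (DIM('a) - 1))"
  unfolding surface_measure_def by (subst nn_integral_restrict_space) auto

text \<open>The inequality \<open>s / L \<le> exp (s / L - 1)\<close> replaces the weight \<open>s^m\<close> by an exponential. This raises the
  rate from \<open>k\<close> to \<open>k + m / L\<close>, which is the effect of the curvature \<open>1 / L\<close>.\<close>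

lemma radial_exp_integral_le:
  assumes k: "0 < k" and L: "0 < L"
  shows "(\<integral>\<^sup>+s. ennreal (s ^ m * exp (k * s)) * indicator {0..L} s \<partial>lborel)
    \<le> ennreal (L ^ m * exp (k * L) / (k + real m / L))"
proof -
  define K where "K = k + real m / L"
  have K: "0 < K" using k L by (simp add: K_def add_pos_nonneg)
  have KL: "K * L = k * L + real m" using L by (simp add: K_def field_simps)
  have "(\<integral>\<^sup>+s. ennreal (s ^ m * exp (k * s)) * indicator {0..L} s \<partial>lborel)
      \<le> (\<integral>\<^sup>+s. ennreal (L ^ m * exp (- real m) * exp (K * s)) * indicator {0..L} s \<partial>lborel)"
  proof (rule nn_integral_mono)
    fix s :: real
    show "ennreal (s ^ m * exp (k * s)) * indicator {0..L} s
        \<le> ennreal (L ^ m * exp (- real m) * exp (K * s)) * indicator {0..L} s"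
    proof (cases "s \<in> {0..L}")
      case True
      have "s / L \<le> exp (s / L - 1)" using exp_ge_add_one_self[of "s / L - 1"] by simp
      then have "(s / L) ^ m \<le> exp (s / L - 1) ^ m" using True L by (intro power_mono) auto
      then have "s ^ m \<le> L ^ m * exp (real m * (s / L - 1))"
        using L by (simp add: power_divide exp_of_nat_mult[symmetric] pos_divide_le_eq mult.commute)
      then have "s ^ m * exp (k * s) \<le> L ^ m * exp (real m * (s / L - 1)) * exp (k * s)"
        by (intro mult_right_mono) auto
      also have "\<dots> = L ^ m * exp (- real m) * exp (K * s)"
        by (simp add: K_def mult_exp_exp algebra_simps)
      finally show ?thesis using True by (simp add: ennreal_leI)
    qed simp
  qed
  also have "\<dots> = ennreal (L ^ m * exp (- real m) * exp (K * L) / K - L ^ m * exp (- real m) * exp (K * 0) / K)"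
    using K L by (intro nn_integral_FTC_Icc) (auto intro!: derivative_eq_intros)
  also have "\<dots> \<le> ennreal (L ^ m * exp (- real m) * exp (K * L) / K)"
    using K L by (intro ennreal_leI) simp
  also have "L ^ m * exp (- real m) * exp (K * L) / K = L ^ m * exp (k * L) / K"
    unfolding KL by (simp add: exp_add exp_minus field_simps)
  finally show ?thesis by (simp add: K_def)
qed

lemma ball_exp_integral_le:
  fixes a :: "'a::euclidean_space"
  assumes k: "0 < k" and L: "0 < L"
  shows "(\<integral>\<^sup>+x. ennreal (exp (k * norm (x - a))) * indicator (ball a L) x \<partial>lborel)
    \<le> ennreal (L ^ (DIM('a) - 1) * exp (k * L) / (k + real (DIM('a) - 1) / L)) * emeasure sphere_measure (UNIV :: 'a set)"
proof -
  let ?m = "DIM('a) - 1"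
  let ?C = "ennreal (L ^ ?m * exp (k * L) / (k + real ?m / L))"
  let ?I = "\<lambda>\<theta>. \<integral>\<^sup>+s. ennreal (s ^ ?m) * indicator {0<..} s *
        (ennreal (exp (k * norm (a + s *\<^sub>R \<theta> - a))) * indicator (ball a L) (a + s *\<^sub>R \<theta>)) \<partial>lborel"
  have [measurable]: "ball a L \<in> sets borel" by simp
  have "(\<integral>\<^sup>+x. ennreal (exp (k * norm (x - a))) * indicator (ball a L) x \<partial>lborel)
    = (\<integral>\<^sup>+\<theta>. ?I \<theta> \<partial>sphere_measure)"
    by (rule nn_integral_polar) measurable
  also have "\<dots> \<le> (\<integral>\<^sup>+(\<theta>::'a). ?C \<partial>sphere_measure)"
  proof (rule nn_integral_mono_AE)
    show "AE \<theta> in sphere_measure. ?I \<theta>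
        \<le> ?C"
      using AE_sphere_measure
    proof eventually_elim
      case (elim \<theta>)
      have "?I \<theta>
          \<le> (\<integral>\<^sup>+s. ennreal (s ^ ?m * exp (k * s)) * indicator {0..L} s \<partial>lborel)"
        using elim by (intro nn_integral_mono) (auto simp: indicator_def ennreal_mult dist_norm)
      also have "\<dots> \<le> ?C"
        by (rule radial_exp_integral_le[OF k L])
      finally show ?case .
    qed
  qed
  also have "\<dots> = ?C * emeasure sphere_measure (UNIV :: 'a set)"
    by simp
  finally show ?thesis .
qed

lemma exp_radial_C1:
  fixes a :: "'a::euclidean_space" and \<beta> \<epsilon> :: real
  assumes \<epsilon>: "0 < \<epsilon>"
  defines "q \<equiv> \<lambda>x. sqrt (\<epsilon>\<^sup>2 + (x - a) \<bullet> (x - a))"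
  defines "u \<equiv> \<lambda>x. exp (\<beta> * q x)"
  shows "Ck_on 1 u UNIV" "gradient u = (\<lambda>x. (u x * \<beta> / q x) *\<^sub>R (x - a))"
proof -
  have pos: "0 < \<epsilon>\<^sup>2 + (x - a) \<bullet> (x - a)" for x using \<epsilon> by (simp add: add_pos_nonneg)
  have qpos: "0 < q x" for x using pos by (simp add: q_def)
  have Dq: "(q has_derivative (\<lambda>h. ((x - a) \<bullet> h) / q x)) (at x)" for x
    unfolding q_def using pos[of x]
    by (auto intro!: derivative_eq_intros simp: inner_commute field_simps)
  have D: "(u has_derivative (\<lambda>h. ((u x * \<beta> / q x) *\<^sub>R (x - a)) \<bullet> h)) (at x)" for x
    unfolding u_def by (rule derivative_eq_intros Dq refl)+ (simp add: fun_eq_iff)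
  have cq: "continuous_on UNIV q" unfolding q_def by (intro continuous_intros)
  have "continuous_on UNIV (\<lambda>x. (u x * \<beta> / q x) *\<^sub>R (x - a))"
    unfolding u_def using qpos by (intro continuous_intros cq) (auto simp: less_imp_neq[THEN not_sym])
  from C1_I[OF D this] show "Ck_on 1 u UNIV" "gradient u = (\<lambda>x. (u x * \<beta> / q x) *\<^sub>R (x - a))" by auto
qed

lemma inverse_ennreal_antimono:
  fixes x y :: ennreal
  assumes "x \<le> y"
  shows "inverse y \<le> inverse x"
proof (cases "x = 0 \<or> y = top")
  case False
  then obtain a b where "x = ennreal a" "0 < a" "y = ennreal b" "0 \<le> b"
    using assms by (cases x; cases y) (auto simp: top_unique)
  then show ?thesis using assms by (simp add: inverse_ennreal le_imp_inverse_le ennreal_leI)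
qed auto

lemma best_trace_const_le:
  assumes "sobolev_W1p p \<Omega> u G" "has_trace p \<Omega> u G g" "\<not> (AE x in lebesgue_on \<Omega>. u x = 0)"
    and le: "ennreal c * (\<integral>\<^sup>+x. ennreal (norm (G x) powr p + \<bar>u x\<bar> powr p) \<partial>lebesgue_on \<Omega>)
      \<le> (\<integral>\<^sup>+x. ennreal (\<bar>g x\<bar> powr p) \<partial>surface_measure \<Omega>)"
    and fin: "(\<integral>\<^sup>+x. ennreal (norm (G x) powr p + \<bar>u x\<bar> powr p) \<partial>lebesgue_on \<Omega>) < \<infinity>"
    and pos: "0 < (\<integral>\<^sup>+x. ennreal (\<bar>g x\<bar> powr p) \<partial>surface_measure \<Omega>)"
    and c: "0 < c"
  shows "best_trace_const p \<Omega> \<le> ennreal (1 / c)"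
proof -
  let ?N = "\<integral>\<^sup>+x. ennreal (\<bar>g x\<bar> powr p) \<partial>surface_measure \<Omega>"
  let ?D = "\<integral>\<^sup>+x. ennreal (norm (G x) powr p + \<bar>u x\<bar> powr p) \<partial>lebesgue_on \<Omega>"
  let ?A = "{(u, G, g). sobolev_W1p p \<Omega> u G \<and> has_trace p \<Omega> u G g \<and> \<not> (AE x in lebesgue_on \<Omega>. u x = 0)}"
  let ?F = "\<lambda>(u, G, g). (\<integral>\<^sup>+x. ennreal (\<bar>g x\<bar> powr p) \<partial>surface_measure \<Omega>) /
        (\<integral>\<^sup>+x. ennreal (norm (G x) powr p + \<bar>u x\<bar> powr p) \<partial>lebesgue_on \<Omega>)"
  have "ennreal c \<le> ?N / ?D"
  proof (cases "?D = 0")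
    case True
    then show ?thesis using pos by simp
  next
    case False
    have "ennreal c = (ennreal c * ?D) / ?D"
      using False fin by (simp add: ennreal_times_divide[symmetric])
    also have "\<dots> \<le> ?N / ?D" using le by (rule divide_right_mono_ennreal)
    finally show ?thesis .
  qed
  also have "?N / ?D = ?F (u, G, g)" by simp
  also have "\<dots> \<le> Sup (?F ` ?A)"
    using assms(1-3) by (intro SUP_upper) simp
  finally have "ennreal c \<le> Sup (?F ` ?A)" .
  then have "1 / Sup (?F ` ?A) \<le> 1 / ennreal c"
    by (simp add: divide_ennreal_def inverse_ennreal_antimono)
  also have "\<dots> = ennreal (1 / c)" using c by (simp add: divide_ennreal[symmetric])
  finally show ?thesis unfolding best_trace_const_def .
qed

text \<open>The trial functions \<open>exp (\<beta> * sqrt (\<epsilon>^2 + |x - a|^2))\<close> regularise the exponential of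
  \<open>\<beta> * |x - a|\<close> at the centre, where it fails to be differentiable.\<close>

lemma best_trace_const_ball_le_eps:
  fixes a :: "'a::euclidean_space"
  assumes \<kappa>: "hausdorff_factor TYPE('a) \<kappa>" and p: "1 < p" and \<beta>: "0 < \<beta>" and L: "0 < L" and \<epsilon>: "0 < \<epsilon>"
  shows "best_trace_const p (ball a L)
    \<le> ennreal ((\<beta> powr p + 1) * exp (p * \<beta> * \<epsilon>) / (\<kappa> * (p * \<beta> + real (DIM('a) - 1) / L)))"
proof -
  let ?m = "DIM('a) - 1"
  define q where "q x = sqrt (\<epsilon>\<^sup>2 + (x - a) \<bullet> (x - a))" for x
  define u where "u x = exp (\<beta> * q x)" for x
  define w where "w = emeasure sphere_measure (UNIV :: 'a set)"
  define k where "k = p * \<beta>"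
  let ?D = "\<integral>\<^sup>+x. ennreal (norm (gradient u x) powr p + \<bar>u x\<bar> powr p) \<partial>lebesgue_on (ball a L)"
  let ?N = "\<integral>\<^sup>+x. ennreal (\<bar>u x\<bar> powr p) \<partial>surface_measure (ball a L)"
  define K where "K = k + real ?m / L"
  define c where "c = \<kappa> * K / ((\<beta> powr p + 1) * exp (k * \<epsilon>))"
  have k: "0 < k" using p \<beta> by (simp add: k_def)
  have K: "0 < K" using k L by (simp add: K_def add_pos_nonneg)
  have \<kappa>0: "0 < \<kappa>" using \<kappa> by (simp add: hausdorff_factor_def)
  have \<beta>1: "0 < \<beta> powr p + 1" by (simp add: add_nonneg_pos)
  have c: "0 < c" using K \<kappa>0 \<beta>1 by (simp add: c_def)
  have w: "0 < w" "w < \<infinity>" by (auto simp: w_def emeasure_sphere_measure_UNIV)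
  have C1: "Ck_on 1 u UNIV" and grad: "gradient u = (\<lambda>x. (u x * \<beta> / q x) *\<^sub>R (x - a))"
    using exp_radial_C1[OF \<epsilon>, where a=a and \<beta>=\<beta>] unfolding u_def[abs_def] q_def[abs_def] by auto
  have upos: "0 < u x" for x by (simp add: u_def)
  have qpos: "0 < q x" for x using \<epsilon> by (simp add: q_def add_pos_nonneg)
  have q_ge: "norm (x - a) \<le> q x" for x
    unfolding q_def norm_eq_sqrt_inner by simp
  have q_le: "q x \<le> \<epsilon> + norm (x - a)" for x
    using \<epsilon> sqrt_add_le_add_sqrt[of "\<epsilon>\<^sup>2" "(x - a) \<bullet> (x - a)"] by (simp add: q_def norm_eq_sqrt_inner)
  have u_powr: "u x powr p = exp (k * q x)" for x by (simp add: u_def k_def powr_def mult_ac)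
  have grad_le: "norm (gradient u x) \<le> \<beta> * u x" for x
  proof -
    have "norm (x - a) / q x \<le> 1" using q_ge[of x] qpos[of x] by simp
    then have "(u x * \<beta>) * (norm (x - a) / q x) \<le> (u x * \<beta>) * 1"
      using upos[of x] \<beta> by (intro mult_left_mono) auto
    then show ?thesis using upos[of x] qpos[of x] \<beta> by (simp add: grad mult.commute)
  qed
  have uC: "continuous_on UNIV u" and gC: "continuous_on UNIV (gradient u)"
    using C1 by (rule C1_continuous, rule C1_continuous_gradient)
  have [measurable]: "ball a L \<in> sets borel" by simp
  have [measurable]: "u \<in> borel_measurable borel" using uC by (rule borel_measurable_continuous_onI)
  have sob: "sobolev_W1p p (ball a L) u (gradient u)"
    unfolding sobolev_W1p_def using p
    by (intro conjI Lp_fun_continuous_bounded uC gC C1_has_weak_gradient C1) auto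
  have "\<And>x. x \<in> sphere a L \<Longrightarrow> q x = sqrt (\<epsilon>\<^sup>2 + L\<^sup>2)"
    by (simp add: q_def dist_norm power2_norm_eq_inner[symmetric] norm_minus_commute)
  then have u_sphere: "\<And>x. x \<in> sphere a L \<Longrightarrow> u x = exp (\<beta> * sqrt (\<epsilon>\<^sup>2 + L\<^sup>2))"
    by (simp add: u_def)
  have area: "(\<integral>\<^sup>+x. ennreal d * indicator (sphere a L) x \<partial>hausdorff_measure ?m) = ennreal d * (ennreal (\<kappa> * L ^ ?m) * w)" for d
    using \<kappa> L unfolding hausdorff_factor_def w_def by (simp add: mult_ac)
  have trace_int: "?N
      = ennreal (exp (k * sqrt (\<epsilon>\<^sup>2 + L\<^sup>2))) * (ennreal (\<kappa> * L ^ ?m) * w)"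
  proof -
    have "?N
        = (\<integral>\<^sup>+x. ennreal (exp (k * sqrt (\<epsilon>\<^sup>2 + L\<^sup>2))) * indicator (sphere a L) x \<partial>hausdorff_measure ?m)"
      unfolding nn_integral_surface_measure frontier_ball[OF L]
      by (intro nn_integral_cong) (auto simp: indicator_def u_sphere k_def powr_def mult_ac)
    then show ?thesis by (simp only: area)
  qed
  have tr: "has_trace p (ball a L) u (gradient u) u"
    unfolding has_trace_def
  proof (intro conjI exI[of _ "\<lambda>_. u"] allI)
    show "Lp_fun p (surface_measure (ball a L)) u"
      unfolding Lp_fun_def
    proof
      show "u \<in> borel_measurable (surface_measure (ball a L))"
        unfolding surface_measure_def by (intro measurable_restrict_space1) measurable
      show "(\<integral>\<^sup>+x. ennreal (norm (u x) powr p) \<partial>surface_measure (ball a L)) < \<infinity>"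
        using w by (simp add: trace_int ennreal_mult_less_top)
    qed
  qed (use C1 p in \<open>auto simp: Lp_tendsto_def\<close>)
  have nz: "\<not> (AE x in lebesgue_on (ball a L). u x = 0)"
  proof
    assume "AE x in lebesgue_on (ball a L). u x = 0"
    then have "AE x in lebesgue_on (ball a L). False" using upos by (auto simp: less_imp_neq[THEN not_sym] elim: eventually_mono)
    then have "(\<integral>\<^sup>+x. 1 \<partial>lebesgue_on (ball a L)) = (\<integral>\<^sup>+x. 0 \<partial>lebesgue_on (ball a L))"
      by (intro nn_integral_cong_AE) auto
    then have "emeasure lborel (ball a L) = 0" by (simp add: emeasure_restrict_space)
    then show False using L unit_ball_vol_pos[of "real DIM('a)"] by (simp add: emeasure_ball)
  qed
  have D: "?D
      \<le> ennreal ((\<beta> powr p + 1) * exp (k * \<epsilon>)) * (ennreal (L ^ ?m * exp (k * L) / K) * w)"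
  proof -
    have "?D
        \<le> (\<integral>\<^sup>+x. ennreal ((\<beta> powr p + 1) * exp (k * \<epsilon>)) * (ennreal (exp (k * norm (x - a))) * indicator (ball a L) x) \<partial>lborel)"
      unfolding nn_integral_lebesgue_on[OF borel_open[OF open_ball]]
    proof (intro nn_integral_mono)
      fix x
      have "norm (gradient u x) powr p \<le> (\<beta> * u x) powr p"
        using grad_le p by (intro powr_mono2) auto
      also have "\<dots> = \<beta> powr p * u x powr p" using \<beta> upos[of x] by (simp add: powr_mult)
      finally have "norm (gradient u x) powr p + \<bar>u x\<bar> powr p \<le> (\<beta> powr p + 1) * u x powr p"
        using upos[of x] by (simp add: algebra_simps)
      also have "u x powr p \<le> exp (k * \<epsilon>) * exp (k * norm (x - a))"
        using q_le[of x] k by (simp add: u_powr mult_exp_exp distrib_left[symmetric])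
      finally have "norm (gradient u x) powr p + \<bar>u x\<bar> powr p
          \<le> ((\<beta> powr p + 1) * exp (k * \<epsilon>)) * exp (k * norm (x - a))"
        using \<beta>1 by (simp add: mult.assoc)
      then have "ennreal (norm (gradient u x) powr p + \<bar>u x\<bar> powr p)
          \<le> ennreal (((\<beta> powr p + 1) * exp (k * \<epsilon>)) * exp (k * norm (x - a)))"
        by (rule ennreal_leI)
      also have "\<dots> = ennreal ((\<beta> powr p + 1) * exp (k * \<epsilon>)) * ennreal (exp (k * norm (x - a)))"
        using \<beta>1 by (intro ennreal_mult) auto
      finally show "ennreal (norm (gradient u x) powr p + \<bar>u x\<bar> powr p) * indicator (ball a L) x
          \<le> ennreal ((\<beta> powr p + 1) * exp (k * \<epsilon>)) * (ennreal (exp (k * norm (x - a))) * indicator (ball a L) x)"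
        unfolding mult.assoc[symmetric] by (rule mult_right_mono) simp
    qed
    also have "\<dots> = ennreal ((\<beta> powr p + 1) * exp (k * \<epsilon>)) *
        (\<integral>\<^sup>+x. ennreal (exp (k * norm (x - a))) * indicator (ball a L) x \<partial>lborel)"
      by (rule nn_integral_cmult) measurable
    also have "\<dots> \<le> ennreal ((\<beta> powr p + 1) * exp (k * \<epsilon>)) * (ennreal (L ^ ?m * exp (k * L) / K) * w)"
      unfolding K_def w_def by (intro mult_left_mono ball_exp_integral_le k L) simp
    finally show ?thesis .
  qed
  have "best_trace_const p (ball a L) \<le> ennreal (1 / c)"
  proof (rule best_trace_const_le[OF sob tr nz _ _ _ c])
    have "ennreal c * ?D
        \<le> ennreal c * (ennreal ((\<beta> powr p + 1) * exp (k * \<epsilon>)) * (ennreal (L ^ ?m * exp (k * L) / K) * w))"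
      using D by (intro mult_left_mono) auto
    also have "\<dots> = ennreal (c * ((\<beta> powr p + 1) * exp (k * \<epsilon>)) * (L ^ ?m * exp (k * L) / K)) * w"
    proof -
      have "ennreal c * (ennreal A * (ennreal X * w)) = ennreal (c * A * X) * w"
        if "0 \<le> A" "0 \<le> X" for A X :: real
        using c that by (simp add: ennreal_mult mult.assoc)
      then show ?thesis using \<beta>1 K L by simp
    qed
    also have "c * ((\<beta> powr p + 1) * exp (k * \<epsilon>)) * (L ^ ?m * exp (k * L) / K) = exp (k * L) * (\<kappa> * L ^ ?m)"
      using \<beta>1 K by (simp add: c_def)
    also have "ennreal \<dots> * w \<le> ennreal (exp (k * sqrt (\<epsilon>\<^sup>2 + L\<^sup>2)) * (\<kappa> * L ^ ?m)) * w"
    proof (intro mult_right_mono ennreal_leI)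
      have "L \<le> sqrt (\<epsilon>\<^sup>2 + L\<^sup>2)" by (rule real_le_rsqrt) simp
      then show "exp (k * L) \<le> exp (k * sqrt (\<epsilon>\<^sup>2 + L\<^sup>2))" using k by simp
    qed (use \<kappa>0 L in auto)
    also have "\<dots> = ?N"
      using \<kappa>0 L by (simp add: trace_int ennreal_mult mult.assoc)
    finally show "ennreal c * ?D
        \<le> ?N" .
    show "?D < \<infinity>"
      by (rule le_less_trans[OF D]) (use w in \<open>simp add: ennreal_mult_less_top\<close>)
    show "0 < ?N"
      using w(1) \<kappa>0 L by (simp add: trace_int ennreal_zero_less_mult_iff)
  qed
  then show ?thesis by (simp add: c_def K_def k_def)
qed

lemma best_trace_const_ball_le:
  fixes a :: "'a::euclidean_space"
  assumes \<kappa>: "hausdorff_factor TYPE('a) \<kappa>" and p: "1 < p" and \<beta>: "0 < \<beta>" and L: "0 < L"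
  shows "best_trace_const p (ball a L)
    \<le> ennreal ((\<beta> powr p + 1) / (\<kappa> * (p * \<beta> + real (DIM('a) - 1) / L)))"
proof -
  let ?f = "\<lambda>\<epsilon>. (\<beta> powr p + 1) * exp (p * \<beta> * \<epsilon>) / (\<kappa> * (p * \<beta> + real (DIM('a) - 1) / L))"
  have inv: "(\<lambda>k. 1 / real (Suc k)) \<longlonglongrightarrow> 0"
    using LIMSEQ_inverse_real_of_nat by (simp add: inverse_eq_divide)
  have "0 < p * \<beta> + real (DIM('a) - 1) / L" using p \<beta> L by (simp add: add_pos_nonneg)
  then have "\<kappa> * (p * \<beta> + real (DIM('a) - 1) / L) \<noteq> 0"
    using \<kappa> by (simp add: hausdorff_factor_def)
  then have "(\<lambda>k. ennreal (?f (1 / real (Suc k)))) \<longlonglongrightarrow> ennreal (?f 0)"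
    by (intro tendsto_ennrealI tendsto_intros inv)
  moreover have "best_trace_const p (ball a L) \<le> ennreal (?f (1 / real (Suc k)))" for k
    by (rule best_trace_const_ball_le_eps[OF \<kappa> p \<beta> L]) simp
  ultimately have "best_trace_const p (ball a L) \<le> ennreal (?f 0)"
    by (intro LIMSEQ_le_const) auto
  then show ?thesis by simp
qed

section \<open>Annuli: a lower bound for the best constant\<close>

lemma DERIV_abs_powr:
  fixes x :: real
  assumes p: "1 < p"
  shows "((\<lambda>x. \<bar>x\<bar> powr p) has_real_derivative (p * \<bar>x\<bar> powr (p - 1) * sgn x)) (at x)"
proof (cases "x = 0")
  case True
  have "((\<lambda>h::real. \<bar>h\<bar> powr (p - 1)) \<longlongrightarrow> \<bar>0\<bar> powr (p - 1)) (at 0)"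
    using p by (intro tendsto_intros) auto
  then have lim: "((\<lambda>h::real. \<bar>h\<bar> powr (p - 1)) \<longlongrightarrow> 0) (at 0)" by simp
  have "((\<lambda>h::real. (\<bar>0 + h\<bar> powr p - \<bar>0\<bar> powr p) / h) \<longlongrightarrow> 0) (at 0)"
  proof (rule Lim_null_comparison[OF _ lim])
    show "\<forall>\<^sub>F h in at 0. norm ((\<bar>0 + h\<bar> powr p - \<bar>0\<bar> powr p) / h) \<le> \<bar>h\<bar> powr (p - 1)"
      by (rule always_eventually) (auto simp: powr_diff)
  qed
  then show ?thesis using True by (simp add: DERIV_def)
next
  case False
  then consider "0 < x" | "x < 0" by linarith
  then show ?thesis
  proof cases
    case 1
    have "((\<lambda>x. x powr p) has_real_derivative (p * \<bar>x\<bar> powr (p - 1) * sgn x)) (at x)"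
      using 1 by (auto intro!: derivative_eq_intros)
    then show ?thesis
      by (rule has_field_derivative_transform_within_open[where S="{0<..}"]) (use 1 in auto)
  next
    case 2
    have "((\<lambda>x. (- x) powr p) has_real_derivative (p * \<bar>x\<bar> powr (p - 1) * sgn x)) (at x)"
      using 2 by (auto intro!: derivative_eq_intros)
    then show ?thesis
      by (rule has_field_derivative_transform_within_open[where S="{..<0}"]) (use 2 in auto)
  qed
qed

lemma young_scaled:
  fixes a b :: real
  assumes p: "1 < p" and \<alpha>: "0 < \<alpha>" and a: "0 \<le> a" and b: "0 \<le> b"
  shows "p * a powr (p - 1) * b \<le> \<alpha> powr (1 - p) * b powr p + (p - 1) * \<alpha> * a powr p"
proof (cases "a = 0 \<or> b = 0")
  case True then show ?thesis using assms by auto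
next
  case False
  then have a: "0 < a" and b: "0 < b" using a b by auto
  define A where "A = \<alpha> powr (1 - p) * b powr p"
  define B where "B = \<alpha> * a powr p"
  have "A powr (1 / p) * B powr (1 - 1 / p) \<le> 1 / p * A + (1 - 1 / p) * B"
    using a b \<alpha> p by (intro Youngs_inequality_0) (auto simp: A_def B_def)
  moreover have "A powr (1 / p) * B powr (1 - 1 / p) = a powr (p - 1) * b"
  proof -
    have "A powr (1 / p) = \<alpha> powr ((1 - p) / p) * b"
      using \<alpha> b p by (simp add: A_def powr_mult powr_powr)
    moreover have "B powr (1 - 1 / p) = \<alpha> powr (1 - 1 / p) * a powr (p - 1)"
      using \<alpha> a p by (simp add: B_def powr_mult powr_powr right_diff_distrib)
    moreover have "\<alpha> powr ((1 - p) / p) * \<alpha> powr (1 - 1 / p) = 1"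
      using \<alpha> p by (simp add: powr_add[symmetric] diff_divide_distrib)
    moreover have "X * b * (Y * c) = (X * Y) * (c * b)" for X Y c :: real by simp
    ultimately show ?thesis by simp
  qed
  ultimately have "p * (a powr (p - 1) * b) \<le> p * (1 / p * A + (1 - 1 / p) * B)"
    using p by (intro mult_left_mono) auto
  also have "\<dots> = A + (p - 1) * B" using p by (simp add: field_simps)
  finally show ?thesis by (simp add: A_def B_def mult.assoc)
qed

lemma one_le_powr_neg:
  fixes t :: real
  assumes "0 < t" "t < 1" "1 < p"
  shows "1 \<le> t powr (1 - p)"
  using powr_mono'[of "1 - p" 0 t] assms by simp

lemma powr_norm_add_le:
  fixes a b :: "'b::real_normed_vector"
  assumes p: "1 < p" and t: "0 < t" "t < 1"
  shows "norm (a + b) powr p \<le> (1 - t) powr (1 - p) * norm a powr p + t powr (1 - p) * norm b powr p"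
proof (cases "a = 0 \<or> b = 0")
  case True
  then show ?thesis
    using t one_le_powr_neg[of t p] one_le_powr_neg[of "1 - t" p] p
      mult_right_mono[of 1 _ "norm a powr p"] mult_right_mono[of 1 _ "norm b powr p"] by auto
next
  case False
  have conv: "convex_on {0<..} (\<lambda>x::real. x powr p)"
    using p by (intro powr_convex) simp
  have "norm (a + b) powr p \<le> ((1 - t) * (norm a / (1 - t)) + t * (norm b / t)) powr p"
    using p t norm_triangle_ineq[of a b] by (intro powr_mono2) auto
  also have "\<dots> \<le> (1 - t) * (norm a / (1 - t)) powr p + t * (norm b / t) powr p"
    using convex_onD[OF conv, of t "norm a / (1 - t)" "norm b / t"] t False by simp
  also have "\<dots> = (1 - t) powr (1 - p) * norm a powr p + t powr (1 - p) * norm b powr p"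
    using t by (simp add: powr_divide powr_diff)
  finally show ?thesis .
qed

text \<open>Integrate the derivative of \<open>h(s) * s^m * |f(s)|^p\<close>: Young's inequality separates the
  derivative of \<open>f\<close>, and the differential inequality for \<open>h\<close> absorbs the rest.\<close>

lemma ray_trace_le:
  fixes f f' g h h' :: "real \<Rightarrow> real"
  assumes p: "1 < p" and \<alpha>: "0 < \<alpha>" and ab: "0 < a" "a < b"
    and h: "\<And>s. s \<in> {a..b} \<Longrightarrow> (h has_real_derivative h' s) (at s)"
      "\<And>s. s \<in> {a..b} \<Longrightarrow> \<bar>h s\<bar> \<le> 1" "h a = -1" "h b = 1"
    and riccati: "\<And>s. s \<in> {a..b} \<Longrightarrow>
      h' s + real m * h s / s + (p - 1) * \<alpha> * \<bar>h s\<bar> \<le> \<alpha> powr (1 - p)"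
    and f: "\<And>s. s \<in> {a..b} \<Longrightarrow> (f has_real_derivative f' s) (at s)"
    and g: "\<And>s. s \<in> {a..b} \<Longrightarrow> \<bar>f' s\<bar> \<le> g s" "continuous_on {a..b} g"
  shows "ennreal (b ^ m * \<bar>f b\<bar> powr p + a ^ m * \<bar>f a\<bar> powr p)
    \<le> (\<integral>\<^sup>+s. ennreal (\<alpha> powr (1 - p) * (g s powr p + \<bar>f s\<bar> powr p) * s ^ m) * indicator {a..b} s \<partial>lborel)"
proof -
  define F where "F s = h s * (s ^ m * \<bar>f s\<bar> powr p)" for s
  define F' where "F' s = h' s * (s ^ m * \<bar>f s\<bar> powr p)
      + h s * (real m * s ^ m / s * \<bar>f s\<bar> powr p + s ^ m * (p * \<bar>f s\<bar> powr (p - 1) * sgn (f s) * f' s))" for s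
  define W where "W s = \<alpha> powr (1 - p) * (g s powr p + \<bar>f s\<bar> powr p) * s ^ m" for s
  have g0: "0 \<le> g s" if "s \<in> {a..b}" for s using g(1)[OF that] by simp
  have contf: "continuous_on {a..b} f"
    using f by (intro continuous_at_imp_continuous_on) (blast intro: DERIV_isCont)
  have contW: "continuous_on {a..b} W"
    unfolding W_def using p g0 by (intro continuous_intros g(2) contf continuous_on_powr') (auto intro: g0)
  have W0: "0 \<le> W s" if "s \<in> {a..b}" for s using that ab by (simp add: W_def)
  have D: "(F has_real_derivative F' s) (at s)" if s: "s \<in> {a..b}" for s
  proof -
    have s0: "s \<noteq> 0" using s ab by auto
    have 1: "((\<lambda>s. \<bar>f s\<bar> powr p) has_real_derivative (p * \<bar>f s\<bar> powr (p - 1) * sgn (f s) * f' s)) (at s)"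
      by (rule DERIV_chain2[OF DERIV_abs_powr[OF p] f[OF s]])
    have 2: "((\<lambda>s. s ^ m) has_real_derivative (real m * s ^ m / s)) (at s)"
      using s0 DERIV_pow[of m s] by (cases m) auto
    show ?thesis
      unfolding F_def F'_def
      by (rule derivative_eq_intros h(1)[OF s] 1 2 refl)+ (simp add: algebra_simps)
  qed
  have le: "F' s \<le> W s" if s: "s \<in> {a..b}" for s
  proof -
    have s0: "0 < s" using s ab by auto
    have "h s * (sgn (f s) * f' s) \<le> \<bar>h s\<bar> * g s"
    proof -
      have "h s * (sgn (f s) * f' s) \<le> \<bar>h s * (sgn (f s) * f' s)\<bar>" by simp
      also have "\<dots> = \<bar>h s\<bar> * (\<bar>sgn (f s)\<bar> * \<bar>f' s\<bar>)" by (simp add: abs_mult)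
      also have "\<dots> \<le> \<bar>h s\<bar> * (1 * g s)"
        using g(1)[OF s] by (intro mult_left_mono mult_mono) (auto simp: sgn_if)
      finally show ?thesis by simp
    qed
    then have "(p * \<bar>f s\<bar> powr (p - 1)) * (h s * (sgn (f s) * f' s)) \<le> (p * \<bar>f s\<bar> powr (p - 1)) * (\<bar>h s\<bar> * g s)"
      using p by (intro mult_left_mono) auto
    also have "\<dots> = \<bar>h s\<bar> * (p * \<bar>f s\<bar> powr (p - 1) * g s)" by simp
    also have "\<dots> \<le> \<bar>h s\<bar> * (\<alpha> powr (1 - p) * g s powr p + (p - 1) * \<alpha> * \<bar>f s\<bar> powr p)"
      using young_scaled[OF p \<alpha>, of "\<bar>f s\<bar>" "g s"] g0[OF s] by (intro mult_left_mono) auto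
    also have "\<dots> \<le> \<alpha> powr (1 - p) * g s powr p + \<bar>h s\<bar> * ((p - 1) * \<alpha> * \<bar>f s\<bar> powr p)"
      using h(2)[OF s] by (simp add: distrib_left mult_left_le_one_le)
    finally have 1: "(p * \<bar>f s\<bar> powr (p - 1)) * (h s * (sgn (f s) * f' s))
        \<le> \<alpha> powr (1 - p) * g s powr p + (p - 1) * \<alpha> * \<bar>h s\<bar> * \<bar>f s\<bar> powr p"
      by (simp add: mult_ac)
    have "(h' s + real m * h s / s + (p - 1) * \<alpha> * \<bar>h s\<bar>) * \<bar>f s\<bar> powr p \<le> \<alpha> powr (1 - p) * \<bar>f s\<bar> powr p"
      by (intro mult_right_mono riccati s) auto
    with 1 have "(h' s + real m * h s / s) * \<bar>f s\<bar> powr p + (p * \<bar>f s\<bar> powr (p - 1)) * (h s * (sgn (f s) * f' s))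
        \<le> \<alpha> powr (1 - p) * (g s powr p + \<bar>f s\<bar> powr p)"
      by (simp add: algebra_simps)
    then have "((h' s + real m * h s / s) * \<bar>f s\<bar> powr p + (p * \<bar>f s\<bar> powr (p - 1)) * (h s * (sgn (f s) * f' s))) * s ^ m
        \<le> \<alpha> powr (1 - p) * (g s powr p + \<bar>f s\<bar> powr p) * s ^ m"
      using s0 by (intro mult_right_mono) auto
    then show ?thesis by (simp add: F'_def W_def algebra_simps)
  qed
  have I1: "(F' has_integral (F b - F a)) {a..b}"
    using ab D by (intro fundamental_theorem_of_calculus)
      (auto simp: has_real_derivative_iff_has_vector_derivative[symmetric] intro: DERIV_subset)
  obtain I where I2: "(W has_integral I) {a..b}"
    using integrable_continuous_real[OF contW] by (auto simp: integrable_on_def)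
  have "F b - F a \<le> I" by (rule has_integral_le[OF I1 I2 le])
  moreover have "F b - F a = b ^ m * \<bar>f b\<bar> powr p + a ^ m * \<bar>f a\<bar> powr p"
    by (simp add: F_def h)
  ultimately have "ennreal (b ^ m * \<bar>f b\<bar> powr p + a ^ m * \<bar>f a\<bar> powr p) \<le> ennreal I"
    by (simp only: ennreal_leI)
  also have "ennreal I = (\<integral>\<^sup>+s. ennreal (W s) * indicator {a..b} s \<partial>lborel)"
    using nn_integral_has_integral_lebesgue'[OF W0 I2] by simp
  finally show ?thesis by (simp add: W_def)
qed

lemma annulus_measurable [measurable]: "annulus r R \<in> sets borel"
  unfolding annulus_def by measurable

lemma open_annulus: "open (annulus r R)"
  unfolding annulus_def by (intro open_Collect_conj open_Collect_less continuous_intros)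

lemma frontier_annulus_subset: "frontier (annulus r R) \<subseteq> sphere 0 r \<union> sphere 0 R"
proof
  fix x :: 'a assume x: "x \<in> frontier (annulus r R)"
  have "closed {x :: 'a. r \<le> norm x \<and> norm x \<le> R}"
    by (intro closed_Collect_conj closed_Collect_le continuous_intros)
  then have "closure (annulus r R) \<subseteq> {x :: 'a. r \<le> norm x \<and> norm x \<le> R}"
    by (intro closure_minimal) (auto simp: annulus_def)
  moreover have "x \<in> closure (annulus r R)" "x \<notin> annulus r R"
    using x by (auto simp: frontier_def interior_open[OF open_annulus])
  ultimately have "r \<le> norm x \<and> norm x \<le> R" "\<not> (r < norm x \<and> norm x < R)"
    by (auto simp only: annulus_def mem_Collect_eq)
  then show "x \<in> sphere 0 r \<union> sphere 0 R" by (auto simp: not_less)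
qed

text \<open>Integrate the inequality on rays over all directions. The value of \<open>h\<close> on the inner sphere is \<open>-1\<close>
  because the outer normal of the annulus points towards the origin there.\<close>

lemma annulus_trace_le_C1:
  fixes v :: "'a::euclidean_space \<Rightarrow> real"
  assumes \<kappa>: "hausdorff_factor TYPE('a) \<kappa>" and p: "1 < p" and \<alpha>: "0 < \<alpha>" and ab: "0 < a" "a < b"
    and h: "\<And>s. s \<in> {a..b} \<Longrightarrow> (h has_real_derivative h' s) (at s)"
      "\<And>s. s \<in> {a..b} \<Longrightarrow> \<bar>h s\<bar> \<le> 1" "h a = -1" "h b = 1"
    and riccati: "\<And>s. s \<in> {a..b} \<Longrightarrow>
      h' s + real (DIM('a) - 1) * h s / s + (p - 1) * \<alpha> * \<bar>h s\<bar> \<le> \<alpha> powr (1 - p)"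
    and v: "Ck_on 1 v UNIV"
  shows "(\<integral>\<^sup>+x. ennreal (norm (v x) powr p) \<partial>surface_measure (annulus a b :: 'a set))
    \<le> ennreal (\<kappa> * \<alpha> powr (1 - p)) *
      (\<integral>\<^sup>+x. ennreal (norm (gradient v x) powr p + norm (v x) powr p) \<partial>lebesgue_on (annulus a b))"
proof -
  let ?m = "DIM('a) - 1"
  have \<kappa>0: "0 < \<kappa>" using \<kappa> by (simp add: hausdorff_factor_def)
  have b: "0 < b" using ab by simp
  have vC: "continuous_on UNIV v" by (rule C1_continuous[OF v])
  have gC: "continuous_on UNIV (gradient v)" by (rule C1_continuous_gradient[OF v])
  have [measurable]: "v \<in> borel_measurable borel" "gradient v \<in> borel_measurable borel"
    using vC gC by (auto intro: borel_measurable_continuous_onI)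
  define V where "V x = ennreal (norm (v x) powr p)" for x
  define E where "E x = norm (gradient v x) powr p + norm (v x) powr p" for x
  let ?ray = "\<lambda>\<theta>. \<integral>\<^sup>+s. ennreal (s ^ ?m) * indicator {0<..} s *
          (ennreal (\<alpha> powr (1 - p) * E (0 + s *\<^sub>R \<theta>)) * indicator (annulus a b) (0 + s *\<^sub>R \<theta>)) \<partial>lborel"
  let ?bd = "\<lambda>\<theta>. ennreal (b ^ ?m) * V (b *\<^sub>R \<theta>) + ennreal (a ^ ?m) * V (a *\<^sub>R \<theta>)"
  have [measurable]: "V \<in> borel_measurable borel" "E \<in> borel_measurable borel"
    unfolding V_def[abs_def] E_def[abs_def] by measurable
  have sphere: "(\<integral>\<^sup>+x. V x * indicator (sphere 0 L) x \<partial>hausdorff_measure ?m)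
      = ennreal \<kappa> * (\<integral>\<^sup>+\<theta>. ennreal (L ^ ?m) * V (L *\<^sub>R \<theta>) \<partial>sphere_measure)" if L: "0 < L" for L
  proof -
    have "(\<integral>\<^sup>+x. V x * indicator (sphere 0 L) x \<partial>hausdorff_measure ?m)
      = ennreal (\<kappa> * L ^ ?m) * (\<integral>\<^sup>+\<theta>. V (0 + L *\<^sub>R \<theta>) \<partial>sphere_measure)"
      using \<kappa> L \<open>V \<in> borel_measurable borel\<close> unfolding hausdorff_factor_def by blast
    also have "\<dots> = ennreal \<kappa> * (ennreal (L ^ ?m) * (\<integral>\<^sup>+\<theta>. V (L *\<^sub>R \<theta>) \<partial>sphere_measure))"
      using \<kappa>0 L by (simp add: ennreal_mult mult.assoc)
    also have "ennreal (L ^ ?m) * (\<integral>\<^sup>+\<theta>. V (L *\<^sub>R \<theta>) \<partial>sphere_measure)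
        = (\<integral>\<^sup>+\<theta>. ennreal (L ^ ?m) * V (L *\<^sub>R \<theta>) \<partial>sphere_measure)"
      by (rule nn_integral_cmult[symmetric]) measurable
    finally show ?thesis .
  qed
  have "(\<integral>\<^sup>+x. V x \<partial>surface_measure (annulus a b :: 'a set))
      \<le> (\<integral>\<^sup>+x. V x * indicator (sphere 0 b) x + V x * indicator (sphere 0 a) x \<partial>hausdorff_measure ?m)"
    unfolding nn_integral_surface_measure
    using frontier_annulus_subset[of a b] by (intro nn_integral_mono) (auto simp: indicator_def)
  also have "\<dots> = (\<integral>\<^sup>+x. V x * indicator (sphere 0 b) x \<partial>hausdorff_measure ?m)
      + (\<integral>\<^sup>+x. V x * indicator (sphere 0 a) x \<partial>hausdorff_measure ?m)"
    by (intro nn_integral_add borel_measurable_times_ennreal borel_measurable_indicator) auto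
  also have "\<dots> = ennreal \<kappa> * (\<integral>\<^sup>+\<theta>. ?bd \<theta> \<partial>sphere_measure)"
    unfolding sphere[OF b] sphere[OF ab(1)] distrib_left[symmetric]
    by (subst nn_integral_add) auto
  also have "(\<integral>\<^sup>+\<theta>. ?bd \<theta> \<partial>sphere_measure)
      \<le> (\<integral>\<^sup>+\<theta>. ?ray \<theta> \<partial>sphere_measure)"
  proof (rule nn_integral_mono_AE)
    show "AE \<theta> in sphere_measure. ?bd \<theta>
       \<le> ?ray \<theta>"
      using AE_sphere_measure
    proof eventually_elim
      case (elim \<theta>)
      have D: "((\<lambda>s. v (s *\<^sub>R \<theta>)) has_real_derivative (gradient v (s *\<^sub>R \<theta>) \<bullet> \<theta>)) (at s)" for s
      proof -
        have "((\<lambda>s. v (s *\<^sub>R \<theta>)) has_derivative (\<lambda>h. gradient v (s *\<^sub>R \<theta>) \<bullet> (h *\<^sub>R \<theta>))) (at s)"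
          by (rule has_derivative_compose[OF _ C1_has_derivative[OF v]])
             (auto intro!: derivative_eq_intros)
        then show ?thesis by (rule has_derivative_imp_has_field_derivative) simp
      qed
      have gle: "\<bar>gradient v (s *\<^sub>R \<theta>) \<bullet> \<theta>\<bar> \<le> norm (gradient v (s *\<^sub>R \<theta>))" for s
        using Cauchy_Schwarz_ineq2[of "gradient v (s *\<^sub>R \<theta>)" \<theta>] elim by simp
      have cont: "continuous_on {a..b} (\<lambda>s. norm (gradient v (s *\<^sub>R \<theta>)))"
        by (intro continuous_intros continuous_on_compose2[OF gC]) auto
      have "?bd \<theta>
          = ennreal (b ^ ?m * \<bar>v (b *\<^sub>R \<theta>)\<bar> powr p + a ^ ?m * \<bar>v (a *\<^sub>R \<theta>)\<bar> powr p)"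
        using ab by (simp add: V_def ennreal_mult)
      also have "\<dots> \<le> (\<integral>\<^sup>+s. ennreal (\<alpha> powr (1 - p) *
          (norm (gradient v (s *\<^sub>R \<theta>)) powr p + \<bar>v (s *\<^sub>R \<theta>)\<bar> powr p) * s ^ ?m) * indicator {a..b} s \<partial>lborel)"
        using ray_trace_le[OF p \<alpha> ab h riccati D gle cont] by simp
      also have "\<dots> = ?ray \<theta>"
      proof (rule nn_integral_cong_AE)
        show "AE s in lborel. ennreal (\<alpha> powr (1 - p) *
            (norm (gradient v (s *\<^sub>R \<theta>)) powr p + \<bar>v (s *\<^sub>R \<theta>)\<bar> powr p) * s ^ ?m) * indicator {a..b} s
          = ennreal (s ^ ?m) * indicator {0<..} s *
          (ennreal (\<alpha> powr (1 - p) * E (0 + s *\<^sub>R \<theta>)) * indicator (annulus a b) (0 + s *\<^sub>R \<theta>))"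
          using AE_lborel_singleton[of a] AE_lborel_singleton[of b]
        proof eventually_elim
          case (elim s)
          show ?case
          proof (cases "s \<in> {a<..<b}")
            case True
            then have "s *\<^sub>R \<theta> \<in> annulus a b" "0 < s" using ab \<open>norm \<theta> = 1\<close> by (auto simp: annulus_def)
            moreover have "ennreal (\<alpha> powr (1 - p) * E (s *\<^sub>R \<theta>) * s ^ ?m) = ennreal (s ^ ?m) * ennreal (\<alpha> powr (1 - p) * E (s *\<^sub>R \<theta>))"
              using \<open>0 < s\<close> by (subst ennreal_mult[symmetric]) (auto simp: E_def mult.commute)
            ultimately show ?thesis using True by (simp add: E_def)
          next
            case False
            then have "s \<notin> {a..b}" using elim by auto
            moreover have "s *\<^sub>R \<theta> \<notin> annulus a b \<or> s \<le> 0"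
              using False \<open>norm \<theta> = 1\<close> by (auto simp: annulus_def)
            ultimately show ?thesis by auto
          qed
        qed
      qed
      finally show ?case .
    qed
  qed
  also have "\<dots> = (\<integral>\<^sup>+x. ennreal (\<alpha> powr (1 - p) * E x) * indicator (annulus a b) x \<partial>lborel)"
    by (rule nn_integral_polar[symmetric]) measurable
  also have "\<dots> = (\<integral>\<^sup>+x. ennreal (\<alpha> powr (1 - p)) * (ennreal (E x) * indicator (annulus a b) x) \<partial>lborel)"
    by (intro nn_integral_cong) (auto simp: E_def indicator_def ennreal_mult'')
  also have "\<dots> = ennreal (\<alpha> powr (1 - p)) * (\<integral>\<^sup>+x. ennreal (E x) * indicator (annulus a b) x \<partial>lborel)"
    by (rule nn_integral_cmult) measurable
  finally show ?thesis
    using \<kappa>0 by (simp add: V_def E_def nn_integral_lebesgue_on ennreal_mult mult.assoc mult_left_mono)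
qed

lemma nn_integral_powr_norm_le:
  fixes f g :: "'a \<Rightarrow> 'b::euclidean_space"
  assumes p: "1 < p" and t: "0 < t" "t < 1"
    and [measurable]: "f \<in> borel_measurable M" "g \<in> borel_measurable M"
  shows "(\<integral>\<^sup>+x. ennreal (norm (f x) powr p) \<partial>M) \<le>
    ennreal ((1 - t) powr (1 - p)) * (\<integral>\<^sup>+x. ennreal (norm (g x) powr p) \<partial>M)
    + ennreal (t powr (1 - p)) * (\<integral>\<^sup>+x. ennreal (norm (f x - g x) powr p) \<partial>M)"
proof -
  have "(\<integral>\<^sup>+x. ennreal (norm (f x) powr p) \<partial>M) \<le>
      (\<integral>\<^sup>+x. ennreal ((1 - t) powr (1 - p)) * ennreal (norm (g x) powr p)
        + ennreal (t powr (1 - p)) * ennreal (norm (f x - g x) powr p) \<partial>M)"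
  proof (rule nn_integral_mono)
    fix x
    show "ennreal (norm (f x) powr p) \<le> ennreal ((1 - t) powr (1 - p)) * ennreal (norm (g x) powr p)
        + ennreal (t powr (1 - p)) * ennreal (norm (f x - g x) powr p)"
      using powr_norm_add_le[OF p t, of "g x" "f x - g x"]
      by (simp add: ennreal_mult[symmetric] ennreal_plus[symmetric] ennreal_leI del: ennreal_plus)
  qed
  also have "\<dots> = ennreal ((1 - t) powr (1 - p)) * (\<integral>\<^sup>+x. ennreal (norm (g x) powr p) \<partial>M)
    + ennreal (t powr (1 - p)) * (\<integral>\<^sup>+x. ennreal (norm (f x - g x) powr p) \<partial>M)"
    by (simp add: nn_integral_add nn_integral_cmult)
  finally show ?thesis .
qed

text \<open>A trace is an \<open>L\<^sup>p\<close> limit of continuously differentiable functions. The inequality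
  \<open>|a + b| powr p \<le> (1 - t) powr (1 - p) * |a| powr p + t powr (1 - p) * |b| powr p\<close> takes the place of
  Minkowski's inequality: the approximation errors vanish for fixed \<open>t\<close>, and letting \<open>t\<close> tend to \<open>0\<close>
  recovers the constant.\<close>

lemma trace_inequality_limit:
  assumes p: "1 < p" and c: "0 < c"
    and C1: "\<And>v. Ck_on 1 v UNIV \<Longrightarrow> (\<integral>\<^sup>+x. ennreal (norm (v x) powr p) \<partial>surface_measure \<Omega>)
      \<le> ennreal c * (\<integral>\<^sup>+x. ennreal (norm (gradient v x) powr p + norm (v x) powr p) \<partial>lebesgue_on \<Omega>)"
    and sob: "sobolev_W1p p \<Omega> u G" and tr: "has_trace p \<Omega> u G g"
  shows "(\<integral>\<^sup>+x. ennreal (norm (g x) powr p) \<partial>surface_measure \<Omega>)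
      \<le> ennreal c * (\<integral>\<^sup>+x. ennreal (norm (G x) powr p + norm (u x) powr p) \<partial>lebesgue_on \<Omega>)"
proof -
  let ?S = "surface_measure \<Omega>" and ?L = "lebesgue_on \<Omega>"
  define N where "N = (\<integral>\<^sup>+x. ennreal (norm (g x) powr p) \<partial>?S)"
  define U where "U = (\<integral>\<^sup>+x. ennreal (norm (u x) powr p) \<partial>?L)"
  define W where "W = (\<integral>\<^sup>+x. ennreal (norm (G x) powr p) \<partial>?L)"
  have [measurable]: "u \<in> borel_measurable ?L" "G \<in> borel_measurable ?L" "g \<in> borel_measurable ?S"
    and fin: "U < \<infinity>" "W < \<infinity>"
    using sob tr by (auto simp: sobolev_W1p_def has_trace_def Lp_fun_def U_def W_def)
  obtain v where v: "\<And>k. Ck_on 1 (v k) UNIV"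
    and lim: "Lp_tendsto p ?L v u" "Lp_tendsto p ?L (\<lambda>k. gradient (v k)) G" "Lp_tendsto p ?S v g"
    using tr unfolding has_trace_def by blast
  have [measurable]: "v k \<in> borel_measurable ?L" "gradient (v k) \<in> borel_measurable ?L"
      "v k \<in> borel_measurable ?S" for k
  proof -
    show "v k \<in> borel_measurable ?L" "gradient (v k) \<in> borel_measurable ?L"
      by (intro borel_measurable_lebesgue_on_continuous C1_continuous[OF v] C1_continuous_gradient[OF v])+
    have "v k \<in> borel_measurable borel" by (intro borel_measurable_continuous_onI C1_continuous[OF v])
    then show "v k \<in> borel_measurable ?S"
      unfolding surface_measure_def by (intro measurable_restrict_space1) simp
  qed
  define e1 where "e1 k = (\<integral>\<^sup>+x. ennreal (norm (v k x - u x) powr p) \<partial>?L)" for k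
  define e2 where "e2 k = (\<integral>\<^sup>+x. ennreal (norm (gradient (v k) x - G x) powr p) \<partial>?L)" for k
  define e3 where "e3 k = (\<integral>\<^sup>+x. ennreal (norm (v k x - g x) powr p) \<partial>?S)" for k
  have e: "e1 \<longlonglongrightarrow> 0" "e2 \<longlonglongrightarrow> 0" "e3 \<longlonglongrightarrow> 0"
    using lim unfolding Lp_tendsto_def e1_def e2_def e3_def by auto
  let ?U = "\<lambda>k. \<integral>\<^sup>+x. ennreal (norm (v k x) powr p) \<partial>?L"
  let ?W = "\<lambda>k. \<integral>\<^sup>+x. ennreal (norm (gradient (v k) x) powr p) \<partial>?L"
  have bound: "N \<le> ennreal ((1 - t) powr (1 - p)) * (ennreal c * (ennreal ((1 - t) powr (1 - p)) * (W + U)))"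
    if t: "0 < t" "t < 1" for t
  proof -
    define A where "A = ennreal ((1 - t) powr (1 - p))"
    define B where "B = ennreal (t powr (1 - p))"
    have AB: "A < top" "B < top" by (auto simp: A_def B_def)
    have "N \<le> A * (ennreal c * ((A * W + B * e2 k) + (A * U + B * e1 k))) + B * e3 k" for k
    proof -
      have "N \<le> A * (\<integral>\<^sup>+x. ennreal (norm (v k x) powr p) \<partial>?S) + B * (\<integral>\<^sup>+x. ennreal (norm (g x - v k x) powr p) \<partial>?S)"
        unfolding N_def A_def B_def by (intro nn_integral_powr_norm_le p t) measurable
      also have "(\<integral>\<^sup>+x. ennreal (norm (g x - v k x) powr p) \<partial>?S) = e3 k"
        unfolding e3_def by (simp only: norm_minus_commute)
      also have "(\<integral>\<^sup>+x. ennreal (norm (v k x) powr p) \<partial>?S) \<le> ennreal c *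
          (\<integral>\<^sup>+x. ennreal (norm (gradient (v k) x) powr p + norm (v k x) powr p) \<partial>?L)"
        by (rule C1[OF v])
      also have "(\<integral>\<^sup>+x. ennreal (norm (gradient (v k) x) powr p + norm (v k x) powr p) \<partial>?L)
          = ?W k + ?U k"
        by (subst nn_integral_add[symmetric]) auto
      also have "?W k \<le> A * W + B * e2 k"
        unfolding A_def B_def W_def e2_def by (intro nn_integral_powr_norm_le p t) measurable
      also have "?U k \<le> A * U + B * e1 k"
        unfolding A_def B_def U_def e1_def by (intro nn_integral_powr_norm_le p t) measurable
      finally show ?thesis by (simp add: add_mono mult_left_mono)
    qed
    moreover have "(\<lambda>k. A * (ennreal c * ((A * W + B * e2 k) + (A * U + B * e1 k))) + B * e3 k)
        \<longlonglongrightarrow> A * (ennreal c * ((A * W + B * 0) + (A * U + B * 0))) + B * 0"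
      using AB by (intro tendsto_add ennreal_tendsto_cmult tendsto_const e) auto
    ultimately have "N \<le> A * (ennreal c * ((A * W + B * 0) + (A * U + B * 0))) + B * 0"
      by (intro LIMSEQ_le_const) auto
    then show ?thesis by (simp add: A_def distrib_left)
  qed
  obtain d where d: "W + U = ennreal d" "0 \<le> d"
    using fin by (cases "W + U") auto
  define t where "t k = 1 / real (Suc (Suc k))" for k
  have t: "0 < t k" "t k < 1" for k by (auto simp: t_def)
  have "t \<longlonglongrightarrow> 0"
    unfolding t_def using LIMSEQ_Suc[OF LIMSEQ_inverse_real_of_nat] by (simp add: inverse_eq_divide)
  then have "(\<lambda>k. (1 - t k) powr (1 - p) * (c * ((1 - t k) powr (1 - p) * d))) \<longlonglongrightarrow>
      (1 - 0) powr (1 - p) * (c * ((1 - 0) powr (1 - p) * d))"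
    by (intro tendsto_intros) auto
  then have "(\<lambda>k. ennreal ((1 - t k) powr (1 - p) * (c * ((1 - t k) powr (1 - p) * d)))) \<longlonglongrightarrow> ennreal (c * d)"
    by (intro tendsto_ennrealI) simp
  moreover have "N \<le> ennreal ((1 - t k) powr (1 - p) * (c * ((1 - t k) powr (1 - p) * d)))" for k
    using bound[OF t] c d by (simp add: ennreal_mult)
  ultimately have "N \<le> ennreal (c * d)" by (intro LIMSEQ_le_const) auto
  also have "\<dots> = ennreal c * (W + U)" using c d by (simp add: ennreal_mult)
  also have "W + U = (\<integral>\<^sup>+x. ennreal (norm (G x) powr p + norm (u x) powr p) \<partial>?L)"
    unfolding W_def U_def by (subst nn_integral_add[symmetric]) auto
  finally show ?thesis by (simp add: N_def)
qed

lemma best_trace_const_ge: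
  assumes p: "1 < p" and c: "0 < c"
    and C1: "\<And>v. Ck_on 1 v UNIV \<Longrightarrow> (\<integral>\<^sup>+x. ennreal (norm (v x) powr p) \<partial>surface_measure \<Omega>)
      \<le> ennreal c * (\<integral>\<^sup>+x. ennreal (norm (gradient v x) powr p + norm (v x) powr p) \<partial>lebesgue_on \<Omega>)"
  shows "ennreal (1 / c) \<le> best_trace_const p \<Omega>"
proof -
  let ?A = "{(u, G, g). sobolev_W1p p \<Omega> u G \<and> has_trace p \<Omega> u G g \<and> \<not> (AE x in lebesgue_on \<Omega>. u x = 0)}"
  let ?F = "\<lambda>(u, G, g). (\<integral>\<^sup>+x. ennreal (\<bar>g x\<bar> powr p) \<partial>surface_measure \<Omega>) /
        (\<integral>\<^sup>+x. ennreal (norm (G x) powr p + \<bar>u x\<bar> powr p) \<partial>lebesgue_on \<Omega>)"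
  have "Sup (?F ` ?A) \<le> ennreal c"
  proof (rule SUP_least, clarify)
    fix u G g assume "sobolev_W1p p \<Omega> u G" "has_trace p \<Omega> u G g"
    then have le: "(\<integral>\<^sup>+x. ennreal (\<bar>g x\<bar> powr p) \<partial>surface_measure \<Omega>)
      \<le> ennreal c * (\<integral>\<^sup>+x. ennreal (norm (G x) powr p + \<bar>u x\<bar> powr p) \<partial>lebesgue_on \<Omega>)" (is "?N \<le> _ * ?D")
      using trace_inequality_limit[OF p c C1] by simp
    have "?N / ?D \<le> (ennreal c * ?D) / ?D" using le by (rule divide_right_mono_ennreal)
    also have "\<dots> \<le> ennreal c"
      by (cases "?D = 0"; cases "?D = top") (auto simp: ennreal_times_divide[symmetric] less_top)
    finally show "?N / ?D \<le> ennreal c" .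
  qed
  then have "1 / ennreal c \<le> 1 / Sup (?F ` ?A)"
    by (simp add: divide_ennreal_def inverse_ennreal_antimono)
  moreover have "1 / ennreal c = ennreal (1 / c)" using c by (simp add: divide_ennreal[symmetric])
  ultimately show ?thesis unfolding best_trace_const_def by simp
qed

text \<open>The profile for \<open>ray_trace_le\<close> is \<open>h(s) = \<phi>(s / \<mu>)\<close>, with \<open>\<phi>\<close> a fixed cubic rising from \<open>-1\<close>
  to \<open>1\<close> whose slope vanishes at both ends. By the choice of \<open>\<beta>\<close>, the difference of
  \<open>\<alpha> powr (1 - p)\<close> and \<open>(p - 1) * \<alpha>\<close> at \<open>\<alpha> = \<beta> - c / \<mu>\<close> is \<open>p * (p - 1) * c / \<mu>\<close> to first order. At the
  ends this has to dominate the curvature terms, which are \<open>m / R\<close> and \<open>- m / r\<close> divided by \<open>\<mu>\<close>. Away from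
  the ends \<open>|\<phi>|\<close> stays below one, and the term \<open>(p - 1) * \<alpha> * |\<phi>|\<close> leaves a slack bounded below independently of \<open>\<mu>\<close>.\<close>

lemma eventually_annulus_profile:
  fixes r R p \<beta> c :: real
  assumes rR: "0 < r" "r < R" and p: "1 < p" and \<beta>: "0 < \<beta>" "\<beta> powr p * (p - 1) = 1"
    and c: "real m / R < p * (p - 1) * c"
  obtains \<phi> \<phi>' :: "real \<Rightarrow> real" where
    "\<And>t. (\<phi> has_real_derivative \<phi>' t) (at t)" "\<And>t. t \<in> {r..R} \<Longrightarrow> \<bar>\<phi> t\<bar> \<le> 1" "\<phi> r = -1" "\<phi> R = 1"
    "\<forall>\<^sub>F \<mu> in at_top. 0 < \<beta> - c / \<mu> \<and> (\<forall>t\<in>{r..R}. (\<phi>' t + real m * \<phi> t / t) / \<mu>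
        + (p - 1) * (\<beta> - c / \<mu>) * \<bar>\<phi> t\<bar> \<le> (\<beta> - c / \<mu>) powr (1 - p))"
proof
  \<comment> \<open>\<open>\<tau>\<close> maps \<open>[r, R]\<close> affinely onto \<open>[-1, 1]\<close>, and \<open>(3 * \<tau> - \<tau>^3) / 2\<close> has critical points \<open>-1\<close> and \<open>1\<close>.\<close>
  define \<tau> where "\<tau> t = (2 * t - R - r) / (R - r)" for t
  define \<phi> where "\<phi> t = (3 * \<tau> t - \<tau> t ^ 3) / 2" for t
  define \<phi>' where "\<phi>' t = (3 - 3 * \<tau> t ^ 2) / (R - r)" for t
  have D\<tau>: "(\<tau> has_real_derivative 2 / (R - r)) (at t)" for t
    unfolding \<tau>_def by (rule DERIV_cdivide) (auto intro!: derivative_eq_intros)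
  show D: "(\<phi> has_real_derivative \<phi>' t) (at t)" for t
  proof -
    have "(\<phi> has_real_derivative (3 * (2 / (R - r)) - 3 * \<tau> t ^ 2 * (2 / (R - r))) / 2) (at t)"
      unfolding \<phi>_def using DERIV_power[OF D\<tau>, of 3]
      by (intro DERIV_cdivide DERIV_diff DERIV_cmult D\<tau>) (simp add: mult_ac)
    also have "(3 * (2 / (R - r)) - 3 * \<tau> t ^ 2 * (2 / (R - r))) / 2 = \<phi>' t"
    proof -
      have "(3 * (2 / k) - 3 * x * (2 / k)) / 2 = (3 - 3 * x) / k" for k x :: real
        by (simp add: diff_divide_distrib)
      then show ?thesis by (simp only: \<phi>'_def)
    qed
    finally show ?thesis .
  qed
  have \<tau>: "\<tau> t \<in> {-1..1}" if "t \<in> {r..R}" for t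
    using that rR by (auto simp: \<tau>_def field_simps)
  have ident: "1 - \<phi> t = (1 - \<tau> t)\<^sup>2 * (2 + \<tau> t) / 2" "1 + \<phi> t = (1 + \<tau> t)\<^sup>2 * (2 - \<tau> t) / 2" for t
    by (simp_all add: \<phi>_def power2_eq_square power3_eq_cube field_simps)
  show bd: "\<bar>\<phi> t\<bar> \<le> 1" if "t \<in> {r..R}" for t
  proof -
    have "0 \<le> 1 - \<phi> t" "0 \<le> 1 + \<phi> t" unfolding ident using \<tau>[OF that] by auto
    then show ?thesis by simp
  qed
  have strict: "\<bar>\<phi> t\<bar> < 1" if "t \<in> {r<..<R}" for t
  proof -
    have "-1 < \<tau> t" "\<tau> t < 1" using that rR by (auto simp: \<tau>_def field_simps)
    then have "0 < 1 - \<phi> t" "0 < 1 + \<phi> t" unfolding ident by auto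
    then show ?thesis by simp
  qed
  have \<tau>e: "\<tau> r = -1" "\<tau> R = 1" using rR by (auto simp: \<tau>_def field_simps)
  show \<phi>e: "\<phi> r = -1" "\<phi> R = 1" by (auto simp: \<phi>_def \<tau>e)
  have \<phi>'e: "\<phi>' r = 0" "\<phi>' R = 0" by (auto simp: \<phi>'_def \<tau>e)
  define A where "A t = \<phi>' t + real m * \<phi> t / t" for t
  obtain B where B: "real m / R < B" "B < p * (p - 1) * c" using c dense by blast
  have "0 \<le> real m / R" using rR by simp
  then have B0: "0 < B" using B by linarith
  have c0: "0 < c" using B0 B p by (metis less_trans zero_less_mult_pos mult_pos_pos diff_gt_0_iff_gt zero_less_one)
  have contA: "continuous_on {r..R} A" and cont\<phi>: "continuous_on X \<phi>" for X
    unfolding A_def \<phi>'_def \<phi>_def \<tau>_def using rR by (auto intro!: continuous_intros)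
  \<comment> \<open>The curvature term exceeds \<open>B\<close> only on \<open>Z\<close>, a compact set away from the ends, where \<open>|\<phi>| \<le> 1 - \<delta>\<close>.\<close>
  define Z where "Z = {t \<in> {r..R}. B \<le> A t}"
  have "A r \<le> 0" using rR by (simp add: A_def \<phi>'e \<phi>e)
  then have Zr: "r \<notin> Z" using B0 by (simp add: Z_def)
  have ZR: "R \<notin> Z" using B(1) by (simp add: Z_def A_def \<phi>'e \<phi>e)
  have Zsub: "Z \<subseteq> {r<..<R}" using Zr ZR by (force simp: Z_def less_le)
  have "closed Z"
    using continuous_closed_preimage[OF contA closed_atLeastAtMost closed_atLeast[of B]]
    by (simp add: Z_def vimage_def Int_def)
  moreover have "bounded Z" using bounded_closed_interval[of r R] by (rule bounded_subset) (auto simp: Z_def)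
  ultimately have compZ: "compact Z" by (simp add: compact_eq_bounded_closed)
  obtain \<delta> where \<delta>: "0 < \<delta>" "\<And>t. t \<in> Z \<Longrightarrow> \<bar>\<phi> t\<bar> \<le> 1 - \<delta>"
  proof (cases "Z = {}")
    case True then show ?thesis using that[of 1] by simp
  next
    case False
    obtain t0 where t0: "t0 \<in> Z" "\<And>t. t \<in> Z \<Longrightarrow> \<bar>\<phi> t\<bar> \<le> \<bar>\<phi> t0\<bar>"
      using continuous_attains_sup[OF compZ False, of "\<lambda>t. \<bar>\<phi> t\<bar>"] cont\<phi>
      by (metis continuous_on_rabs)
    have "\<bar>\<phi> t0\<bar> < 1" using t0(1) Zsub strict by blast
    then show ?thesis using that[of "1 - \<bar>\<phi> t0\<bar>"] t0(2) by simp
  qed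
  have "{r..R} \<noteq> {}" using rR by simp
  then obtain M where M: "\<And>t. t \<in> {r..R} \<Longrightarrow> A t \<le> M"
    using continuous_attains_sup[OF compact_Icc _ contA] by blast
  define e where "e x = (\<beta> - c * x) powr (1 - p) - (p - 1) * (\<beta> - c * x) - B * x" for x
  have e0: "e 0 = 0"
  proof -
    have "\<beta> powr (1 - p) = \<beta> / \<beta> powr p" using \<beta>(1) by (simp add: powr_diff)
    also have "\<dots> = (p - 1) * \<beta>" using \<beta> by (simp add: field_simps)
    finally show ?thesis by (simp add: e_def)
  qed
  have De: "(e has_real_derivative (p * (p - 1) * c - B)) (at 0)"
  proof -
    have "(e has_real_derivative ((1 - p) * \<beta> powr (1 - p - 1) * (- c) + (p - 1) * c - B)) (at 0)"
      unfolding e_def using \<beta>(1) by (auto intro!: derivative_eq_intros)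
    moreover have "\<beta> powr (1 - p - 1) = p - 1"
      using \<beta> by (simp add: powr_minus field_simps)
    moreover have "(1 - p) * (p - 1) * (- c) + (p - 1) * c - B = p * (p - 1) * c - B"
      by (simp add: algebra_simps)
    ultimately show ?thesis by (simp only:)
  qed
  obtain d where d: "0 < d" "\<And>x. 0 < x \<Longrightarrow> x < d \<Longrightarrow> 0 < e x"
    using DERIV_pos_inc_right[OF De] B(2) e0 by auto
  let ?good = "\<lambda>\<mu>. 0 < \<beta> - c / \<mu> \<and> (\<forall>t\<in>{r..R}. (\<phi>' t + real m * \<phi> t / t) / \<mu>
        + (p - 1) * (\<beta> - c / \<mu>) * \<bar>\<phi> t\<bar> \<le> (\<beta> - c / \<mu>) powr (1 - p))"
  define \<mu>0 where "\<mu>0 = max (max (1 / d) (2 * c / \<beta>)) (2 * \<bar>M\<bar> / ((p - 1) * \<beta> * \<delta>))"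
  have "?good \<mu>" if "\<mu>0 < \<mu>" for \<mu>
  proof -
    have \<mu>: "1 / d < \<mu>" "2 * c / \<beta> < \<mu>" "2 * \<bar>M\<bar> / ((p - 1) * \<beta> * \<delta>) < \<mu>"
      using that by (auto simp: \<mu>0_def)
    have \<mu>p: "0 < \<mu>" using \<mu>(1) d(1) by (meson less_trans zero_less_divide_1_iff)
    define \<alpha> where "\<alpha> = \<beta> - c / \<mu>"
    have \<alpha>: "\<beta> / 2 < \<alpha>" using \<mu>(2) \<mu>p \<beta>(1) by (simp add: \<alpha>_def field_simps)
    have "0 < e (1 / \<mu>)" using \<mu>(1) \<mu>p d by (intro d(2)) (auto simp: field_simps)
    then have main: "B / \<mu> + (p - 1) * \<alpha> \<le> \<alpha> powr (1 - p)" by (simp add: e_def \<alpha>_def)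
    have "A t / \<mu> + (p - 1) * \<alpha> * \<bar>\<phi> t\<bar> \<le> \<alpha> powr (1 - p)" if t: "t \<in> {r..R}" for t
    proof (cases "t \<in> Z")
      case False
      then have "A t / \<mu> \<le> B / \<mu>" using t \<mu>p by (intro divide_right_mono) (auto simp: Z_def)
      moreover have "(p - 1) * \<alpha> * \<bar>\<phi> t\<bar> \<le> (p - 1) * \<alpha> * 1"
        using p \<alpha> \<beta>(1) bd[OF t] by (intro mult_left_mono) auto
      ultimately show ?thesis using main by simp
    next
      case True
      have "A t / \<mu> \<le> \<bar>M\<bar> / \<mu>" using M[OF t] \<mu>p by (intro divide_right_mono) auto
      also have "\<dots> \<le> (p - 1) * (\<beta> / 2) * \<delta>"
        using \<mu>(3) \<mu>p p \<beta>(1) \<delta>(1) by (simp add: field_simps)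
      also have "\<dots> \<le> (p - 1) * \<alpha> * \<delta>"
        using p \<alpha> \<delta>(1) by (intro mult_right_mono mult_left_mono) auto
      finally have 1: "A t / \<mu> \<le> (p - 1) * \<alpha> * \<delta>" .
      have "(p - 1) * \<alpha> * \<bar>\<phi> t\<bar> \<le> (p - 1) * \<alpha> * (1 - \<delta>)"
        using p \<alpha> \<beta>(1) \<delta>(2)[OF True] by (intro mult_left_mono) auto
      with 1 have "A t / \<mu> + (p - 1) * \<alpha> * \<bar>\<phi> t\<bar> \<le> (p - 1) * \<alpha>" by (simp add: algebra_simps)
      moreover have "0 < B / \<mu>" using B0 \<mu>p by simp
      ultimately show ?thesis using main by linarith
    qed
    moreover have "0 < \<alpha>" using \<alpha> \<beta>(1) by linarith
    ultimately show ?thesis by (auto simp: \<alpha>_def A_def)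
  qed
  then show "\<forall>\<^sub>F \<mu> in at_top. ?good \<mu>"
    using eventually_gt_at_top[of \<mu>0] by (rule eventually_mono[rotated]) blast
qed

lemma eventually_best_trace_const_annulus_ge:
  fixes r R p \<beta> c \<kappa> :: real
  assumes \<kappa>: "hausdorff_factor TYPE('a::euclidean_space) \<kappa>"
    and rR: "0 < r" "r < R" and p: "1 < p" and \<beta>: "0 < \<beta>" "\<beta> powr p * (p - 1) = 1"
    and c: "real (DIM('a) - 1) / R < p * (p - 1) * c"
  shows "\<forall>\<^sub>F \<mu> in at_top. 0 < \<beta> - c / \<mu> \<and>
    ennreal ((\<beta> - c / \<mu>) powr (p - 1) / \<kappa>) \<le> best_trace_const p (annulus (\<mu> * r) (\<mu> * R) :: 'a set)"
proof -
  obtain \<phi> \<phi>' :: "real \<Rightarrow> real" where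
    \<phi>: "\<And>t. (\<phi> has_real_derivative \<phi>' t) (at t)" "\<And>t. t \<in> {r..R} \<Longrightarrow> \<bar>\<phi> t\<bar> \<le> 1" "\<phi> r = -1" "\<phi> R = 1"
    and ev: "\<forall>\<^sub>F \<mu> in at_top. 0 < \<beta> - c / \<mu> \<and> (\<forall>t\<in>{r..R}. (\<phi>' t + real (DIM('a) - 1) * \<phi> t / t) / \<mu>
        + (p - 1) * (\<beta> - c / \<mu>) * \<bar>\<phi> t\<bar> \<le> (\<beta> - c / \<mu>) powr (1 - p))"
    using eventually_annulus_profile[OF rR p \<beta> c] by blast
  show ?thesis
    using ev eventually_gt_at_top[of 0]
  proof eventually_elim
    case (elim \<mu>)
    define \<alpha> where "\<alpha> = \<beta> - c / \<mu>"
    have \<alpha>: "0 < \<alpha>" and \<mu>: "0 < \<mu>" using elim by (auto simp: \<alpha>_def)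
    have \<kappa>0: "0 < \<kappa>" using \<kappa> by (simp add: hausdorff_factor_def)
    have in_rR: "s / \<mu> \<in> {r..R}" if "s \<in> {\<mu> * r..\<mu> * R}" for s
      using that \<mu> by (auto simp: field_simps)
    have "ennreal (1 / (\<kappa> * \<alpha> powr (1 - p))) \<le> best_trace_const p (annulus (\<mu> * r) (\<mu> * R) :: 'a set)"
    proof (rule best_trace_const_ge[OF p])
      show "0 < \<kappa> * \<alpha> powr (1 - p)" using \<kappa>0 \<alpha> by simp
      fix v :: "'a \<Rightarrow> real" assume v: "Ck_on 1 v UNIV"
      show "(\<integral>\<^sup>+x. ennreal (norm (v x) powr p) \<partial>surface_measure (annulus (\<mu> * r) (\<mu> * R)))
        \<le> ennreal (\<kappa> * \<alpha> powr (1 - p)) *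
          (\<integral>\<^sup>+x. ennreal (norm (gradient v x) powr p + norm (v x) powr p) \<partial>lebesgue_on (annulus (\<mu> * r) (\<mu> * R)))"
      proof (rule annulus_trace_le_C1[OF \<kappa> p \<alpha> _ _ _ _ _ _ _ v])
        show "0 < \<mu> * r" "\<mu> * r < \<mu> * R" using \<mu> rR by auto
        show "((\<lambda>s. \<phi> (s / \<mu>)) has_real_derivative \<phi>' (s / \<mu>) / \<mu>) (at s)" for s
          using DERIV_chain2[OF \<phi>(1) DERIV_cdivide[OF DERIV_ident]] by simp
        show "\<bar>\<phi> (s / \<mu>)\<bar> \<le> 1" if "s \<in> {\<mu> * r..\<mu> * R}" for s using \<phi>(2) in_rR[OF that] .
        show "\<phi> (\<mu> * r / \<mu>) = -1" "\<phi> (\<mu> * R / \<mu>) = 1" using \<mu> \<phi> by auto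
        show "\<phi>' (s / \<mu>) / \<mu> + real (DIM('a) - 1) * \<phi> (s / \<mu>) / s + (p - 1) * \<alpha> * \<bar>\<phi> (s / \<mu>)\<bar> \<le> \<alpha> powr (1 - p)"
          if "s \<in> {\<mu> * r..\<mu> * R}" for s
        proof -
          have "real (DIM('a) - 1) * \<phi> (s / \<mu>) / (s / \<mu>) / \<mu> = real (DIM('a) - 1) * \<phi> (s / \<mu>) / s"
            using \<mu> by simp
          then show ?thesis
            using elim(1) in_rR[OF that] unfolding \<alpha>_def[symmetric] by (metis add_divide_distrib)
        qed
      qed
    qed
    moreover have "1 / (\<kappa> * \<alpha> powr (1 - p)) = \<alpha> powr (p - 1) / \<kappa>"
      using powr_minus[of \<alpha> "p - 1"] by (simp add: field_simps)
    ultimately show ?case using \<alpha> by (simp add: \<alpha>_def)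
  qed
qed

text \<open>Both sides agree to leading order; the terms of order \<open>1 / \<mu>\<close> decide.\<close>

lemma eventually_ball_bound_less:
  fixes \<rho> p \<beta> c :: real
  assumes \<rho>: "0 < \<rho>" and p: "1 < p" and \<beta>: "0 < \<beta>" "\<beta> powr p * (p - 1) = 1"
    and c: "p * (p - 1) * c < real m / \<rho>"
  shows "\<forall>\<^sub>F \<mu> in at_top. (\<beta> powr p + 1) / (p * \<beta> + real m / (\<mu> * \<rho>)) < (\<beta> - c / \<mu>) powr (p - 1)"
proof -
  have \<beta>p: "\<beta> powr p + 1 = p * \<beta> powr p" using \<beta>(2) by (simp add: algebra_simps)
  define e where "e x = (\<beta> - c * x) powr (p - 1) * (p * \<beta> + real m / \<rho> * x) - p * \<beta> powr p" for x
  have pow: "\<beta> powr (p - 1) * \<beta> = \<beta> powr p" "\<beta> powr (p - 1 - 1) * \<beta> = \<beta> powr (p - 1)"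
    using powr_add[of \<beta> "p - 1" 1] powr_add[of \<beta> "p - 1 - 1" 1] \<beta>(1) by simp_all
  have e0: "e 0 = 0" using pow(1) by (simp add: e_def mult_ac)
  have De: "(e has_real_derivative (\<beta> powr (p - 1) * (real m / \<rho> - p * (p - 1) * c))) (at 0)"
  proof -
    have "(e has_real_derivative ((p - 1) * \<beta> powr (p - 1 - 1) * (- c) * (p * \<beta>) + \<beta> powr (p - 1) * (real m / \<rho>))) (at 0)"
      unfolding e_def using \<beta>(1) \<rho> by (auto intro!: derivative_eq_intros)
    moreover have "(p - 1) * Y * (- c) * (p * \<beta>) + Y * \<beta> * (real m / \<rho>)
        = Y * \<beta> * (real m / \<rho> - p * (p - 1) * c)" for Y
      by (simp add: algebra_simps)
    ultimately show ?thesis by (simp only: pow(2)[symmetric])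
  qed
  have "0 < \<beta> powr (p - 1) * (real m / \<rho> - p * (p - 1) * c)" using \<beta>(1) c by simp
  then obtain d where d: "0 < d" "\<And>x. 0 < x \<Longrightarrow> x < d \<Longrightarrow> 0 < e x"
    using DERIV_pos_inc_right[OF De] e0 by auto
  have "(\<beta> powr p + 1) / (p * \<beta> + real m / (\<mu> * \<rho>)) < (\<beta> - c / \<mu>) powr (p - 1)" if \<mu>: "1 / d < \<mu>" for \<mu>
  proof -
    have \<mu>0: "0 < \<mu>" using \<mu> d(1) by (meson less_trans zero_less_divide_1_iff)
    have "0 < e (1 / \<mu>)" using \<mu> \<mu>0 d by (intro d(2)) (auto simp: field_simps)
    moreover have "real m / \<rho> * (1 / \<mu>) = real m / (\<mu> * \<rho>)" by simp
    ultimately have "p * \<beta> powr p < (\<beta> - c / \<mu>) powr (p - 1) * (p * \<beta> + real m / (\<mu> * \<rho>))"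
      by (simp add: e_def mult.commute[of \<rho>])
    moreover have "0 < p * \<beta> + real m / (\<mu> * \<rho>)" using p \<beta>(1) \<mu>0 \<rho> by (simp add: add_pos_nonneg)
    ultimately show ?thesis by (simp add: \<beta>p pos_divide_less_eq)
  qed
  then show ?thesis using eventually_gt_at_top[of "1 / d"] by (rule eventually_mono[rotated]) blast
qed

section \<open>Comparison\<close>

lemma Ck_on_const: "Ck_on k (\<lambda>x. c) S"
  by (induction k arbitrary: c) auto

lemma Ck_on_linear: "Ck_on k (\<lambda>x::'a::euclidean_space. c * (x \<bullet> a)) S"
proof (cases k)
  case 0 then show ?thesis by (auto intro!: continuous_intros)
next
  case (Suc k')
  have D: "((\<lambda>x. c * (x \<bullet> a)) has_derivative (\<lambda>h. c * (h \<bullet> a))) (at x)" for x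
    by (auto intro!: derivative_eq_intros)
  have "frechet_derivative (\<lambda>x. c * (x \<bullet> a)) (at x) = (\<lambda>h. c * (h \<bullet> a))" for x
    using frechet_derivative_at[OF D] by simp
  then show ?thesis
    using D by (auto simp: Suc Ck_on_const differentiable_on_def differentiable_def intro: has_derivative_at_withinI)
qed

lemma quadratic_smooth_gradient:
  fixes c d :: real
  shows "smooth_on (\<lambda>y::'a::euclidean_space. c * (y \<bullet> y) + d) S"
    "gradient (\<lambda>y::'a. c * (y \<bullet> y) + d) x = (2 * c) *\<^sub>R x"
proof -
  have D: "((\<lambda>y. c * (y \<bullet> y) + d) has_derivative (\<lambda>h. 2 * c * (x \<bullet> h))) (at x)" for x :: 'a
    by (auto intro!: derivative_eq_intros simp: inner_commute fun_eq_iff)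
  have fd: "frechet_derivative (\<lambda>y::'a. c * (y \<bullet> y) + d) (at x) = (\<lambda>h. 2 * c * (x \<bullet> h))" for x :: 'a
    using frechet_derivative_at[OF D] by simp
  have "Ck_on k (\<lambda>y::'a. c * (y \<bullet> y) + d) S" for k
  proof (cases k)
    case 0 then show ?thesis by (auto intro!: continuous_intros)
  next
    case (Suc k')
    then show ?thesis
      using D by (auto simp: fd Ck_on_linear differentiable_on_def differentiable_def intro: has_derivative_at_withinI)
  qed
  then show "smooth_on (\<lambda>y::'a. c * (y \<bullet> y) + d) S" by (simp add: smooth_on_def)
  have "gradient (\<lambda>y::'a. c * (y \<bullet> y) + d) x = (2 * c) *\<^sub>R (\<Sum>b\<in>Basis. (x \<bullet> b) *\<^sub>R b)"
    by (simp add: gradient_def fd scaleR_sum_right)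
  then show "gradient (\<lambda>y::'a. c * (y \<bullet> y) + d) x = (2 * c) *\<^sub>R x"
    by (simp add: euclidean_representation)
qed

lemma inner_self_less_iff:
  fixes y :: "'a::real_inner"
  assumes "0 \<le> s"
  shows "y \<bullet> y < s\<^sup>2 \<longleftrightarrow> norm y < s" "s\<^sup>2 < y \<bullet> y \<longleftrightarrow> s < norm y"
  using assms by (auto simp: power2_norm_eq_inner[symmetric] power_mono_iff abs_le_square_iff[symmetric] power2_less_imp_less
      intro: power_strict_mono)

text \<open>A local defining function is \<open>r\<^sup>2 - |y|\<^sup>2\<close> near the inner sphere and \<open>|y|\<^sup>2 - R\<^sup>2\<close> near the outer one.\<close>

lemma smooth_bounded_domain_annulus:
  assumes dim: "2 \<le> DIM('a::euclidean_space)" and rR: "0 < r" "r < R"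
  shows "smooth_bounded_domain (annulus r R :: 'a set)"
  unfolding smooth_bounded_domain_def
proof (intro conjI)
  show "open (annulus r R :: 'a set)" by (rule open_annulus)
  show "connected (annulus r R :: 'a set)"
    using connected_annulus(1)[OF dim, of r 0 R] by (simp add: annulus_def)
  obtain e :: 'a where e: "norm e = 1" using norm_Basis nonempty_Basis by blast
  have "((r + R) / 2) *\<^sub>R e \<in> annulus r R" using e rR by (auto simp: annulus_def)
  then show "(annulus r R :: 'a set) \<noteq> {}" by blast
  show "bounded (annulus r R :: 'a set)"
    by (rule bounded_subset[OF bounded_ball[of 0 R]]) (auto simp: annulus_def)
  show "smooth_boundary (annulus r R :: 'a set)"
    unfolding smooth_boundary_def
  proof
    fix x :: 'a assume "x \<in> frontier (annulus r R)"
    then consider "norm x = r" | "norm x = R" using frontier_annulus_subset by force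
    then show "\<exists>W \<psi>. open W \<and> x \<in> W \<and> smooth_on \<psi> W \<and>
        (\<forall>y\<in>W. gradient \<psi> y \<noteq> 0) \<and> annulus r R \<inter> W = {y \<in> W. \<psi> y < 0}"
    proof cases
      case 1
      then show ?thesis
        using rR open_annulus[of 0 R]
        by (intro exI[of _ "annulus 0 R"] exI[of _ "\<lambda>y. (-1) * (y \<bullet> y) + r\<^sup>2"] conjI
            quadratic_smooth_gradient(1) ballI)
          (auto simp only: quadratic_smooth_gradient(2), auto simp: annulus_def inner_self_less_iff)
    next
      case 2
      have "open {y :: 'a. r < norm y}" by (intro open_Collect_less continuous_intros)
      then show ?thesis
        using 2 rR
        by (intro exI[of _ "{y. r < norm y}"] exI[of _ "\<lambda>y. 1 * (y \<bullet> y) + (- R\<^sup>2)"] conjI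
            quadratic_smooth_gradient(1) ballI)
          (auto simp only: quadratic_smooth_gradient(2), auto simp: annulus_def inner_self_less_iff)
    qed
  qed
qed

lemma emeasure_annulus:
  assumes "0 \<le> r" "r < R"
  shows "emeasure lborel (annulus r R :: 'a::euclidean_space set)
    = ennreal (unit_ball_vol (real DIM('a)) * (R ^ DIM('a) - r ^ DIM('a)))"
proof -
  have "(annulus r R :: 'a set) = ball 0 R - cball 0 r" by (auto simp: annulus_def)
  moreover have "emeasure lborel (ball (0::'a) R - cball 0 r) = emeasure lborel (ball (0::'a) R) - emeasure lborel (cball (0::'a) r)"
    using assms by (intro emeasure_Diff) (auto simp: emeasure_cball)
  ultimately show ?thesis
    using assms by (simp add: emeasure_ball emeasure_cball ennreal_minus right_diff_distrib)
qed

lemma scaleR_image_ball_0: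
  assumes "0 < \<mu>"
  shows "(*\<^sub>R) \<mu> ` ball (0 :: 'a::euclidean_space) \<rho> = ball 0 (\<mu> * \<rho>)"
proof (intro subset_antisym subsetI)
  fix x :: 'a assume "x \<in> ball 0 (\<mu> * \<rho>)"
  then show "x \<in> (*\<^sub>R) \<mu> ` ball 0 \<rho>"
    using assms by (intro image_eqI[of _ _ "x /\<^sub>R \<mu>"]) (auto simp: field_simps)
qed (use assms in auto)

lemma scaleR_image_annulus:
  assumes "0 < \<mu>"
  shows "(*\<^sub>R) \<mu> ` (annulus r R :: 'a::euclidean_space set) = annulus (\<mu> * r) (\<mu> * R)"
proof (intro subset_antisym subsetI)
  fix x :: 'a assume "x \<in> annulus (\<mu> * r) (\<mu> * R)"
  then show "x \<in> (*\<^sub>R) \<mu> ` annulus r R"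
    using assms by (intro image_eqI[of _ _ "x /\<^sub>R \<mu>"]) (auto simp: annulus_def field_simps)
qed (use assms in \<open>auto simp: annulus_def\<close>)

lemma eventually_best_trace_const_ball_less_annulus:
  fixes p r \<rho> R :: real
  assumes dim: "2 \<le> DIM('a::euclidean_space)" and p: "1 < p"
    and r: "0 < r" "r < \<rho>" "\<rho> < R"
  shows "\<forall>\<^sub>F \<mu> in at_top. \<forall>a::'a. best_trace_const p (ball a (\<mu> * \<rho>))
    < best_trace_const p (annulus (\<mu> * r) (\<mu> * R) :: 'a set)"
proof -
  let ?m = "DIM('a) - 1"
  obtain \<kappa> where \<kappa>: "hausdorff_factor TYPE('a) \<kappa>"
    using hausdorff_sphere_integral[OF dim] unfolding hausdorff_factor_def by metis
  have \<kappa>0: "0 < \<kappa>" using \<kappa> by (simp add: hausdorff_factor_def)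
  have m: "0 < real ?m" using dim by simp
  define \<beta> where "\<beta> = (1 / (p - 1)) powr (1 / p)"
  have \<beta>: "0 < \<beta>" "\<beta> powr p * (p - 1) = 1" using p by (auto simp: \<beta>_def powr_powr)
  have "real ?m / R < real ?m / \<rho>" using m r by (intro divide_strict_left_mono) auto
  then obtain B where B: "real ?m / R < B" "B < real ?m / \<rho>" using dense by blast
  define c where "c = B / (p * (p - 1))"
  have c: "p * (p - 1) * c = B" using p by (simp add: c_def)
  have "\<forall>\<^sub>F \<mu> in at_top. 0 < \<beta> - c / \<mu> \<and>
      ennreal ((\<beta> - c / \<mu>) powr (p - 1) / \<kappa>) \<le> best_trace_const p (annulus (\<mu> * r) (\<mu> * R) :: 'a set)"
    using r p \<beta> B(1) by (intro eventually_best_trace_const_annulus_ge[OF \<kappa>]) (auto simp: c)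
  moreover have "\<forall>\<^sub>F \<mu> in at_top. (\<beta> powr p + 1) / (p * \<beta> + real ?m / (\<mu> * \<rho>)) < (\<beta> - c / \<mu>) powr (p - 1)"
    using r p \<beta> B(2) by (intro eventually_ball_bound_less) (auto simp: c)
  ultimately show ?thesis using eventually_gt_at_top[of 0]
  proof eventually_elim
    case (elim \<mu>)
    have L: "0 < \<mu> * \<rho>" using elim r by simp
    show ?case
    proof
      fix a :: 'a
      have "best_trace_const p (ball a (\<mu> * \<rho>)) \<le> ennreal ((\<beta> powr p + 1) / (\<kappa> * (p * \<beta> + real ?m / (\<mu> * \<rho>))))"
        by (rule best_trace_const_ball_le[OF \<kappa> p \<beta>(1) L])
      also have "\<dots> = ennreal ((\<beta> powr p + 1) / (p * \<beta> + real ?m / (\<mu> * \<rho>)) / \<kappa>)"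
        by (simp add: mult.commute)
      also have "\<dots> < ennreal ((\<beta> - c / \<mu>) powr (p - 1) / \<kappa>)"
        using elim \<kappa>0 by (intro ennreal_lessI divide_strict_right_mono) auto
      also have "\<dots> \<le> best_trace_const p (annulus (\<mu> * r) (\<mu> * R) :: 'a set)" using elim by simp
      finally show "best_trace_const p (ball a (\<mu> * \<rho>)) < best_trace_const p (annulus (\<mu> * r) (\<mu> * R) :: 'a set)" .
    qed
  qed
qed

theorem mainTheorem8:
  fixes p r \<rho> R :: real
  assumes "2 \<le> CARD('n::finite)"
    and "1 < p"
    and "0 < r" and "r < \<rho>" and "\<rho> < R"
    and "R ^ CARD('n) - r ^ CARD('n) = \<rho> ^ CARD('n)"
  shows "emeasure lborel (ball (0 :: real ^ 'n) \<rho>) = emeasure lborel (annulus r R :: (real ^ 'n) set)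
    \<and> (\<forall>\<^sub>F \<mu> in at_top.
         best_trace_const p ((*\<^sub>R) \<mu> ` ball (0 :: real ^ 'n) \<rho>)
           < best_trace_const p ((*\<^sub>R) \<mu> ` (annulus r R :: (real ^ 'n) set))
         \<and> (\<exists>\<Omega> :: (real ^ 'n) set. smooth_bounded_domain \<Omega>
              \<and> emeasure lborel \<Omega> = emeasure lborel ((*\<^sub>R) \<mu> ` ball (0 :: real ^ 'n) \<rho>)
              \<and> (\<forall>a :: real ^ 'n. best_trace_const p (ball a (\<mu> * \<rho>)) < best_trace_const p \<Omega>)))"
proof -
  have dim: "2 \<le> DIM(real ^ 'n)" using assms(1) by simp
  have vol: "emeasure lborel (annulus (\<mu> * r) (\<mu> * R) :: (real ^ 'n) set)
      = emeasure lborel (ball (0 :: real ^ 'n) (\<mu> * \<rho>))" if "0 < \<mu>" for \<mu>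
    using assms(3-6) that
    by (simp add: emeasure_annulus emeasure_ball power_mult_distrib right_diff_distrib[symmetric])
  have eq: "emeasure lborel (ball (0 :: real ^ 'n) \<rho>) = emeasure lborel (annulus r R :: (real ^ 'n) set)"
    using vol[of 1] by simp
  have smooth: "smooth_bounded_domain (annulus (\<mu> * r) (\<mu> * R) :: (real ^ 'n) set)" if "0 < \<mu>" for \<mu>
    using assms(3-5) that by (intro smooth_bounded_domain_annulus dim) auto
  show ?thesis
    by (rule conjI[OF eq], rule eventually_mono[OF eventually_conj[OF
          eventually_best_trace_const_ball_less_annulus[OF dim assms(2-5)] eventually_gt_at_top[of 0]]])
       (use vol smooth in \<open>auto simp: scaleR_image_ball_0 scaleR_image_annulus\<close>)
qed

end
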